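(* Let $F$ be Thompson's group $F$ and let $f\in F$ be an element whose image in the abelianization $F/[F,F]$ of $F$ is non-trivial. Then there is an element $g\in F$ such that the subgroup $\langle f,g\rangle$ is isomorphic to $F$ and has finite index in $F$.
   Context: Thompson's group $F$ is the group (under composition) of all piecewise-linear homeomorphisms of the interval $[0,1]$ with finitely many breakpoints, where all breakpoints are dyadic fractions (numbers in $\mathbb{Z}[\frac12]\cap(0,1)$) and all slopes are integer powers of $2$. (In particular its elements fix $0$ and $1$.) The standard abelianization map $\pi_{ab}\colon F\to\mathbb{Z}^2$ is the surjective homomorphism $\pi_{ab}(f)=(\log_2 f'(0^+),\log_2 f'(1^-))$, whose kernel is the derived subgroup $[F,F]$; so the image of $f$ in the abelianization is non-trivial if and only if $\pi_{ab}(f)\neq(0,0)$. *)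

theory Defs
  imports "HOL-Analysis.Analysis" "HOL-Algebra.Algebra"
begin

text \<open>The library's \<^const>\<open>dyadics\<close> contains only the nonnegative dyadic fractions; inside the
  open unit interval these are all of them. The finite set \<open>B\<close> below may contain
  points at which the slope does not change. Slopes are positive, so the homeomorphisms are
  automatically increasing and fix the endpoints.\<close>

definition dyadic_PL :: "(real \<Rightarrow> real) \<Rightarrow> bool" where
  "dyadic_PL f \<longleftrightarrow>
     (\<exists>B. finite B \<and> B \<subseteq> dyadics \<inter> {0<..<1} \<and>
        (\<forall>a b. 0 \<le> a \<and> a < b \<and> b \<le> 1 \<and> {a<..<b} \<inter> B = {} \<longrightarrow>
           (\<exists>(k::int) c. \<forall>x\<in>{a..b}. f x = 2 powi k * x + c)))"

text \<open>As in \<^const>\<open>BijGroup\<close>, elements are extensional, i.e. undefined outside the unit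
  interval, so that equality of elements is equality of maps of the interval.\<close>

definition thompson_F :: "(real \<Rightarrow> real) monoid" where
  "thompson_F = (BijGroup {0..1})
     \<lparr>carrier := {f \<in> extensional {0..1}.
        (\<exists>f'. homeomorphism {0..1} {0..1} f f') \<and> dyadic_PL f}\<rparr>"

definition abelianization :: "('a, 'b) monoid_scheme \<Rightarrow> 'a set monoid" where
  "abelianization G = G Mod derived G (carrier G)"

definition to_abelianization :: "('a, 'b) monoid_scheme \<Rightarrow> 'a \<Rightarrow> 'a set" where
  "to_abelianization G x = derived G (carrier G) #>\<^bsub>G\<^esub> x"

end

theory Submission
  imports Defs
begin

text \<open>
  An element \<open>f\<close> with non-trivial image in the abelianization has a slope different from \<open>1\<close> at one of
  the end points (lemma \<open>trivial_slopes_imp_derived\<close>). Reversing the interval and inverting \<open>f\<close>, one may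
  suppose that \<open>f x = 2\<^sup>-\<^sup>k x\<close> near \<open>0\<close> with \<open>k > 0\<close>. The partner \<open>g\<close> has slope \<open>1\<close> at \<open>0\<close> and slope \<open>2\<^sup>d\<close>
  at \<open>1\<close>, where \<open>d > 0\<close> divides the exponent of the slope of \<open>f\<close> at \<open>1\<close>. If \<open>f\<close> and \<open>g\<close> generate all
  elements that are trivial near both end points, they generate exactly the elements whose slope
  exponents at \<open>0\<close> and \<open>1\<close> are divisible by \<open>k\<close> and \<open>d\<close>. This group clearly has finite index. It is
  isomorphic to \<open>F\<close>, because conjugation by a homeomorphism that turns halving into division by \<open>2\<^sup>k\<close>
  near \<open>0\<close> multiplies the slope exponent at \<open>0\<close> by \<open>k\<close>, and likewise at \<open>1\<close> (\<open>TF_div_iso\<close>).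

  The choice of \<open>g\<close> is made in \<open>exists_partner\<close>. Most of \<open>g\<close> is a map that fixes the points up to a
  small \<open>a\<^sub>0\<close> and pushes all other points of the open interval towards \<open>a\<^sub>0\<close>. Below \<open>a\<^sub>0\<close>, where \<open>f\<close> is
  multiplication by \<open>2\<^sup>-\<^sup>k\<close>, there are disjoint intervals \<open>E i\<close> with \<open>f (E i) = E (i + 1)\<close>; on \<open>E 4\<close> and
  \<open>E 7\<close> the map \<open>g\<close> acts as a small copy of the standard generators \<open>x\<^sub>0\<close> and \<open>x\<^sub>1\<close> of \<open>F\<close>. The commutator
  \<open>a\<close> of \<open>f\<close> and \<open>g\<close> is trivial near \<open>1\<close>, so powers of \<open>g\<close> and then of \<open>f\<close> can push the large part of
  its support below itself. For a suitable conjugate \<open>b\<close> of \<open>a\<close> the two supports then meet only in \<open>E 7\<close>,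
  where \<open>a\<close> is a copy of the inverse of \<open>x\<^sub>1\<close> and \<open>b\<close> is a copy of \<open>x\<^sub>0\<close>. Thus the commutator of \<open>a\<close> and \<open>b\<close>
  is a copy in \<open>E 7\<close> of a commutator of the generators. Conjugation by \<open>g\<close> and by a conjugate of \<open>g\<close>,
  which act on \<open>E 7\<close> as the two generators, produces a copy of its normal closure in \<open>F\<close>, and this normal
  closure contains all elements that are trivial near the end points
  (\<open>TF_cpt_subset_normal_closure\<close>). Finally the maps \<open>f\<close> and \<open>g\<close> can squeeze every compact part of the
  open interval into \<open>E 7\<close>.

  Both this and the description of the kernel of the slope map rest on the fact that \<open>F\<close> is generated by
  \<open>x\<^sub>0\<close> and \<open>x\<^sub>1\<close> (\<open>TF_generated\<close>). All of it is carried out for maps of the whole line that are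
  the identity off the unit interval, so that composition and inverse are those of plain functions.
\<close>

section \<open>Dyadic numbers and one-sided germs\<close>

text \<open>Negative numbers are included, since the constants of affine pieces can be negative.\<close>

definition dyadic :: "real set" where
  "dyadic = {x. \<exists>n::nat. x * 2 ^ n \<in> \<int>}"

lemma dyadic_Ints: "x \<in> \<int> \<Longrightarrow> x \<in> dyadic"
  unfolding dyadic_def by (auto intro!: exI[of _ 0])

lemma dyadic_of_nat [simp]: "of_nat k \<in> dyadic"
  and dyadic_numeral [simp]: "numeral w \<in> dyadic"
  and dyadic_0 [simp]: "0 \<in> dyadic"
  and dyadic_1 [simp]: "1 \<in> dyadic"
  by (auto intro: dyadic_Ints)

lemma dyadic_common:
  assumes "x \<in> dyadic" "y \<in> dyadic"
  obtains n :: nat where "x * 2 ^ n \<in> \<int>" "y * 2 ^ n \<in> \<int>"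
proof -
  obtain a b :: nat where a: "x * 2 ^ a \<in> \<int>" and b: "y * 2 ^ b \<in> \<int>"
    using assms by (auto simp: dyadic_def)
  have "x * 2 ^ (a + b) = (x * 2 ^ a) * 2 ^ b" "y * 2 ^ (a + b) = (y * 2 ^ b) * 2 ^ a"
    by (simp_all add: power_add)
  moreover have "(x * 2 ^ a) * 2 ^ b \<in> \<int>" "(y * 2 ^ b) * 2 ^ a \<in> \<int>"
    using a b by (auto intro!: Ints_mult Ints_power)
  ultimately show ?thesis
    using that by metis
qed

lemma dyadic_add [intro]: "x \<in> dyadic \<Longrightarrow> y \<in> dyadic \<Longrightarrow> x + y \<in> dyadic"
  by (erule (1) dyadic_common) (metis (mono_tags, lifting) Ints_add distrib_right dyadic_def mem_Collect_eq)

lemma dyadic_uminus [intro]: "x \<in> dyadic \<Longrightarrow> - x \<in> dyadic"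
  by (auto simp: dyadic_def)

lemma dyadic_diff [intro]: "x \<in> dyadic \<Longrightarrow> y \<in> dyadic \<Longrightarrow> x - y \<in> dyadic"
  using dyadic_add[of x "- y"] by auto

lemma dyadic_mult [intro]:
  assumes "x \<in> dyadic" "y \<in> dyadic" shows "x * y \<in> dyadic"
proof -
  obtain a b :: nat where "x * 2 ^ a \<in> \<int>" "y * 2 ^ b \<in> \<int>"
    using assms by (auto simp: dyadic_def)
  then have "(x * 2 ^ a) * (y * 2 ^ b) \<in> \<int>"
    by (rule Ints_mult)
  then show ?thesis
    unfolding dyadic_def by (auto intro!: exI[of _ "a + b"] simp: power_add ac_simps)
qed

lemma dyadic_half [simp]: "1 / 2 \<in> dyadic"
  unfolding dyadic_def by (auto intro!: exI[of _ 1])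

lemma dyadic_power [simp, intro]: "x \<in> dyadic \<Longrightarrow> x ^ n \<in> dyadic"
  by (induction n) auto

lemma dyadic_powi [simp]: "2 powi k \<in> dyadic"
proof (cases "k \<ge> 0")
  case False
  then have "2 powi k = (1/2::real) ^ nat (- k)"
    by (simp add: power_int_def power_one_over inverse_eq_divide)
  then show ?thesis by simp
qed (auto simp: power_int_def)

lemma dyadic_powi_mult_iff: "2 powi k * x \<in> dyadic \<longleftrightarrow> x \<in> dyadic"
proof
  assume "2 powi k * x \<in> dyadic"
  then have "2 powi (-k) * (2 powi k * x) \<in> dyadic"
    by (rule dyadic_mult[OF dyadic_powi])
  moreover have "2 powi (-k) * (2 powi k * x) = x"
    by (simp add: power_int_minus)
  ultimately show "x \<in> dyadic" by simp
qed auto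

lemma dyadics_eq: "dyadics \<inter> {0<..<1} = dyadic \<inter> {0<..<1::real}"
proof (intro equalityI subsetI)
  fix x :: real assume "x \<in> dyadics \<inter> {0<..<1}"
  then obtain k m where x: "x = of_nat k / 2 ^ m" "0 < x" "x < 1"
    by (auto simp: dyadics_def)
  have "x * 2 ^ m \<in> \<int>" by (simp add: x(1))
  then have "x \<in> dyadic" unfolding dyadic_def by blast
  with x show "x \<in> dyadic \<inter> {0<..<1}" by simp
next
  fix x :: real assume x: "x \<in> dyadic \<inter> {0<..<1}"
  then obtain n where n: "x * 2 ^ n \<in> \<int>" by (auto simp: dyadic_def)
  then obtain z where z: "x * 2 ^ n = of_int z" by (auto simp: Ints_def)
  moreover have "x * 2 ^ n \<ge> 0" using x by simp
  ultimately have "z \<ge> 0" by simp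
  then have "x = of_nat (nat z) / 2 ^ n"
    using z by (simp add: field_simps)
  with x show "x \<in> dyadics \<inter> {0<..<1}"
    unfolding dyadics_def by blast
qed

text \<open>The parameter \<open>s\<close> is \<open>1\<close> for the right-hand and \<open>-1\<close> for the left-hand germ; treating
  both sides by one formula halves the calculus below.\<close>

definition germ :: "real \<Rightarrow> (real \<Rightarrow> real) \<Rightarrow> real \<Rightarrow> int \<Rightarrow> bool" where
  "germ s f x k \<longleftrightarrow> (\<forall>\<^sub>F t in at_right 0. f (x + s * t) = f x + s * (2 powi k * t))"

lemma eventually_at_right_0_scale:
  fixes P :: "real \<Rightarrow> bool"
  assumes "\<forall>\<^sub>F t in at_right 0. P t" "c > 0"
  shows "\<forall>\<^sub>F t in at_right 0. P (c * t)"
proof -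
  obtain b where b: "b > 0" "\<And>t. 0 < t \<Longrightarrow> t < b \<Longrightarrow> P t"
    using assms(1) by (auto simp: eventually_at_right_field)
  show ?thesis
    unfolding eventually_at_right_field
    by (rule exI[of _ "b / c"]) (use b assms(2) in \<open>auto simp: field_simps\<close>)
qed

lemma germ_comp:
  assumes "germ s g x l" "germ s f (g x) k"
  shows "germ s (f \<circ> g) x (k + l)"
proof -
  have "\<forall>\<^sub>F t in at_right 0. f (g x + s * (2 powi l * t)) = f (g x) + s * (2 powi k * (2 powi l * t))"
    using eventually_at_right_0_scale[OF assms(2)[unfolded germ_def], of "2 powi l"] by simp
  with assms(1)[unfolded germ_def] show ?thesis
    unfolding germ_def by eventually_elim (simp add: power_int_add ac_simps)
qed

abbreviation finv :: "('a \<Rightarrow> 'b) \<Rightarrow> 'b \<Rightarrow> 'a" where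
  "finv f \<equiv> inv_into UNIV f"

lemma germ_finv:
  assumes "germ s f x k" "inj f"
  shows "germ s (finv f) (f x) (- k)"
proof -
  have "\<forall>\<^sub>F t in at_right 0. f (x + s * (2 powi (-k) * t)) = f x + s * (2 powi k * (2 powi (-k) * t))"
    using eventually_at_right_0_scale[OF assms(1)[unfolded germ_def], of "2 powi (-k)"] by simp
  then show ?thesis
    unfolding germ_def
  proof eventually_elim
    case (elim t)
    have "2 powi k * (2 powi (-k) * t) = t"
      by (simp add: power_int_minus)
    with elim have "f x + s * t = f (x + s * (2 powi (-k) * t))" by simp
    then show ?case using assms(2) by simp
  qed
qed

lemma germ_unique:
  assumes "germ s f x k" "germ s f x l" "s \<noteq> 0"
  shows "k = l"
proof -
  have "\<forall>\<^sub>F t in at_right (0::real). 2 powi k = (2 powi l :: real)"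
    using assms(1,2)[unfolded germ_def] eventually_at_right_less[of 0]
    by eventually_elim (use assms(3) in auto)
  then have "2 powi k = (2 powi l :: real)" by simp
  then have "\<not> k < l" "\<not> l < k"
    using power_int_strict_increasing[of k l "2::real"] power_int_strict_increasing[of l k "2::real"]
    by fastforce+
  then show ?thesis by linarith
qed

lemma germ_cong:
  assumes "\<forall>\<^sub>F t in at_right 0. f (x + s * t) = g (x + s * t)" "f x = g x"
  shows "germ s f x k \<longleftrightarrow> germ s g x k"
proof
  assume "germ s f x k"
  then show "germ s g x k" unfolding germ_def using assms(1)
    by eventually_elim (use assms(2) in simp)
next
  assume "germ s g x k"
  then show "germ s f x k" unfolding germ_def using assms(1)
    by eventually_elim (use assms(2) in simp)
qed

lemma germ_affine: "germ s (\<lambda>y. 2 powi k * y + c) x k"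
  unfolding germ_def by (simp add: algebra_simps)

lemma germ_id: "germ s id x 0" "germ s (\<lambda>x. x) x 0"
  by (simp_all add: germ_def)

lemma germ_right_interval:
  "germ 1 f x k \<longleftrightarrow> (\<exists>d>0. \<forall>y\<in>{x..x + d}. f y = f x + 2 powi k * (y - x))"
proof
  assume "germ 1 f x k"
  then obtain b where b: "b > 0" "\<And>t. 0 < t \<Longrightarrow> t < b \<Longrightarrow> f (x + t) = f x + 2 powi k * t"
    unfolding germ_def eventually_at_right_field by auto
  have "f y = f x + 2 powi k * (y - x)" if "y \<in> {x..x + b / 2}" for y
  proof (cases "y = x")
    case False
    with that b(1) have "0 < y - x" "y - x < b" by auto
    from b(2)[OF this] show ?thesis by (metis add.commute diff_add_cancel)
  qed simp
  then show "\<exists>d>0. \<forall>y\<in>{x..x + d}. f y = f x + 2 powi k * (y - x)"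
    using b(1) by (intro exI[of _ "b / 2"] conjI ballI half_gt_zero)
next
  assume "\<exists>d>0. \<forall>y\<in>{x..x + d}. f y = f x + 2 powi k * (y - x)"
  then obtain d where d: "d > 0" "\<forall>y\<in>{x..x + d}. f y = f x + 2 powi k * (y - x)" by blast
  have "f (x + t) = f x + 2 powi k * t" if "0 < t" "t < d" for t
  proof -
    have "x + t \<in> {x..x + d}" using that by simp
    from bspec[OF d(2) this] show ?thesis by (metis add_diff_cancel_left')
  qed
  then show "germ 1 f x k"
    unfolding germ_def eventually_at_right_field by (intro exI[of _ d] conjI d(1)) simp
qed

lemma germ_left_interval:
  "germ (-1) f x k \<longleftrightarrow> (\<exists>d>0. \<forall>y\<in>{x - d..x}. f y = f x - 2 powi k * (x - y))"
proof
  assume "germ (-1) f x k"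
  then obtain b where b: "b > 0" "\<And>t. 0 < t \<Longrightarrow> t < b \<Longrightarrow> f (x - t) = f x - 2 powi k * t"
    unfolding germ_def eventually_at_right_field by auto
  have "f y = f x - 2 powi k * (x - y)" if "y \<in> {x - b / 2..x}" for y
  proof (cases "y = x")
    case False
    with that b(1) have "0 < x - y" "x - y < b" by auto
    from b(2)[OF this] show ?thesis by (metis diff_diff_eq2 add_diff_cancel_left')
  qed simp
  then show "\<exists>d>0. \<forall>y\<in>{x - d..x}. f y = f x - 2 powi k * (x - y)"
    using b(1) by (intro exI[of _ "b / 2"] conjI ballI half_gt_zero)
next
  assume "\<exists>d>0. \<forall>y\<in>{x - d..x}. f y = f x - 2 powi k * (x - y)"
  then obtain d where d: "d > 0" "\<forall>y\<in>{x - d..x}. f y = f x - 2 powi k * (x - y)" by blast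
  have "f (x - t) = f x - 2 powi k * t" if "0 < t" "t < d" for t
  proof -
    have "x - t \<in> {x - d..x}" using that by simp
    from bspec[OF d(2) this] show ?thesis by (metis diff_diff_eq2 add_diff_cancel_left')
  qed
  then show "germ (-1) f x k"
    unfolding germ_def eventually_at_right_field by (intro exI[of _ d] conjI d(1)) simp
qed

lemma germ_rightI:
  "d > 0 \<Longrightarrow> (\<And>y. x \<le> y \<Longrightarrow> y \<le> x + d \<Longrightarrow> f y = f x + 2 powi k * (y - x)) \<Longrightarrow> germ 1 f x k"
  and germ_leftI:
  "d > 0 \<Longrightarrow> (\<And>y. x - d \<le> y \<Longrightarrow> y \<le> x \<Longrightarrow> f y = f x - 2 powi k * (x - y)) \<Longrightarrow> germ (-1) f x k"
  unfolding germ_right_interval germ_left_interval by (meson atLeastAtMost_iff)+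

section \<open>Piecewise linear maps of the line with dyadic breakpoints\<close>

text \<open>The condition defining \<open>F\<close>, at a single point. Because it is local, closure under composition, inversion and
  conjugation by maps with infinitely many breakpoints needs no bookkeeping of partitions.\<close>

definition PL_at :: "(real \<Rightarrow> real) \<Rightarrow> real \<Rightarrow> bool" where
  "PL_at f x \<longleftrightarrow> (\<exists>k l. germ 1 f x k \<and> germ (-1) f x l \<and>
     f x - 2 powi k * x \<in> dyadic \<and> f x - 2 powi l * x \<in> dyadic \<and> (x \<in> dyadic \<or> k = l))"

text \<open>This is what keeps breakpoints dyadic under composition and inversion.\<close>

lemma PL_at_dyadic_iff:
  assumes "PL_at f x"
  shows "f x \<in> dyadic \<longleftrightarrow> x \<in> dyadic"
proof -
  obtain k where k: "f x - 2 powi k * x \<in> dyadic"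
    using assms by (auto simp: PL_at_def)
  then have "f x \<in> dyadic \<longleftrightarrow> 2 powi k * x \<in> dyadic"
    using dyadic_add[OF k, of "2 powi k * x"] dyadic_diff[OF _ k, of "f x"] by auto
  then show ?thesis by (simp add: dyadic_powi_mult_iff)
qed

lemma PL_at_comp:
  assumes g: "PL_at g x" and f: "PL_at f (g x)"
  shows "PL_at (f \<circ> g) x"
proof -
  obtain k l where g': "germ 1 g x k" "germ (-1) g x l"
     "g x - 2 powi k * x \<in> dyadic" "g x - 2 powi l * x \<in> dyadic" "x \<in> dyadic \<or> k = l"
    using g by (auto simp: PL_at_def)
  obtain k' l' where f': "germ 1 f (g x) k'" "germ (-1) f (g x) l'"
     "f (g x) - 2 powi k' * g x \<in> dyadic" "f (g x) - 2 powi l' * g x \<in> dyadic"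
     "g x \<in> dyadic \<or> k' = l'"
    using f by (auto simp: PL_at_def)
  have *: "f (g x) - 2 powi (i + j) * x \<in> dyadic"
    if "f (g x) - 2 powi i * g x \<in> dyadic" "g x - 2 powi j * x \<in> dyadic" for i j
  proof -
    have "f (g x) - 2 powi (i + j) * x =
       (f (g x) - 2 powi i * g x) + 2 powi i * (g x - 2 powi j * x)"
      by (simp add: power_int_add algebra_simps)
    moreover have "2 powi i * (g x - 2 powi j * x) \<in> dyadic"
      using that(2) by (simp only: dyadic_powi_mult_iff)
    ultimately show ?thesis using that(1) dyadic_add by metis
  qed
  show ?thesis
    unfolding PL_at_def
    using germ_comp[OF g'(1) f'(1)] germ_comp[OF g'(2) f'(2)] *[OF f'(3) g'(3)] *[OF f'(4) g'(4)]
      g'(5) f'(5) PL_at_dyadic_iff[OF g]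
    by (intro exI[of _ "k' + k"] exI[of _ "l' + l"]) auto
qed

lemma PL_at_finv:
  assumes "PL_at f x" "inj f"
  shows "PL_at (finv f) (f x)"
proof -
  obtain k l where f': "germ 1 f x k" "germ (-1) f x l"
     "f x - 2 powi k * x \<in> dyadic" "f x - 2 powi l * x \<in> dyadic" "x \<in> dyadic \<or> k = l"
    using assms by (auto simp: PL_at_def)
  have *: "x - 2 powi (- i) * f x \<in> dyadic" if "f x - 2 powi i * x \<in> dyadic" for i
  proof -
    have "x - 2 powi (- i) * f x = - (2 powi (- i) * (f x - 2 powi i * x))"
      by (simp add: power_int_minus algebra_simps)
    then show ?thesis using that by (metis dyadic_powi_mult_iff dyadic_uminus)
  qed
  show ?thesis
    unfolding PL_at_def
    using germ_finv[OF f'(1) assms(2)] germ_finv[OF f'(2) assms(2)] *[OF f'(3)] *[OF f'(4)]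
      f'(5) PL_at_dyadic_iff[OF assms(1)] assms(2)
    by (intro exI[of _ "- k"] exI[of _ "- l"]) simp
qed

lemma PL_at_cong:
  assumes "PL_at g x" "open S" "x \<in> S" "\<And>y. y \<in> S \<Longrightarrow> f y = g y"
  shows "PL_at f x"
proof -
  obtain d where d: "d > 0" "\<And>y. dist y x < d \<Longrightarrow> f y = g y"
    using assms(2-4) unfolding open_dist by blast
  have 1: "\<forall>\<^sub>F t in at_right 0. f (x + s * t) = g (x + s * t)" if "\<bar>s\<bar> = 1" for s
    unfolding eventually_at_right_field
    by (rule exI[of _ d]) (use d that in \<open>auto simp: dist_real_def abs_mult\<close>)
  have "f x = g x" using d by simp
  then show ?thesis
    using assms(1) germ_cong[OF 1, of 1] germ_cong[OF 1, of "-1"] unfolding PL_at_def by simp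
qed

lemma PL_at_cong_ev:
  "PL_at g x \<Longrightarrow> \<forall>\<^sub>F y in nhds x. f y = g y \<Longrightarrow> PL_at f x"
  unfolding eventually_nhds by (auto intro: PL_at_cong)

lemma PL_at_glue:
  assumes "PL_at g x" "PL_at h x" "x \<in> dyadic" "d > 0"
    and "\<And>y. x \<le> y \<Longrightarrow> y < x + d \<Longrightarrow> f y = g y"
    and "\<And>y. x - d < y \<Longrightarrow> y \<le> x \<Longrightarrow> f y = h y"
  shows "PL_at f x"
proof -
  obtain k where k: "germ 1 g x k" "g x - 2 powi k * x \<in> dyadic"
    using assms(1) by (auto simp: PL_at_def)
  obtain l where l: "germ (-1) h x l" "h x - 2 powi l * x \<in> dyadic"
    using assms(2) by (auto simp: PL_at_def)
  have eq: "f x = g x" "f x = h x" using assms(4) by (auto intro!: assms(5,6))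
  have "germ 1 f x k"
  proof (subst germ_cong)
    show "\<forall>\<^sub>F t in at_right 0. f (x + 1 * t) = g (x + 1 * t)"
      unfolding eventually_at_right_field by (rule exI[of _ d]) (use assms in auto)
  qed (use eq k in auto)
  moreover have "germ (-1) f x l"
  proof (subst germ_cong)
    show "\<forall>\<^sub>F t in at_right 0. f (x + -1 * t) = h (x + -1 * t)"
      unfolding eventually_at_right_field by (rule exI[of _ d]) (use assms in auto)
  qed (use eq l in auto)
  ultimately show ?thesis
    unfolding PL_at_def using k l eq assms(3) by metis
qed

lemma PL_at_affine: "c \<in> dyadic \<Longrightarrow> PL_at (\<lambda>y. 2 powi k * y + c) x"
  unfolding PL_at_def using germ_affine by (auto intro!: exI[of _ k])

lemma PL_at_id: "PL_at id x" "PL_at (\<lambda>x. x) x"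
  using PL_at_affine[of 0 0 x] by (simp_all add: id_def)

lemma PL_at_isCont:
  assumes "PL_at f x" shows "isCont f x"
proof -
  obtain k l where kl: "germ 1 f x k" "germ (-1) f x l"
    using assms by (auto simp: PL_at_def)
  obtain d where d: "d > 0" "\<And>y. y \<in> {x..x + d} \<Longrightarrow> f y = f x + 2 powi k * (y - x)"
    using kl(1) unfolding germ_right_interval by blast
  obtain d' where d': "d' > 0" "\<And>y. y \<in> {x - d'..x} \<Longrightarrow> f y = f x - 2 powi l * (x - y)"
    using kl(2) unfolding germ_left_interval by blast
  have "((\<lambda>y. f x + 2 powi k * (y - x)) \<longlongrightarrow> f x + 2 powi k * (x - x)) (at_right x)"
    by (intro tendsto_intros)
  moreover have "\<forall>\<^sub>F y in at_right x. f x + 2 powi k * (y - x) = f y"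
    unfolding eventually_at_right_field
    by (intro exI[of _ "x + d"] conjI allI impI d(2)[symmetric]) (use d(1) in auto)
  ultimately have 1: "(f \<longlongrightarrow> f x) (at_right x)"
    using Lim_transform_eventually by fastforce
  have "((\<lambda>y. f x - 2 powi l * (x - y)) \<longlongrightarrow> f x - 2 powi l * (x - x)) (at_left x)"
    by (intro tendsto_intros)
  moreover have "\<forall>\<^sub>F y in at_left x. f x - 2 powi l * (x - y) = f y"
    unfolding eventually_at_left_field
    by (intro exI[of _ "x - d'"] conjI allI impI d'(2)[symmetric]) (use d'(1) in auto)
  ultimately have 2: "(f \<longlongrightarrow> f x) (at_left x)"
    using Lim_transform_eventually by fastforce
  from 1 2 show ?thesis
    unfolding isCont_def by (simp add: filterlim_at_split)
qed

lemma germ_max: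
  assumes "germ s f x k" "germ s g x l" "f x = g x" "\<bar>s\<bar> = 1"
  shows "germ s (\<lambda>y. max (f y) (g y)) x (if s = 1 then max k l else min k l)"
    "germ s (\<lambda>y. min (f y) (g y)) x (if s = 1 then min k l else max k l)"
proof -
  have s: "s = 1 \<or> s = -1" using assms(4) by linarith
  have mono: "(2::real) powi i * t \<le> 2 powi j * t" if "i \<le> j" "t > 0" for i j t
    using that by (intro mult_right_mono power_int_increasing) auto
  have ev: "\<forall>\<^sub>F t in at_right 0. t > 0 \<and> f (x + s * t) = f x + s * (2 powi k * t) \<and>
      g (x + s * t) = g x + s * (2 powi l * t)"
    using assms(1,2)[unfolded germ_def] eventually_at_right_less[of 0] by eventually_elim auto
  show "germ s (\<lambda>y. max (f y) (g y)) x (if s = 1 then max k l else min k l)"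
    unfolding germ_def using ev
    by eventually_elim
      (use s assms(3) mono[of k l] mono[of l k] in \<open>auto simp: max_def min_def\<close>)
  show "germ s (\<lambda>y. min (f y) (g y)) x (if s = 1 then min k l else max k l)"
    unfolding germ_def using ev
    by eventually_elim
      (use s assms(3) mono[of k l] mono[of l k] in \<open>auto simp: max_def min_def\<close>)
qed

lemma PL_at_max_min:
  assumes f: "PL_at f x" and g: "PL_at g x" and cross: "f x = g x \<Longrightarrow> x \<in> dyadic"
  shows PL_at_max: "PL_at (\<lambda>y. max (f y) (g y)) x"
    and PL_at_min: "PL_at (\<lambda>y. min (f y) (g y)) x"
proof -
  have cont: "(f \<longlongrightarrow> f x) (nhds x)" "(g \<longlongrightarrow> g x) (nhds x)"
    using PL_at_isCont[OF f] PL_at_isCont[OF g] by (auto simp: isCont_def tendsto_at_iff_tendsto_nhds)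
  have lt: "\<forall>\<^sub>F y in nhds x. u y < w y"
    if "(u \<longlongrightarrow> u x) (nhds x)" "(w \<longlongrightarrow> w x) (nhds x)" "u x < w x" for u w :: "real \<Rightarrow> real"
  proof -
    from dense[OF that(3)] obtain c where "u x < c" "c < w x" by blast
    then have "\<forall>\<^sub>F y in nhds x. u y < c" "\<forall>\<^sub>F y in nhds x. c < w y"
      using that(1,2) by (auto intro: order_tendstoD)
    then show ?thesis by eventually_elim simp
  qed
  consider "f x < g x" | "g x < f x" | "f x = g x" by linarith
  then have "PL_at (\<lambda>y. max (f y) (g y)) x \<and> PL_at (\<lambda>y. min (f y) (g y)) x"
  proof cases
    case 1
    then have "\<forall>\<^sub>F y in nhds x. f y < g y"
      using lt[OF cont] by simp
    then have "\<forall>\<^sub>F y in nhds x. max (f y) (g y) = g y" "\<forall>\<^sub>F y in nhds x. min (f y) (g y) = f y"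
      by (auto elim: eventually_mono)
    then show ?thesis using PL_at_cong_ev[OF g] PL_at_cong_ev[OF f] by simp
  next
    case 2
    then have "\<forall>\<^sub>F y in nhds x. g y < f y"
      using lt[OF cont(2,1)] by simp
    then have "\<forall>\<^sub>F y in nhds x. max (f y) (g y) = f y" "\<forall>\<^sub>F y in nhds x. min (f y) (g y) = g y"
      by (auto elim: eventually_mono)
    then show ?thesis using PL_at_cong_ev[OF g] PL_at_cong_ev[OF f] by simp
  next
    case 3
    then have xD: "x \<in> dyadic" by (rule cross)
    have fx: "f x \<in> dyadic" using PL_at_dyadic_iff[OF f] xD by simp
    have *: "f x - 2 powi k * x \<in> dyadic" for k
      by (rule dyadic_diff[OF fx dyadic_mult[OF dyadic_powi xD]])
    from f g obtain k l k' l' where "germ 1 f x k" "germ (-1) f x l" "germ 1 g x k'" "germ (-1) g x l'"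
      by (auto simp: PL_at_def)
    then show ?thesis
      using germ_max[of 1 f x k g k'] germ_max[of "-1" f x l g l'] 3 xD *
      unfolding PL_at_def by (auto simp del: max.absorb_iff1 max.absorb_iff2)
  qed
  then show "PL_at (\<lambda>y. max (f y) (g y)) x" "PL_at (\<lambda>y. min (f y) (g y)) x" by auto
qed

definition PL_line :: "(real \<Rightarrow> real) set" where
  "PL_line = {f. strict_mono f \<and> surj f \<and> (\<forall>x. PL_at f x)}"

lemma PL_line_less_iff: "f \<in> PL_line \<Longrightarrow> f x < f y \<longleftrightarrow> x < y"
  and PL_line_le_iff: "f \<in> PL_line \<Longrightarrow> f x \<le> f y \<longleftrightarrow> x \<le> y"
  by (auto simp: PL_line_def strict_mono_less strict_mono_less_eq)

lemma PL_line_bij: "f \<in> PL_line \<Longrightarrow> bij f"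
  by (auto simp: PL_line_def bij_def intro: strict_mono_imp_inj_on)

lemma PL_line_inj: "f \<in> PL_line \<Longrightarrow> inj f"
  by (auto dest: PL_line_bij simp: bij_def)

lemma finv_f: "f \<in> PL_line \<Longrightarrow> finv f (f x) = x"
  and f_finv: "f \<in> PL_line \<Longrightarrow> f (finv f x) = x"
  by (auto dest: PL_line_bij simp: bij_def surj_f_inv_f)

lemma finv_eq_iff: "f \<in> PL_line \<Longrightarrow> finv f y = x \<longleftrightarrow> y = f x"
  using finv_f f_finv by metis

lemma finv_comp_self: "f \<in> PL_line \<Longrightarrow> finv f \<circ> f = id"
  and self_comp_finv: "f \<in> PL_line \<Longrightarrow> f \<circ> finv f = id"
  by (auto simp: finv_f f_finv)

lemma PL_line_id: "id \<in> PL_line" "(\<lambda>x. x) \<in> PL_line"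
  by (auto simp: PL_line_def strict_mono_def PL_at_id)

lemma PL_line_comp: "f \<in> PL_line \<Longrightarrow> g \<in> PL_line \<Longrightarrow> f \<circ> g \<in> PL_line"
  using comp_surj[of g f] by (auto simp: PL_line_def strict_mono_def PL_at_comp)

lemma PL_line_finv:
  assumes "f \<in> PL_line" shows "finv f \<in> PL_line"
proof -
  have "finv f x < finv f y" if "x < y" for x y
    using that PL_line_less_iff[OF assms, of "finv f x" "finv f y"] by (simp add: f_finv[OF assms])
  moreover have "surj (finv f)"
    using PL_line_bij[OF assms] bij_imp_bij_inv bij_def by blast
  moreover have "PL_at (finv f) y" for y
    using PL_at_finv[of f "finv f y"] assms PL_line_inj[OF assms]
    by (auto simp: f_finv PL_line_def)
  ultimately show ?thesis by (auto simp: PL_line_def strict_mono_def)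
qed

lemma PL_line_funpow: "f \<in> PL_line \<Longrightarrow> f ^^ n \<in> PL_line"
  by (induction n) (auto intro: PL_line_comp PL_line_id)

lemma PL_line_affine:
  assumes "c \<in> dyadic" shows "(\<lambda>x. 2 powi k * x + c) \<in> PL_line"
proof -
  have "surj (\<lambda>x::real. 2 powi k * x + c)"
  proof (rule surjI)
    show "2 powi k * ((y - c) / 2 powi k) + c = y" for y by simp
  qed
  then show ?thesis
    using assms by (auto simp: PL_line_def strict_mono_def PL_at_affine)
qed

lemma PL_line_affine_comp:
  assumes "u \<in> PL_line" "c \<in> dyadic" "c' \<in> dyadic"
  shows "(\<lambda>x. 2 powi k * u (2 powi l * x + c) + c') \<in> PL_line"
  using PL_line_comp[OF PL_line_affine[OF assms(3), of k] PL_line_comp[OF assms(1) PL_line_affine[OF assms(2), of l]]]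
  by (simp add: comp_def)

lemma dyadic_minus_1: "- 1 \<in> dyadic"
  using dyadic_uminus[OF dyadic_1] .

lemma finv_comp: "f \<in> PL_line \<Longrightarrow> g \<in> PL_line \<Longrightarrow> finv (f \<circ> g) = finv g \<circ> finv f"
  by (intro o_inv_distrib PL_line_bij)

lemma finv_finv: "f \<in> PL_line \<Longrightarrow> finv (finv f) = f"
  by (intro inv_inv_eq PL_line_bij)

section \<open>Thompson's group as a group of maps of the line\<close>

definition TF :: "(real \<Rightarrow> real) set" where
  "TF = {f \<in> PL_line. \<forall>x. x \<notin> {0<..<1} \<longrightarrow> f x = x}"

lemma TF_PL_line: "f \<in> TF \<Longrightarrow> f \<in> PL_line"
  by (simp add: TF_def)

lemma TF_outside: "f \<in> TF \<Longrightarrow> x \<le> 0 \<or> x \<ge> 1 \<Longrightarrow> f x = x"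
  by (auto simp: TF_def)

lemma TF_0 [simp]: "f \<in> TF \<Longrightarrow> f 0 = 0" and TF_1 [simp]: "f \<in> TF \<Longrightarrow> f 1 = 1"
  by (auto simp: TF_def)

lemma TF_bounds:
  assumes "f \<in> TF"
  shows "0 < f x \<longleftrightarrow> 0 < x" "f x < 1 \<longleftrightarrow> x < 1" "0 \<le> f x \<longleftrightarrow> 0 \<le> x" "f x \<le> 1 \<longleftrightarrow> x \<le> 1"
  using PL_line_less_iff[OF TF_PL_line[OF assms], of 0 x] PL_line_less_iff[OF TF_PL_line[OF assms], of x 1]
    PL_line_le_iff[OF TF_PL_line[OF assms], of 0 x] PL_line_le_iff[OF TF_PL_line[OF assms], of x 1] assms
  by simp_all

lemma TF_id: "id \<in> TF"
  by (simp add: TF_def PL_line_id)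

lemma TF_comp: "f \<in> TF \<Longrightarrow> g \<in> TF \<Longrightarrow> f \<circ> g \<in> TF"
  by (auto simp: TF_def intro: PL_line_comp)

lemma TF_finv: "f \<in> TF \<Longrightarrow> finv f \<in> TF"
  by (auto simp: TF_def finv_eq_iff intro: PL_line_finv)

lemma TF_funpow: "f \<in> TF \<Longrightarrow> f ^^ n \<in> TF"
  by (induction n) (auto intro: TF_comp TF_id)

text \<open>Subgroups of a permutation group, without an ambient carrier.\<close>

definition subgrp :: "('a \<Rightarrow> 'a) set \<Rightarrow> bool" where
  "subgrp H \<longleftrightarrow> id \<in> H \<and> (\<forall>f\<in>H. \<forall>g\<in>H. f \<circ> g \<in> H) \<and> (\<forall>f\<in>H. finv f \<in> H)"

lemma subgrpD: "subgrp H \<Longrightarrow> id \<in> H" "subgrp H \<Longrightarrow> f \<in> H \<Longrightarrow> g \<in> H \<Longrightarrow> f \<circ> g \<in> H"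
  "subgrp H \<Longrightarrow> f \<in> H \<Longrightarrow> finv f \<in> H"
  by (auto simp: subgrp_def)

lemma subgrp_funpow: "subgrp H \<Longrightarrow> f \<in> H \<Longrightarrow> f ^^ n \<in> H"
  by (induction n) (auto intro: subgrpD)

lemma subgrp_Int: "subgrp H \<Longrightarrow> subgrp K \<Longrightarrow> subgrp (H \<inter> K)"
  by (auto simp: subgrp_def)

subsection \<open>Slopes at the end points\<close>

text \<open>Exponents of the slopes at \<open>0\<close> from the right and at \<open>1\<close> from the left, that is, the two components
  of the abelianization map.\<close>

definition slope0 :: "(real \<Rightarrow> real) \<Rightarrow> int" where "slope0 f = (THE k. germ 1 f 0 k)"
definition slope1 :: "(real \<Rightarrow> real) \<Rightarrow> int" where "slope1 f = (THE k. germ (-1) f 1 k)"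

lemma slope0_eq: "germ 1 f 0 k \<Longrightarrow> slope0 f = k"
  unfolding slope0_def by (rule the_equality) (auto dest: germ_unique)

lemma slope1_eq: "germ (-1) f 1 k \<Longrightarrow> slope1 f = k"
  unfolding slope1_def by (rule the_equality) (auto dest: germ_unique)

lemma germ_slope0: "f \<in> PL_line \<Longrightarrow> germ 1 f 0 (slope0 f)"
  and germ_slope1: "f \<in> PL_line \<Longrightarrow> germ (-1) f 1 (slope1 f)"
  unfolding PL_line_def PL_at_def using slope0_eq slope1_eq by fastforce+

lemma slope_comp:
  assumes "f \<in> TF" "g \<in> TF"
  shows slope0_comp: "slope0 (f \<circ> g) = slope0 f + slope0 g"
    and slope1_comp: "slope1 (f \<circ> g) = slope1 f + slope1 g"
  using assms germ_comp[of 1 g 0 "slope0 g" f] germ_comp[of "-1" g 1 "slope1 g" f]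
  by (auto intro!: slope0_eq slope1_eq simp: germ_slope0 germ_slope1 TF_PL_line)

lemma slope_finv:
  assumes "f \<in> TF"
  shows slope0_finv: "slope0 (finv f) = - slope0 f"
    and slope1_finv: "slope1 (finv f) = - slope1 f"
  using assms germ_finv[of 1 f 0 "slope0 f"] germ_finv[of "-1" f 1 "slope1 f"]
  by (auto intro!: slope0_eq slope1_eq simp: germ_slope0 germ_slope1 TF_PL_line PL_line_inj)

lemma slope_id [simp]: "slope0 id = 0" "slope1 id = 0"
  by (auto intro: slope0_eq slope1_eq germ_id)

lemma slope_funpow:
  assumes "f \<in> TF"
  shows "slope0 (f ^^ n) = int n * slope0 f" "slope1 (f ^^ n) = int n * slope1 f"
  by (induction n)
    (use assms in \<open>simp_all add: slope0_comp slope1_comp TF_funpow algebra_simps\<close>)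

lemma subgrp_slope_multiple:
  assumes "subgrp H" "f \<in> H" "f \<in> TF"
  obtains z where "z \<in> H" "z \<in> TF" "slope0 z = i * slope0 f" "slope1 z = i * slope1 f"
proof (cases "i \<ge> 0")
  case True
  then show ?thesis
    using that[of "f ^^ nat i"] assms by (simp add: slope_funpow subgrp_funpow TF_funpow)
next
  case False
  then show ?thesis
    using that[of "finv (f ^^ nat (- i))"] assms
    by (simp add: slope_funpow slope0_finv slope1_finv subgrp_funpow TF_funpow TF_finv subgrpD)
qed

text \<open>The kernel of the abelianization map: the elements with compact support in the open interval.\<close>

definition TF_cpt :: "(real \<Rightarrow> real) set" where
  "TF_cpt = {y \<in> TF. slope0 y = 0 \<and> slope1 y = 0}"

lemma TF_cpt_support:
  assumes "y \<in> TF_cpt"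
  obtains \<alpha> \<beta> where "0 < \<alpha>" "\<alpha> < \<beta>" "\<beta> < 1" "\<And>x. x \<le> \<alpha> \<or> x \<ge> \<beta> \<Longrightarrow> y x = x"
proof -
  have y: "y \<in> TF" "germ 1 y 0 0" "germ (-1) y 1 0"
    using assms germ_slope0[of y] germ_slope1[of y] by (auto simp: TF_cpt_def TF_PL_line)
  obtain a where a: "a > 0" "\<forall>x\<in>{0..0 + a}. y x = y 0 + 2 powi 0 * (x - 0)"
    using y(2) unfolding germ_right_interval by blast
  obtain b where b: "b > 0" "\<forall>x\<in>{1 - b..1}. y x = y 1 - 2 powi 0 * (1 - x)"
    using y(3) unfolding germ_left_interval by blast
  have a': "y x = x" if "x \<le> a" for x
    using bspec[OF a(2), of x] that y(1) TF_outside[OF y(1), of x] by fastforce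
  have b': "y x = x" if "x \<ge> 1 - b" for x
    using bspec[OF b(2), of x] that y(1) TF_outside[OF y(1), of x] by fastforce
  show ?thesis
    by (rule that[of "min a (1/3)" "max (1 - b) (2/3)"]) (use a(1) b(1) in \<open>auto intro: a' b'\<close>)
qed

lemma TF_cptI:
  assumes "y \<in> TF" "0 < \<alpha>" "\<beta> < 1" "\<And>x. x \<le> \<alpha> \<or> x \<ge> \<beta> \<Longrightarrow> y x = x"
  shows "y \<in> TF_cpt"
proof -
  have "germ 1 y 0 0"
    unfolding germ_right_interval by (rule exI[of _ \<alpha>]) (use assms in auto)
  moreover have "germ (-1) y 1 0"
    unfolding germ_left_interval by (rule exI[of _ "1 - \<beta>"]) (use assms in auto)
  ultimately show ?thesis
    using assms(1) by (simp add: TF_cpt_def slope0_eq slope1_eq)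
qed

subsection \<open>Reversing the interval\<close>

definition flip :: "(real \<Rightarrow> real) \<Rightarrow> real \<Rightarrow> real" where
  "flip f = (\<lambda>x. 1 - f (1 - x))"

lemma flip_flip [simp]: "flip (flip f) = f"
  by (simp add: flip_def)

lemma flip_comp: "flip (f \<circ> g) = flip f \<circ> flip g"
  by (auto simp: flip_def)

lemma flip_id [simp]: "flip id = id"
  by (auto simp: flip_def)

lemma germ_flip: "germ s f x k \<Longrightarrow> germ (- s) (flip f) (1 - x) k"
  unfolding germ_def flip_def by (erule eventually_mono) (simp add: algebra_simps)

lemma PL_at_flip:
  assumes "PL_at f x" shows "PL_at (flip f) (1 - x)"
proof -
  obtain k l where f': "germ 1 f x k" "germ (-1) f x l"
     "f x - 2 powi k * x \<in> dyadic" "f x - 2 powi l * x \<in> dyadic" "x \<in> dyadic \<or> k = l"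
    using assms by (auto simp: PL_at_def)
  have *: "flip f (1 - x) - 2 powi i * (1 - x) \<in> dyadic" if "f x - 2 powi i * x \<in> dyadic" for i
  proof -
    have "flip f (1 - x) - 2 powi i * (1 - x) = (1 - 2 powi i) - (f x - 2 powi i * x)"
      by (simp add: flip_def algebra_simps)
    moreover have "(1 - 2 powi i) - (f x - 2 powi i * x) \<in> dyadic"
      by (intro dyadic_diff[OF dyadic_diff that]) simp_all
    ultimately show ?thesis by simp
  qed
  show ?thesis
    unfolding PL_at_def
    using germ_flip[OF f'(1)] germ_flip[OF f'(2)] *[OF f'(3)] *[OF f'(4)] f'(5)
    by (intro exI[of _ l] exI[of _ k]) auto
qed

lemma flip_TF:
  assumes "f \<in> TF" shows "flip f \<in> TF"
proof -
  have f: "strict_mono f" "surj f" "\<And>x. PL_at f x"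
    using assms by (auto simp: TF_def PL_line_def)
  have "strict_mono (flip f)"
    using f(1) by (auto simp: flip_def strict_mono_def)
  moreover have "surj (flip f)"
  proof
    show "UNIV \<subseteq> range (flip f)"
    proof
      fix y
      obtain x where "f x = 1 - y" using f(2) by (metis surj_def)
      then have "flip f (1 - x) = y" by (simp add: flip_def)
      then show "y \<in> range (flip f)" by blast
    qed
  qed simp
  moreover have "PL_at (flip f) x" for x
    using PL_at_flip[OF f(3), of "1 - x"] by simp
  ultimately show ?thesis
    using assms by (auto simp: TF_def PL_line_def flip_def)
qed

lemma slope_flip:
  assumes "f \<in> TF" shows "slope0 (flip f) = slope1 f" "slope1 (flip f) = slope0 f"
  using germ_flip[OF germ_slope0[OF TF_PL_line[OF assms]]]
    germ_flip[OF germ_slope1[OF TF_PL_line[OF assms]]]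
  by (auto intro: slope0_eq slope1_eq)

lemma flip_finv: "f \<in> TF \<Longrightarrow> flip (finv f) = finv (flip f)"
proof -
  assume f: "f \<in> TF"
  have "flip f (flip (finv f) x) = x" for x
    using f by (simp add: flip_def f_finv TF_PL_line)
  then show ?thesis
    by (intro ext) (metis finv_eq_iff[OF TF_PL_line[OF flip_TF[OF f]]])
qed

section \<open>Uniform dyadic subdivisions\<close>

lemma eventually_dyadic_scaled_Ints:
  assumes "c \<in> dyadic"
  shows "\<forall>\<^sub>F N in sequentially. k \<le> int N \<and> c * 2 ^ nat (int N - k) \<in> \<int>"
proof -
  obtain n where n: "c * 2 ^ n \<in> \<int>" using assms by (auto simp: dyadic_def)
  have "k \<le> int N \<and> c * 2 ^ nat (int N - k) \<in> \<int>" if "N \<ge> nat (k + int n) + nat k" for N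
  proof -
    have le: "k \<le> int N" "n \<le> nat (int N - k)" using that by linarith+
    then have "c * 2 ^ nat (int N - k) = (c * 2 ^ n) * 2 ^ (nat (int N - k) - n)"
      by (simp flip: power_add)
    then show ?thesis using n le(1) by (simp only:) (auto intro!: Ints_mult)
  qed
  then show ?thesis by (auto simp: eventually_sequentially)
qed

text \<open>The \<open>i\<close>-th dyadic interval of level \<open>N\<close> is mapped affinely onto a dyadic interval of some
  level \<open>j\<close>.\<close>

definition standard_on :: "(real \<Rightarrow> real) \<Rightarrow> nat \<Rightarrow> int \<Rightarrow> bool" where
  "standard_on f N i \<longleftrightarrow>
     (\<exists>j. \<exists>m::int. \<forall>t\<in>{0..1}. f ((of_int i + t) / 2 ^ N) = (of_int m + t) / 2 ^ j)"

lemma affine_on_standard_interval: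
  fixes i :: int
  assumes "k \<le> int N" "c * 2 ^ nat (int N - k) \<in> \<int>"
    and f: "\<And>y. of_int i / 2 ^ N \<le> y \<Longrightarrow> y \<le> (of_int i + 1) / 2 ^ N \<Longrightarrow> f y = 2 powi k * y + c"
  shows "standard_on f N i"
proof -
  define j where "j = nat (int N - k)"
  obtain z where z: "c * 2 ^ j = of_int z" using assms(2) by (auto simp: Ints_def j_def)
  have "2 powi k = (2::real) ^ N / 2 ^ j"
  proof -
    have "(2::real) powi (int N - k) = 2 ^ j"
      using assms(1) by (simp add: power_int_def j_def)
    then show ?thesis by (simp add: power_int_diff field_simps)
  qed
  note k = this
  have c: "c = of_int z / 2 ^ j" using z by (simp add: field_simps)
  have "f ((of_int i + t) / 2 ^ N) = (of_int (i + z) + t) / 2 ^ j" if "t \<in> {0..1}" for t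
  proof -
    have "f ((of_int i + t) / 2 ^ N) = 2 ^ N / 2 ^ j * ((of_int i + t) / 2 ^ N) + of_int z / 2 ^ j"
      unfolding k[symmetric] c[symmetric] by (rule f) (use that in \<open>simp_all add: divide_right_mono\<close>)
    then show ?thesis by (simp add: add_divide_distrib distrib_left)
  qed
  then show ?thesis unfolding standard_on_def by blast
qed

text \<open>Near each point the claim holds for all fine enough subdivisions: at a dyadic point because
  it becomes a subdivision point, elsewhere because there is no break. Compactness makes this uniform.\<close>

lemma eventually_affine_on_standard_intervals:
  fixes a b :: real
  assumes f: "\<And>x. PL_at f x" and "a \<le> b"
  shows "\<forall>\<^sub>F N in sequentially. \<forall>i::int. of_int i / 2 ^ N \<le> b \<and> a \<le> (of_int i + 1) / 2 ^ N \<longrightarrow>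
     standard_on f N i"
  using assms(2)
proof (induction rule: Bolzano)
  case (trans a b c)
  from trans(1,2) show ?case
  proof eventually_elim
    case (elim N)
    show ?case
    proof (intro allI impI)
      fix i :: int
      assume i: "of_int i / 2 ^ N \<le> c \<and> a \<le> (of_int i + 1) / 2 ^ N"
      show "standard_on f N i"
      proof (cases "of_int i / 2 ^ N \<le> b")
        case True
        then show ?thesis using elim(1)[rule_format, of i] i by simp
      next
        case False
        have "of_int i / 2 ^ N \<le> (of_int i + 1) / (2 ^ N :: real)"
          by (simp add: divide_right_mono)
        then have "b \<le> (of_int i + 1) / 2 ^ N" using False by linarith
        then show ?thesis using elim(2)[rule_format, of i] i by simp
      qed
    qed
  qed
next
  case (local x)
  obtain k l where kl: "germ 1 f x k" "germ (-1) f x l"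
     "f x - 2 powi k * x \<in> dyadic" "f x - 2 powi l * x \<in> dyadic" "x \<in> dyadic \<or> k = l"
    using f[of x] by (auto simp: PL_at_def)
  obtain d1 where d1: "d1 > 0" "\<forall>y\<in>{x..x + d1}. f y = f x + 2 powi k * (y - x)"
    using kl(1) unfolding germ_right_interval by blast
  obtain d2 where d2: "d2 > 0" "\<forall>y\<in>{x - d2..x}. f y = f x - 2 powi l * (x - y)"
    using kl(2) unfolding germ_left_interval by blast
  define d where "d = min d1 d2"
  have d: "d > 0" "d \<le> d1" "d \<le> d2" using d1(1) d2(1) by (auto simp: d_def)
  have R: "f y = 2 powi k * y + (f x - 2 powi k * x)" if "x \<le> y" "y \<le> x + d" for y
  proof -
    have "y \<in> {x..x + d1}" using that d by simp
    from bspec[OF d1(2) this] show ?thesis by (simp add: algebra_simps)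
  qed
  have L: "f y = 2 powi l * y + (f x - 2 powi l * x)" if "x - d \<le> y" "y \<le> x" for y
  proof -
    have "y \<in> {x - d2..x}" using that d by simp
    from bspec[OF d2(2) this] show ?thesis by (simp add: algebra_simps)
  qed
  have ev: "\<forall>\<^sub>F N in sequentially. (1 / 2) ^ N < d / 2"
    using order_tendstoD(2)[OF LIMSEQ_power_zero[of "1/2::real"], of "d / 2"] d by simp
  have evx: "\<forall>\<^sub>F N in sequentially. x \<in> dyadic \<longrightarrow> x * 2 ^ N \<in> \<int>"
  proof (cases "x \<in> dyadic")
    case True
    show ?thesis
      using eventually_dyadic_scaled_Ints[OF True, of 0] by (rule eventually_mono) simp
  qed simp
  have "\<forall>\<^sub>F N in sequentially. \<forall>i::int. of_int i / 2 ^ N \<le> b \<and> a \<le> (of_int i + 1) / 2 ^ N \<longrightarrow>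
     standard_on f N i"
    if ab: "a \<le> x \<and> x \<le> b" "b - a < d / 2" for a b
    using ev evx eventually_dyadic_scaled_Ints[OF kl(3), of k] eventually_dyadic_scaled_Ints[OF kl(4), of l]
  proof eventually_elim
    case (elim N)
    show ?case
    proof (intro allI impI)
      fix i :: int
      assume i: "of_int i / 2 ^ N \<le> b \<and> a \<le> (of_int i + 1) / 2 ^ N"
      have w: "(of_int i + 1) / 2 ^ N = of_int i / 2 ^ N + (1 / 2 :: real) ^ N"
        by (simp add: add_divide_distrib power_one_over)
      consider "x \<le> of_int i / 2 ^ N" | "(of_int i + 1) / 2 ^ N \<le> x" |
        "of_int i / 2 ^ N < x" "x < (of_int i + 1) / 2 ^ N" by linarith
      then show "standard_on f N i"
      proof cases
        case 1
        show ?thesis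
        proof (rule affine_on_standard_interval[OF conjunct1[OF elim(3)] conjunct2[OF elim(3)]])
          fix y :: real assume "of_int i / 2 ^ N \<le> y" "y \<le> (of_int i + 1) / 2 ^ N"
          then show "f y = 2 powi k * y + (f x - 2 powi k * x)"
            using 1 w elim(1) i ab by (intro R) linarith+
        qed
      next
        case 2
        show ?thesis
        proof (rule affine_on_standard_interval[OF conjunct1[OF elim(4)] conjunct2[OF elim(4)]])
          fix y :: real assume "of_int i / 2 ^ N \<le> y" "y \<le> (of_int i + 1) / 2 ^ N"
          then show "f y = 2 powi l * y + (f x - 2 powi l * x)"
            using 2 w elim(1) i ab by (intro L) linarith+
        qed
      next
        case 3
        have "x \<notin> dyadic"
        proof
          assume "x \<in> dyadic"
          then obtain z where z: "x * 2 ^ N = of_int z" using elim(2) by (auto simp: Ints_def)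
          have "of_int i < x * 2 ^ N" "x * 2 ^ N < of_int i + 1"
            using 3 by (simp_all add: field_simps)
          then have "i < z" "z < i + 1"
            unfolding z using of_int_less_iff[where 'a = real, of z "i + 1"] by simp_all
          then show False by simp
        qed
        then have "k = l" using kl(5) by simp
        show ?thesis
        proof (rule affine_on_standard_interval[OF conjunct1[OF elim(3)] conjunct2[OF elim(3)]])
          fix y :: real assume y: "of_int i / 2 ^ N \<le> y" "y \<le> (of_int i + 1) / 2 ^ N"
          show "f y = 2 powi k * y + (f x - 2 powi k * x)"
          proof (cases "x \<le> y")
            case True
            show ?thesis by (rule R[OF True]) (use y 3 w elim(1) i ab in linarith)
          next
            case False
            show ?thesis unfolding \<open>k = l\<close> by (rule L) (use False y 3 w elim(1) i ab in linarith)+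
          qed
        qed
      qed
    qed
  qed
  then have key: "a \<le> x \<and> x \<le> b \<and> b - a < d / 2 \<longrightarrow>
     (\<forall>\<^sub>F N in sequentially. \<forall>i::int. of_int i / 2 ^ N \<le> b \<and> a \<le> (of_int i + 1) / 2 ^ N \<longrightarrow>
     standard_on f N i)" for a b
    by iprover
  show ?case
    by (rule exI[of _ "d / 2"], rule conjI[OF half_gt_zero[OF d(1)]], intro allI, rule key)
qed

lemma TF_standard_intervals:
  assumes "f \<in> TF"
  shows "\<exists>N. \<forall>i<2 ^ N.
     \<exists>j m::nat. \<forall>t\<in>{0..1::real}. f ((real i + t) / 2 ^ N) = (real m + t) / 2 ^ j"
proof -
  have "\<And>x. PL_at f x" using assms by (simp add: TF_def PL_line_def)
  from eventually_affine_on_standard_intervals[OF this, of 0 1]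
  obtain N where N: "\<And>i::int. of_int i / 2 ^ N \<le> (1::real) \<Longrightarrow> 0 \<le> (of_int i + 1) / (2 ^ N :: real) \<Longrightarrow>
     standard_on f N i"
    unfolding eventually_sequentially by (metis order_refl zero_le_one)
  show ?thesis
  proof (rule exI[of _ N], intro allI impI)
    fix i :: nat assume i: "i < 2 ^ N"
    have "real i \<le> 2 ^ N" using i by (simp add: less_imp_le)
    then have "standard_on f N (int i)" using N[of "int i"] by (simp add: field_simps)
    then obtain j and m :: int
      where m: "\<forall>t\<in>{0..1::real}. f ((real i + t) / 2 ^ N) = (of_int m + t) / 2 ^ j"
      by (auto simp: standard_on_def)
    have "0 \<le> f (real i / 2 ^ N)" using TF_bounds(3)[OF assms] by simp
    then have "0 \<le> of_int m / (2 ^ j :: real)" using bspec[OF m, of 0] by simp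
    then have "0 \<le> of_int m / (2 ^ j :: real) * 2 ^ j" by (rule mult_nonneg_nonneg) simp
    then have "m \<ge> 0" by simp
    then show "\<exists>j m::nat. \<forall>t\<in>{0..1::real}. f ((real i + t) / 2 ^ N) = (real m + t) / 2 ^ j"
      using m by (intro exI[of _ j] exI[of _ "nat m"]) simp
  qed
qed

section \<open>Thompson's group is generated by two elements\<close>

text \<open>For a map of the unit interval onto \<open>[0, n]\<close> that takes the \<open>n\<close> leaves of a dyadic subdivision to
  the unit intervals, composing with this map halves the leaf number \<open>i\<close>. Away from \<open>[i, i + 1]\<close> it
  is a translation, so one formula serves for all \<open>n\<close>.\<close>

definition split_leaf :: "nat \<Rightarrow> real \<Rightarrow> real" where
  "split_leaf i x = max x (min (2 * x - real i) (x + 1))"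

lemma split_leaf_simps:
  "x \<le> real i \<Longrightarrow> split_leaf i x = x"
  "real i \<le> x \<Longrightarrow> x \<le> real i + 1 \<Longrightarrow> split_leaf i x = 2 * x - real i"
  "real i + 1 \<le> x \<Longrightarrow> split_leaf i x = x + 1"
  by (auto simp: split_leaf_def)

lemma split_leaf_PL_line: "split_leaf i \<in> PL_line"
proof -
  have "strict_mono (split_leaf i)"
    by (auto simp: strict_mono_def split_leaf_def max_def min_def)
  moreover have "surj (split_leaf i)"
    by (rule surjI[of _ "\<lambda>y. min y (max ((y + real i) / 2) (y - 1))"])
      (auto simp: split_leaf_def max_def min_def field_simps)
  moreover have "PL_at (split_leaf i) x" for x
  proof -
    have 1: "PL_at (\<lambda>y. 2 * y - real i) x"
      using PL_at_affine[of "- real i" 1 x] by (simp add: dyadic_uminus)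
    have 2: "PL_at (\<lambda>y. y + 1) x"
      using PL_at_affine[of 1 0 x] by simp
    have "PL_at (\<lambda>y. min (2 * y - real i) (y + 1)) x"
    proof (rule PL_at_min[OF 1 2])
      assume "2 * x - real i = x + 1"
      then have "x = real (i + 1)" by simp
      then show "x \<in> dyadic" by (simp only: dyadic_of_nat)
    qed
    then show ?thesis
      unfolding split_leaf_def[abs_def]
    proof (rule PL_at_max[OF PL_at_id(2)])
      assume "x = min (2 * x - real i) (x + 1)"
      then have "x = real i" by (auto simp: min_def split: if_splits)
      then show "x \<in> dyadic" by (simp only: dyadic_of_nat)
    qed
  qed
  ultimately show ?thesis by (auto simp: PL_line_def)
qed

lemma split_leaf_commute: "i < j \<Longrightarrow> split_leaf (Suc j) \<circ> split_leaf i = split_leaf i \<circ> split_leaf j"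
proof
  fix x assume "i < j"
  then have "real i + 1 \<le> real j" by simp
  then show "(split_leaf (Suc j) \<circ> split_leaf i) x = (split_leaf i \<circ> split_leaf j) x"
    by (auto simp: split_leaf_def max_def min_def)
qed

text \<open>Binary trees with \<open>n\<close> leaves, represented by the maps that send their leaves to
  \<open>[0, 1], \<dots>, [n - 1, n]\<close>.\<close>

inductive leaf_map :: "nat \<Rightarrow> (real \<Rightarrow> real) \<Rightarrow> bool" where
  leaf: "leaf_map 1 id"
| caret: "leaf_map n \<rho> \<Longrightarrow> i < n \<Longrightarrow> leaf_map (Suc n) (split_leaf i \<circ> \<rho>)"

lemma leaf_map_props:
  assumes "leaf_map n \<rho>"
  shows "n \<ge> 1" "\<rho> \<in> PL_line" "x \<le> 0 \<Longrightarrow> \<rho> x = x" "x \<ge> 1 \<Longrightarrow> \<rho> x = x + real n - 1"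
  using assms
  by (induction arbitrary: x) (auto simp: PL_line_id split_leaf_simps intro!: PL_line_comp split_leaf_PL_line)

lemma leaf_map_range:
  assumes "leaf_map n \<rho>" "0 \<le> x" "x \<le> 1"
  shows "0 \<le> \<rho> x" "\<rho> x \<le> real n"
  using leaf_map_props[OF assms(1)] PL_line_le_iff[of \<rho> 0 x] PL_line_le_iff[of \<rho> x 1] assms(2,3)
  by fastforce+

text \<open>The tree whose two halves are given trees: first grow the left half, then the right one.\<close>

lemma leaf_map_join:
  assumes "leaf_map a \<rho>" "leaf_map b \<sigma>"
  obtains \<tau> where "leaf_map (a + b) \<tau>" "\<And>x. 0 \<le> x \<Longrightarrow> x \<le> 1/2 \<Longrightarrow> \<tau> x = \<rho> (2 * x)"
    "\<And>x. 1/2 \<le> x \<Longrightarrow> x \<le> 1 \<Longrightarrow> \<tau> x = real a + \<sigma> (2 * x - 1)"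
proof -
  have 1: "\<exists>\<tau>. leaf_map (Suc a) \<tau> \<and> (\<forall>x. 0 \<le> x \<and> x \<le> 1/2 \<longrightarrow> \<tau> x = \<rho> (2 * x)) \<and>
      (\<forall>x. 1/2 \<le> x \<and> x \<le> 1 \<longrightarrow> \<tau> x = real a + (2 * x - 1))"
    using assms(1)
  proof induction
    case leaf
    show ?case
      by (rule exI[of _ "split_leaf 0 \<circ> id"]) (use leaf_map.caret[OF leaf_map.leaf, of 0] in \<open>auto simp: split_leaf_simps\<close>)
  next
    case (caret n \<rho> i)
    then obtain \<tau> where \<tau>: "leaf_map (Suc n) \<tau>" "\<And>x. 0 \<le> x \<Longrightarrow> x \<le> 1/2 \<Longrightarrow> \<tau> x = \<rho> (2 * x)"
      "\<And>x. 1/2 \<le> x \<Longrightarrow> x \<le> 1 \<Longrightarrow> \<tau> x = real n + (2 * x - 1)" by blast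
    have i: "real i + 1 \<le> real n" using caret(2) by simp
    show ?case
    proof (intro exI conjI allI impI)
      show "leaf_map (Suc (Suc n)) (split_leaf i \<circ> \<tau>)"
        using \<tau>(1) caret(2) by (intro leaf_map.caret) auto
      show "(split_leaf i \<circ> \<tau>) x = (split_leaf i \<circ> \<rho>) (2 * x)" if "0 \<le> x \<and> x \<le> 1/2" for x
        using \<tau>(2)[of x] that by simp
      show "(split_leaf i \<circ> \<tau>) x = real (Suc n) + (2 * x - 1)" if "1/2 \<le> x \<and> x \<le> 1" for x
        using \<tau>(3)[of x] that i by (simp add: split_leaf_simps)
    qed
  qed
  have "\<exists>\<tau>. leaf_map (a + b) \<tau> \<and> (\<forall>x. 0 \<le> x \<and> x \<le> 1/2 \<longrightarrow> \<tau> x = \<rho> (2 * x)) \<and>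
      (\<forall>x. 1/2 \<le> x \<and> x \<le> 1 \<longrightarrow> \<tau> x = real a + \<sigma> (2 * x - 1))"
    using assms(2)
  proof induction
    case leaf
    show ?case using 1 by simp
  next
    case (caret n \<sigma> i)
    then obtain \<tau> where \<tau>: "leaf_map (a + n) \<tau>" "\<And>x. 0 \<le> x \<Longrightarrow> x \<le> 1/2 \<Longrightarrow> \<tau> x = \<rho> (2 * x)"
      "\<And>x. 1/2 \<le> x \<Longrightarrow> x \<le> 1 \<Longrightarrow> \<tau> x = real a + \<sigma> (2 * x - 1)" by blast
    have 1: "split_leaf (a + i) (\<rho> (2 * x)) = \<rho> (2 * x)" if "0 \<le> x" "x \<le> 1/2" for x
      using leaf_map_range(2)[OF assms(1), of "2 * x"] that by (intro split_leaf_simps) auto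
    have 2: "split_leaf (a + i) (real a + y) = real a + split_leaf i y" for y
      by (auto simp: split_leaf_def max_def min_def)
    show ?case
    proof (intro exI conjI allI impI)
      show "leaf_map (a + Suc n) (split_leaf (a + i) \<circ> \<tau>)"
        using leaf_map.caret[OF \<tau>(1), of "a + i"] caret(2) by simp
      show "(split_leaf (a + i) \<circ> \<tau>) x = \<rho> (2 * x)" if "0 \<le> x \<and> x \<le> 1/2" for x
        using \<tau>(2)[of x] 1[of x] that by simp
      show "(split_leaf (a + i) \<circ> \<tau>) x = real a + (split_leaf i \<circ> \<sigma>) (2 * x - 1)" if "1/2 \<le> x \<and> x \<le> 1" for x
        using \<tau>(3)[of x] that by (simp add: 2)
    qed
  qed
  then show ?thesis using that by blast
qed

text \<open>Here \<open>k\<close> is the inverse of a would-be leaf map, and \<open>M\<close> bounds the depth of the leaves.\<close>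

definition standard_subdivision :: "nat \<Rightarrow> nat \<Rightarrow> (real \<Rightarrow> real) \<Rightarrow> bool" where
  "standard_subdivision M n k \<longleftrightarrow> n \<ge> 1 \<and> k 0 = 0 \<and> k (real n) = 1 \<and>
     (\<forall>x y. 0 \<le> x \<longrightarrow> x < y \<longrightarrow> y \<le> real n \<longrightarrow> k x < k y) \<and>
     (\<forall>i<n. \<exists>j\<le>M. \<exists>m::nat. \<forall>t\<in>{0..1}. k (real i + t) = (real m + t) / 2 ^ j)"

text \<open>Unless there is only one leaf, \<open>1/2\<close> is an endpoint of a leaf, because a dyadic interval with
  \<open>1/2\<close> in its interior is the whole interval. So the subdivision splits into subdivisions of the two
  halves, whose leaves have smaller depth.\<close>

lemma standard_subdivision_leaf_map:
  assumes "standard_subdivision M n k"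
  shows "\<exists>\<rho>. leaf_map n \<rho> \<and> (\<forall>x\<in>{0..1}. k (\<rho> x) = x)"
  using assms
proof (induction M arbitrary: n k rule: less_induct)
  case (less M)
  have n: "n \<ge> 1" "k 0 = 0" "k (real n) = 1"
    and mono: "\<And>x y. 0 \<le> x \<Longrightarrow> x < y \<Longrightarrow> y \<le> real n \<Longrightarrow> k x < k y"
    and pieces: "\<And>i. i < n \<Longrightarrow> \<exists>j\<le>M. \<exists>m::nat. \<forall>t\<in>{0..1}. k (real i + t) = (real m + t) / 2 ^ j"
    using less.prems by (auto simp: standard_subdivision_def)
  have le: "k x \<le> k y" if "0 \<le> x" "x \<le> y" "y \<le> real n" for x y
    using mono[of x y] that by (cases "x = y") auto
  define a where "a = (GREATEST i. i \<le> n \<and> k (real i) \<le> 1 / 2)"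
  have a: "a \<le> n \<and> k (real a) \<le> 1 / 2"
    unfolding a_def by (rule GreatestI_nat[of _ 0 n]) (use n in auto)
  have a_max: "i \<le> a" if "i \<le> n" "k (real i) \<le> 1 / 2" for i
    unfolding a_def by (rule Greatest_le_nat[of _ _ n]) (use that in auto)
  have "a < n" using a n by (cases "a = n") auto
  then have "k (real (Suc a)) > 1 / 2"
    using a_max[of "Suc a"] by (meson Suc_leI leI not_less_eq_eq order_refl)
  from pieces[OF \<open>a < n\<close>] obtain j m where jm: "j \<le> M"
    "\<forall>t\<in>{0..1}. k (real a + t) = (real m + t) / 2 ^ j" by blast
  have m: "real m / 2 ^ j \<le> 1 / 2" "(real m + 1) / 2 ^ j > 1 / 2" "k (real a) = real m / 2 ^ j"
    "k (real a + 1) = (real m + 1) / 2 ^ j"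
    using a \<open>k (real (Suc a)) > 1 / 2\<close> bspec[OF jm(2), of 0] bspec[OF jm(2), of 1]
    by (simp_all add: add.commute)
  show ?case
  proof (cases j)
    case 0
    with m have "m = 0" by simp
    have "a = 0"
    proof (rule ccontr)
      assume "a \<noteq> 0"
      then have "k 0 < k (real a)" using a by (intro mono) auto
      then show False using m \<open>m = 0\<close> n by simp
    qed
    have "n = 1"
    proof (rule ccontr)
      assume "n \<noteq> 1"
      then have "k 1 < k (real n)" using n by (intro mono) auto
      then show False using m(4) \<open>m = 0\<close> n \<open>a = 0\<close> 0 by simp
    qed
    show ?thesis
    proof (intro exI conjI)
      show "leaf_map n id" unfolding \<open>n = 1\<close> by (rule leaf_map.leaf)
      show "\<forall>x\<in>{0..1}. k (id x) = x" using jm(2) \<open>a = 0\<close> \<open>m = 0\<close> 0 by simp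
    qed
  next
    case (Suc j')
    have "real m \<le> 2 ^ j'" "2 ^ j' < real m + 1" using m Suc by (simp_all add: field_simps)
    then have "m = 2 ^ j'" by (metis (mono_tags, lifting) le_antisym less_Suc_eq_le of_nat_1 of_nat_add of_nat_le_iff of_nat_less_iff of_nat_numeral of_nat_power Suc_eq_plus1)
    then have ka: "k (real a) = 1 / 2" using m Suc by (simp add: field_simps)
    then have "a > 0" using n by (cases a) auto
    from jm(1) Suc have "M > 0" by simp
    have "standard_subdivision (M - 1) a (\<lambda>x. 2 * k x)"
      unfolding standard_subdivision_def
    proof (intro conjI allI impI)
      fix i assume "i < a"
      then obtain j m where jm: "j \<le> M"
        "\<forall>t\<in>{0..1}. k (real i + t) = (real m + t) / 2 ^ j" using pieces[of i] a by auto
      have "k (real i + 1) \<le> k (real a)"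
        using \<open>i < a\<close> a by (intro le) auto
      then have "(real m + 1) / 2 ^ j \<le> 1 / 2" using bspec[OF jm(2), of 1] ka by simp
      then have "j \<noteq> 0" by (cases j) auto
      then obtain j' where "j = Suc j'" by (cases j) auto
      then show "\<exists>j\<le>M - 1. \<exists>m::nat. \<forall>t\<in>{0..1}. 2 * k (real i + t) = (real m + t) / 2 ^ j"
        using jm by (intro exI[of _ j'] conjI exI[of _ m]) (auto simp: field_simps)
    qed (use a \<open>a > 0\<close> n ka mono in auto)
    then obtain \<rho> where \<rho>: "leaf_map a \<rho>" "\<forall>x\<in>{0..1}. 2 * k (\<rho> x) = x"
      using less.IH[of "M - 1" a "\<lambda>x. 2 * k x"] \<open>M > 0\<close> by (meson diff_less zero_less_one)
    have "standard_subdivision (M - 1) (n - a) (\<lambda>x. 2 * k (real a + x) - 1)"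
      unfolding standard_subdivision_def
    proof (intro conjI allI impI)
      fix i assume "i < n - a"
      then have "a + i < n" by simp
      from pieces[OF this] obtain j m where jm: "j \<le> M"
        "\<forall>t\<in>{0..1}. k (real (a + i) + t) = (real m + t) / 2 ^ j" by blast
      have "k (real a) \<le> k (real (a + i))"
        using \<open>i < n - a\<close> a by (intro le) auto
      then have *: "1 / 2 \<le> real m / 2 ^ j" using bspec[OF jm(2), of 0] ka by simp
      have "k (real (a + i) + 1) \<le> k (real n)"
        using \<open>i < n - a\<close> a by (intro le) auto
      then have **: "(real m + 1) / 2 ^ j \<le> 1" using bspec[OF jm(2), of 1] n by simp
      have "j \<noteq> 0"
      proof
        assume "j = 0"
        with * ** have "1 / 2 \<le> real m" "real m \<le> 0" by simp_all
        then show False by linarith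
      qed
      then obtain j' where j': "j = Suc j'" by (cases j) auto
      have "real (2 ^ j') \<le> real m" using * j' by (simp add: field_simps)
      then have "2 ^ j' \<le> m" by (simp only: of_nat_le_iff)
      then obtain m' where m': "m = 2 ^ j' + m'" using le_Suc_ex by blast
      have "2 * k (real a + (real i + t)) - 1 = (real m' + t) / 2 ^ j'" if "t \<in> {0..1}" for t
      proof -
        have "k (real a + (real i + t)) = (real m + t) / 2 ^ j"
          using bspec[OF jm(2) that] by (simp add: add.assoc)
        then show ?thesis
          unfolding j' m' by (simp add: field_simps)
      qed
      moreover have "j' \<le> M - 1" using jm(1) j' by simp
      ultimately show "\<exists>j\<le>M - 1. \<exists>m::nat. \<forall>t\<in>{0..1}. 2 * k (real a + (real i + t)) - 1 = (real m + t) / 2 ^ j"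
        by blast
    next
      fix x y :: real assume "0 \<le> x" "x < y" "y \<le> real (n - a)"
      then show "2 * k (real a + x) - 1 < 2 * k (real a + y) - 1"
        using mono[of "real a + x" "real a + y"] a by (simp add: of_nat_diff)
    qed (use \<open>a < n\<close> n ka in \<open>auto simp: of_nat_diff\<close>)
    then obtain \<sigma> where \<sigma>: "leaf_map (n - a) \<sigma>" "\<forall>x\<in>{0..1}. 2 * k (real a + \<sigma> x) - 1 = x"
      using less.IH[of "M - 1" "n - a" "\<lambda>x. 2 * k (real a + x) - 1"] \<open>M > 0\<close>
      by (meson diff_less zero_less_one)
    from leaf_map_join[OF \<rho>(1) \<sigma>(1)] obtain \<tau> where \<tau>: "leaf_map (a + (n - a)) \<tau>"
      "\<And>x. 0 \<le> x \<Longrightarrow> x \<le> 1/2 \<Longrightarrow> \<tau> x = \<rho> (2 * x)"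
      "\<And>x. 1/2 \<le> x \<Longrightarrow> x \<le> 1 \<Longrightarrow> \<tau> x = real a + \<sigma> (2 * x - 1)" by blast
    have "k (\<tau> x) = x" if "x \<in> {0..1}" for x
    proof (cases "x \<le> 1/2")
      case True
      then show ?thesis using \<tau>(2)[of x] bspec[OF \<rho>(2), of "2 * x"] that by simp
    next
      case False
      then show ?thesis using \<tau>(3)[of x] bspec[OF \<sigma>(2), of "2 * x - 1"] that by simp
    qed
    moreover have "a + (n - a) = n" using a by simp
    ultimately show ?thesis using \<tau>(1) by metis
  qed
qed

text \<open>The tree that is always split at its last leaf.\<close>

primrec comb :: "nat \<Rightarrow> real \<Rightarrow> real" where
  "comb 0 = id"
| "comb (Suc m) = split_leaf m \<circ> comb m"

lemma leaf_map_comb: "leaf_map (Suc m) (comb m)"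
proof (induction m)
  case 0
  show ?case using leaf_map.leaf by (simp only: comb.simps One_nat_def)
next
  case (Suc m)
  show ?case unfolding comb.simps by (rule leaf_map.caret[OF Suc lessI])
qed

lemma comb_PL_line: "comb m \<in> PL_line"
  by (induction m) (simp_all only: comb.simps PL_line_id PL_line_comp split_leaf_PL_line)

text \<open>The classical infinite family of generators \<open>x\<^sub>i\<close>: split leaf \<open>i\<close> of a comb and compare the result with the next
  larger comb.\<close>

definition xgen :: "nat \<Rightarrow> real \<Rightarrow> real" where
  "xgen i = finv (comb (i + 2)) \<circ> split_leaf i \<circ> comb (i + 1)"

text \<open>It does not matter how large the comb is, provided that leaf \<open>i\<close> is not its last leaf.\<close>

lemma comb_comp_xgen:
  assumes "i + 2 \<le> m"
  shows "comb m \<circ> xgen i = split_leaf i \<circ> comb (m - 1)"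
  using assms
proof (induction m rule: dec_induct)
  case base
  show ?case
    by (simp add: xgen_def o_assoc[symmetric] fun_eq_iff f_finv comb_PL_line del: comb.simps)
next
  case (step m)
  then obtain m' where m: "m = Suc m'" "i < m'" by (cases m) auto
  have "comb (Suc m) \<circ> xgen i = split_leaf m \<circ> (comb m \<circ> xgen i)"
    by (simp only: comb.simps o_assoc)
  also have "comb m \<circ> xgen i = split_leaf i \<circ> comb m'"
    using step.IH m by (simp only: diff_Suc_1)
  finally have "comb (Suc m) \<circ> xgen i = split_leaf (Suc m') \<circ> (split_leaf i \<circ> comb m')"
    unfolding m(1) .
  also have "\<dots> = split_leaf i \<circ> (split_leaf m' \<circ> comb m')"
    using split_leaf_commute[OF m(2)] by (metis o_assoc)
  finally show ?case unfolding m(1) by (simp only: comb.simps diff_Suc_1)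
qed

lemma comb_comp_cancel: "comb m \<circ> f = comb m \<circ> g \<Longrightarrow> f = g"
  using PL_line_inj[OF comb_PL_line[of m]] by (auto simp: fun_eq_iff inj_def)

lemma xgen_PL_line: "xgen i \<in> PL_line"
  unfolding xgen_def by (intro PL_line_comp PL_line_finv comb_PL_line split_leaf_PL_line)

lemma xgen_TF: "xgen i \<in> TF"
proof -
  have "xgen i x = x" if "x \<le> 0" for x
  proof -
    have "comb m x = x" for m using leaf_map_props(3)[OF leaf_map_comb that] .
    then show ?thesis using that
      by (simp add: xgen_def finv_eq_iff comb_PL_line split_leaf_simps del: comb.simps)
  qed
  moreover have "xgen i x = x" if "x \<ge> 1" for x
  proof -
    have "comb m x = x + real m" for m using leaf_map_props(4)[OF leaf_map_comb[of m] that] by simp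
    then show ?thesis using that
      by (simp add: xgen_def finv_eq_iff comb_PL_line split_leaf_simps del: comb.simps)
  qed
  ultimately show ?thesis using xgen_PL_line by (auto simp: TF_def)
qed

lemma xgen_commute:
  assumes "i < j" shows "xgen i \<circ> xgen j = xgen (Suc j) \<circ> xgen i"
proof (rule comb_comp_cancel[of "j + 3"])
  have "comb (j + 3) \<circ> (xgen i \<circ> xgen j) = split_leaf i \<circ> (comb (j + 2) \<circ> xgen j)"
    using comb_comp_xgen[of i "j + 3"] assms by (simp add: o_assoc del: comb.simps)
  also have "\<dots> = split_leaf i \<circ> (split_leaf j \<circ> comb (j + 1))"
    by (subst comb_comp_xgen) (simp_all del: comb.simps)
  also have "\<dots> = split_leaf (Suc j) \<circ> (split_leaf i \<circ> comb (j + 1))"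
    using split_leaf_commute[OF assms] by (metis o_assoc)
  also have "\<dots> = split_leaf (Suc j) \<circ> (comb (j + 2) \<circ> xgen i)"
    using assms by (subst comb_comp_xgen[of i "j + 2"]) (simp_all del: comb.simps)
  also have "\<dots> = comb (j + 3) \<circ> (xgen (Suc j) \<circ> xgen i)"
    using comb_comp_xgen[of "Suc j" "j + 3"] by (simp add: o_assoc del: comb.simps)
  finally show "comb (j + 3) \<circ> (xgen i \<circ> xgen j) = comb (j + 3) \<circ> (xgen (Suc j) \<circ> xgen i)" .
qed

lemma xgen_mem:
  assumes S: "subgrp S" and "xgen 0 \<in> S" "xgen 1 \<in> S"
  shows "xgen i \<in> S"
proof (induction i rule: less_induct)
  case (less i)
  show ?case
  proof (cases "i \<le> 1")
    case True
    then show ?thesis using assms by (cases i) auto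
  next
    case False
    then obtain j where j: "i = Suc j" "0 < j" by (cases i) auto
    have "xgen i = xgen 0 \<circ> xgen j \<circ> finv (xgen 0)"
      using xgen_commute[OF j(2)] self_comp_finv[OF xgen_PL_line[of 0]]
      unfolding j(1) by (metis comp_id o_assoc)
    moreover have "xgen j \<in> S" using less.IH[of j] j by simp
    ultimately show ?thesis
      using subgrpD(2,3)[OF S] assms(2) by (simp only:)
  qed
qed

text \<open>By induction on the number of splits: a split of the last leaf turns a comb into a comb, and any
  other split contributes a factor \<open>x\<^sub>i\<close>.\<close>

lemma comb_leaf_map_mem:
  assumes S: "subgrp S" and "xgen 0 \<in> S" "xgen 1 \<in> S" and "leaf_map n \<rho>"
  shows "finv (comb (n - 1)) \<circ> \<rho> \<in> S"
  using assms(4)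
proof induction
  case leaf
  have "finv (comb (1 - 1)) \<circ> id = id" by simp
  then show ?case using subgrpD(1)[OF S] by (simp only:)
next
  case (caret n \<rho> i)
  obtain m where n: "n = Suc m" using caret(2) by (cases n) auto
  have "finv (comb n) \<circ> (split_leaf i \<circ> \<rho>) = (if i = m then id else xgen i) \<circ> (finv (comb m) \<circ> \<rho>)"
  proof (rule comb_comp_cancel[of n])
    have "comb n \<circ> (finv (comb n) \<circ> (split_leaf i \<circ> \<rho>)) = split_leaf i \<circ> \<rho>"
      by (simp add: o_assoc self_comp_finv comb_PL_line del: comb.simps)
    also have "\<dots> = split_leaf i \<circ> comb m \<circ> (finv (comb m) \<circ> \<rho>)"
      by (auto simp: f_finv comb_PL_line simp del: comb.simps)
    also have "split_leaf i \<circ> comb m = comb n \<circ> (if i = m then id else xgen i)"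
      using comb_comp_xgen[of i n] caret(2) n by auto
    finally show "comb n \<circ> (finv (comb n) \<circ> (split_leaf i \<circ> \<rho>)) =
       comb n \<circ> ((if i = m then id else xgen i) \<circ> (finv (comb m) \<circ> \<rho>))"
      by (simp only: o_assoc)
  qed
  moreover have "(if i = m then id else xgen i) \<in> S"
    using xgen_mem[OF assms(1-3), of i] subgrpD(1)[OF S] by (cases "i = m") simp_all
  moreover have "finv (comb m) \<circ> \<rho> \<in> S" using caret(3) unfolding n by (simp only: diff_Suc_1)
  ultimately show ?case
    using subgrpD(2)[OF S] by (simp only: diff_Suc_1)
qed

text \<open>A map of \<open>F\<close> is a change between two subdivisions of the interval with equally many
  pieces; each subdivision is compared with the comb.\<close>

theorem TF_generated:
  assumes S: "subgrp S" and x: "xgen 0 \<in> S" "xgen 1 \<in> S"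
  shows "TF \<subseteq> S"
proof
  fix f assume f: "f \<in> TF"
  obtain N where "\<forall>i<2 ^ N.
     \<exists>j m::nat. \<forall>t\<in>{0..1::real}. f ((real i + t) / 2 ^ N) = (real m + t) / 2 ^ j"
    using TF_standard_intervals[OF f] ..
  then have "\<forall>i. \<exists>j. i < 2 ^ N \<longrightarrow>
     (\<exists>m::nat. \<forall>t\<in>{0..1::real}. f ((real i + t) / 2 ^ N) = (real m + t) / 2 ^ j)"
    by blast
  from choice[OF this] obtain J where J: "\<And>i. i < 2 ^ N \<Longrightarrow>
     \<exists>m::nat. \<forall>t\<in>{0..1::real}. f ((real i + t) / 2 ^ N) = (real m + t) / 2 ^ J i"
    by blast
  define M where "M = Max (J ` {..<2 ^ N})"
  have "J i \<le> M" if "i < 2 ^ N" for i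
    unfolding M_def using that by (intro Max_ge) auto
  then have "\<exists>j\<le>M. \<exists>m::nat. \<forall>t\<in>{0..1::real}. f ((real i + t) / 2 ^ N) = (real m + t) / 2 ^ j"
    if "i < 2 ^ N" for i
    using J[OF that] that by blast
  then have "standard_subdivision M (2 ^ N) (\<lambda>x. f (x / 2 ^ N))"
    unfolding standard_subdivision_def
    by (intro conjI allI impI)
      (simp_all add: f PL_line_less_iff[OF TF_PL_line[OF f]] divide_strict_right_mono)
  then obtain \<rho> where \<rho>: "leaf_map (2 ^ N) \<rho>" "\<forall>x\<in>{0..1}. f (\<rho> x / 2 ^ N) = x"
    using standard_subdivision_leaf_map by blast
  have "\<exists>j\<le>N. \<exists>m::nat. \<forall>t\<in>{0..1::real}. (real i + t) / 2 ^ N = (real m + t) / 2 ^ j" for i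
    by blast
  then have "standard_subdivision N (2 ^ N) (\<lambda>x. x / 2 ^ N)"
    unfolding standard_subdivision_def
    by (intro conjI allI impI) (simp_all add: divide_strict_right_mono)
  then obtain \<sigma> where \<sigma>: "leaf_map (2 ^ N) \<sigma>" "\<forall>x\<in>{0..1}. \<sigma> x / 2 ^ N = x"
    using standard_subdivision_leaf_map by blast
  define c where "c = finv (comb (2 ^ N - 1))"
  have PL: "\<rho> \<in> PL_line" "\<sigma> \<in> PL_line" "c \<in> PL_line"
    unfolding c_def by (rule leaf_map_props(2)[OF \<rho>(1)] leaf_map_props(2)[OF \<sigma>(1)]
      PL_line_finv[OF comb_PL_line])+
  have "\<rho> (f x) = \<sigma> x" for x
  proof (cases "0 \<le> x \<and> x \<le> 1")
    case True
    then have "f (\<rho> (f x) / 2 ^ N) = f x" using TF_bounds[OF f, of x] by (intro bspec[OF \<rho>(2)]) simp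
    then have "\<rho> (f x) / 2 ^ N = x" using PL_line_inj[OF TF_PL_line[OF f]] by (simp add: inj_eq)
    also have "\<dots> = \<sigma> x / 2 ^ N" using bspec[OF \<sigma>(2), of x] True by simp
    finally show ?thesis by simp
  next
    case False
    then show ?thesis
      using TF_outside[OF f, of x] leaf_map_props(3,4)[OF \<rho>(1), of x] leaf_map_props(3,4)[OF \<sigma>(1), of x]
      by fastforce
  qed
  then have *: "(c \<circ> \<sigma>) x = (c \<circ> \<rho>) (f x)" for x by simp
  have "finv (c \<circ> \<rho>) \<circ> (c \<circ> \<sigma>) = f"
    by (rule ext) (simp only: o_apply[of "finv (c \<circ> \<rho>)"] * finv_f[OF PL_line_comp[OF PL(3,1)]])
  moreover have "c \<circ> \<rho> \<in> S" "c \<circ> \<sigma> \<in> S"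
    unfolding c_def by (rule comb_leaf_map_mem[OF S x \<rho>(1)] comb_leaf_map_mem[OF S x \<sigma>(1)])+
  ultimately show "f \<in> S" using subgrpD(2,3)[OF S] by metis
qed

section \<open>The kernel of the slope maps as a normal closure\<close>

lemma germ_split_leaf_0: "germ 1 (split_leaf i) 0 (if i = 0 then 1 else 0)"
proof (rule germ_rightI[of 1])
  fix y :: real assume "0 \<le> y" "y \<le> 0 + 1"
  then show "split_leaf i y = split_leaf i 0 + 2 powi (if i = 0 then 1 else 0) * (y - 0)"
    by (auto simp: split_leaf_def max_def min_def)
qed simp

lemma germ_split_leaf_left:
  "germ (-1) (split_leaf i) (real i + 1) 1"
  "real i + 2 \<le> x \<Longrightarrow> germ (-1) (split_leaf i) x 0"
proof -
  show "germ (-1) (split_leaf i) (real i + 1) 1"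
    by (rule germ_leftI[of 1]) (auto simp: split_leaf_def max_def min_def)
  show "germ (-1) (split_leaf i) x 0" if "real i + 2 \<le> x"
    by (rule germ_leftI[of 1]) (use that in \<open>auto simp: split_leaf_def max_def min_def\<close>)
qed

lemma comb_at_ends: "comb m 0 = 0" "comb m 1 = real m + 1"
  using leaf_map_props(3)[OF leaf_map_comb, of 0 m] leaf_map_props(4)[OF leaf_map_comb, of 1 m] by simp_all

lemma germ_comb_0: "m > 0 \<Longrightarrow> germ 1 (comb m) 0 1"
proof (induction m)
  case (Suc m)
  show ?case
  proof (cases "m = 0")
    case True
    have "germ 1 (split_leaf 0 \<circ> id) 0 (1 + 0)"
      by (rule germ_comp[OF germ_id(1)]) (use germ_split_leaf_0[of 0] in simp)
    then show ?thesis unfolding True comb.simps by (simp only: add_0_right)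
  next
    case False
    have "germ 1 (split_leaf m \<circ> comb m) 0 (0 + 1)"
      by (rule germ_comp[OF Suc.IH]) (use False germ_split_leaf_0[of m] in \<open>simp_all add: comb_at_ends\<close>)
    then show ?thesis unfolding comb.simps by (simp only: add_0)
  qed
qed simp

lemma germ_comb_1: "germ (-1) (comb m) 1 (int m)"
proof (induction m)
  case 0
  show ?case by (simp only: comb.simps of_nat_0 germ_id)
next
  case (Suc m)
  have "germ (-1) (split_leaf m \<circ> comb m) 1 (1 + int m)"
    by (rule germ_comp[OF Suc]) (use germ_split_leaf_left(1)[of m] in \<open>simp add: comb_at_ends\<close>)
  then show ?case unfolding comb.simps by (simp only: of_nat_Suc)
qed

lemma slope_xgen: "slope0 (xgen i) = (if i = 0 then 1 else 0)" "slope1 (xgen i) = -1"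
proof -
  have "germ 1 (split_leaf i \<circ> comb (i + 1)) 0 ((if i = 0 then 1 else 0) + 1)"
    by (rule germ_comp[OF germ_comb_0]) (simp, use germ_split_leaf_0[of i] in \<open>simp only: comb_at_ends\<close>)
  moreover have "(split_leaf i \<circ> comb (i + 1)) 0 = comb (i + 2) 0"
    by (simp only: o_apply comb_at_ends) (simp add: split_leaf_simps)
  ultimately have "germ 1 (finv (comb (i + 2)) \<circ> (split_leaf i \<circ> comb (i + 1))) 0 (- 1 + ((if i = 0 then 1 else 0) + 1))"
    using germ_finv[OF germ_comb_0[of "i + 2"] PL_line_inj[OF comb_PL_line]]
    by (intro germ_comp[of 1 "split_leaf i \<circ> comb (i + 1)"]) (assumption, simp only: add_gr_0 zero_less_numeral simp_thms)
  then show "slope0 (xgen i) = (if i = 0 then 1 else 0)"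
    by (intro slope0_eq) (simp add: xgen_def o_assoc del: comb.simps)
  have "germ (-1) (split_leaf i \<circ> comb (i + 1)) 1 (0 + int (i + 1))"
    by (rule germ_comp[OF germ_comb_1]) (simp only: comb_at_ends, rule germ_split_leaf_left(2), simp)
  moreover have "(split_leaf i \<circ> comb (i + 1)) 1 = comb (i + 2) 1"
    by (simp only: o_apply comb_at_ends) (simp add: split_leaf_simps)
  ultimately have "germ (-1) (finv (comb (i + 2)) \<circ> (split_leaf i \<circ> comb (i + 1))) 1 (- int (i + 2) + (0 + int (i + 1)))"
    using germ_finv[OF germ_comb_1[of "i + 2"] PL_line_inj[OF comb_PL_line]]
    by (intro germ_comp[of "-1" "split_leaf i \<circ> comb (i + 1)"]) (assumption, simp only:)
  then show "slope1 (xgen i) = -1"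
    by (intro slope1_eq) (simp add: xgen_def o_assoc del: comb.simps)
qed

definition TF_group :: "(real \<Rightarrow> real) monoid" where
  "TF_group = \<lparr>carrier = TF, mult = (\<circ>), one = id\<rparr>"

lemma TF_group_simps [simp]: "carrier TF_group = TF" "mult TF_group = (\<circ>)" "one TF_group = id"
  by (simp_all add: TF_group_def)

lemma group_TF_group: "group TF_group"
proof (rule groupI)
  fix x assume "x \<in> carrier TF_group"
  then show "\<exists>y\<in>carrier TF_group. y \<otimes>\<^bsub>TF_group\<^esub> x = \<one>\<^bsub>TF_group\<^esub>"
    using finv_comp_self[OF TF_PL_line, of x] TF_finv[of x] by (intro bexI[of _ "finv x"]) simp_all
qed (simp_all add: TF_id TF_comp o_assoc)

lemma inv_TF_group: "f \<in> TF \<Longrightarrow> inv\<^bsub>TF_group\<^esub> f = finv f"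
  using group.inv_equality[OF group_TF_group, of "finv f" f] finv_comp_self[OF TF_PL_line, of f] TF_finv
  by simp

lemma subgroup_TF_group: "subgrp H \<Longrightarrow> H \<subseteq> TF \<Longrightarrow> subgroup H TF_group"
  by (intro group.subgroupI[OF group_TF_group]) (auto simp: inv_TF_group subset_iff subgrp_def)

lemma (in group) commute_inv:
  assumes "u \<in> carrier G" "x \<in> carrier G" "u \<otimes> x = x \<otimes> u"
  shows "inv u \<otimes> x = x \<otimes> inv u"
  using assms by (metis inv_closed inv_solve_left inv_solve_right m_assoc m_closed)

lemma (in group) commute_mult:
  assumes "a \<in> carrier G" "b \<in> carrier G" "u \<in> carrier G" "a \<otimes> u = u \<otimes> a" "b \<otimes> u = u \<otimes> b"
  shows "a \<otimes> b \<otimes> u = u \<otimes> (a \<otimes> b)"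
  using assms by (metis m_assoc)

lemma (in group) commute_if_commutator_one:
  assumes x: "x \<in> carrier G" and y: "y \<in> carrier G" and 1: "inv y \<otimes> x \<otimes> y \<otimes> inv x = \<one>"
  shows "x \<otimes> y = y \<otimes> x"
proof -
  have "x \<otimes> y = (y \<otimes> inv y) \<otimes> x \<otimes> y \<otimes> (inv x \<otimes> x)"
    using x y by simp
  also have "\<dots> = y \<otimes> (inv y \<otimes> x \<otimes> y \<otimes> inv x) \<otimes> x"
    using x y by (simp only: m_assoc m_closed inv_closed)
  also have "\<dots> = y \<otimes> x" using x y by (simp add: 1)
  finally show ?thesis .
qed

text \<open>Modulo the normal closure of one commutator of the generators, \<open>F\<close> is abelian and every class has
  the form \<open>x\<^sub>0\<^sup>a x\<^sub>1\<^sup>b\<close>. The slopes at the end points recover \<open>a\<close> and \<open>b\<close>, so an element whose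
  slopes are trivial lies in the normal closure.\<close>

theorem TF_cpt_subset_normal_closure:
  assumes S: "subgrp S"
    and comm: "finv (xgen 1) \<circ> xgen 0 \<circ> xgen 1 \<circ> finv (xgen 0) \<in> S"
    and conj: "\<And>i y. i \<in> {0, 1} \<Longrightarrow> y \<in> TF_cpt \<Longrightarrow> y \<in> S \<Longrightarrow> xgen i \<circ> y \<circ> finv (xgen i) \<in> S"
      "\<And>i y. i \<in> {0, 1} \<Longrightarrow> y \<in> TF_cpt \<Longrightarrow> y \<in> S \<Longrightarrow> finv (xgen i) \<circ> y \<circ> xgen i \<in> S"
  shows "TF_cpt \<subseteq> S"
proof -
  interpret G: group TF_group by (rule group_TF_group)
  have subgrp_cpt: "subgrp TF_cpt"
    by (auto simp: subgrp_def TF_cpt_def TF_id TF_comp TF_finv slope0_comp slope1_comp slope0_finv slope1_finv)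
  \<comment> \<open>Slopes have to be constant on cosets, hence the intersection.\<close>
  define N where "N = S \<inter> TF_cpt"
  have N: "subgrp N" unfolding N_def by (rule subgrp_Int[OF S subgrp_cpt])
  have NTF: "N \<subseteq> TF" by (auto simp: N_def TF_cpt_def)
  have cpt_conj: "g \<circ> y \<circ> finv g \<in> TF_cpt" "finv g \<circ> y \<circ> g \<in> TF_cpt" if "g \<in> TF" "y \<in> TF_cpt" for g y
    using that by (auto simp: TF_cpt_def TF_comp TF_finv slope0_comp slope1_comp slope0_finv slope1_finv)
  define C where "C = {g \<in> TF. \<forall>y\<in>N. g \<circ> y \<circ> finv g \<in> N \<and> finv g \<circ> y \<circ> g \<in> N}"
  have "TF \<subseteq> C"
  proof (rule TF_generated)
    show "subgrp C"
      unfolding subgrp_def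
    proof (intro conjI ballI)
      show "id \<in> C" by (simp add: C_def TF_id)
      fix f g assume fg: "f \<in> C" "g \<in> C"
      then have *: "f \<in> TF" "g \<in> TF" by (auto simp: C_def)
      have "(f \<circ> g) \<circ> y \<circ> finv (f \<circ> g) = f \<circ> (g \<circ> y \<circ> finv g) \<circ> finv f"
        "finv (f \<circ> g) \<circ> y \<circ> (f \<circ> g) = finv g \<circ> (finv f \<circ> y \<circ> f) \<circ> g" for y
        using finv_comp[OF TF_PL_line[OF *(1)] TF_PL_line[OF *(2)]] by (simp_all only: o_assoc)
      then show "f \<circ> g \<in> C" using fg TF_comp[OF *] by (simp add: C_def)
    next
      fix f assume "f \<in> C"
      then show "finv f \<in> C" by (simp add: C_def TF_finv finv_finv TF_PL_line)
    qed
    show "xgen 0 \<in> C" "xgen 1 \<in> C"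
      using conj[of 0] conj[of 1] cpt_conj xgen_TF by (auto simp: C_def N_def simp del: One_nat_def)
  qed
  then have "N \<lhd> TF_group"
    using NTF by (auto simp: G.normal_inv_iff inv_TF_group C_def intro!: subgroup_TF_group N)
  then interpret N: normal N TF_group .
  define Q where "Q = TF_group Mod N"
  interpret Q: group Q unfolding Q_def by (rule N.factorgroup_is_group)
  define h where "h = (\<lambda>a. N #>\<^bsub>TF_group\<^esub> a)"
  interpret h: group_hom TF_group Q h
    unfolding h_def using N.r_coset_hom_Mod G.is_group Q.is_group
    by (simp add: group_hom_def group_hom_axioms_def Q_def)
  have h_closed: "h f \<in> carrier Q" if "f \<in> TF" for f using h.hom_closed that by simp
  have h_mult: "h (f \<circ> g) = h f \<otimes>\<^bsub>Q\<^esub> h g" if "f \<in> TF" "g \<in> TF" for f g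
    using h.hom_mult that by simp
  have h_finv: "h (finv f) = inv\<^bsub>Q\<^esub> h f" if "f \<in> TF" for f
    using h.hom_inv[of f] that by (simp add: inv_TF_group)
  have h_one: "h f = \<one>\<^bsub>Q\<^esub> \<longleftrightarrow> f \<in> N" if "f \<in> TF" for f
    using that G.coset_join1[of N f] G.coset_join2[of f N] N.subgroup_axioms
    by (auto simp: h_def FactGroup_def Q_def)
  have h_id: "h id = \<one>\<^bsub>Q\<^esub>" using h.hom_one by simp
  let ?X = "h (xgen 0)" and ?Y = "h (xgen 1)"
  note X = h_closed[OF xgen_TF]
  have "finv (xgen 1) \<circ> xgen 0 \<circ> xgen 1 \<circ> finv (xgen 0) \<in> N"
    using comm by (simp add: N_def TF_cpt_def TF_comp TF_finv xgen_TF slope0_comp slope1_comp slope0_finv slope1_finv)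
  then have "h (finv (xgen 1) \<circ> xgen 0 \<circ> xgen 1 \<circ> finv (xgen 0)) = \<one>\<^bsub>Q\<^esub>"
    using h_one NTF by blast
  then have "inv\<^bsub>Q\<^esub> ?Y \<otimes>\<^bsub>Q\<^esub> ?X \<otimes>\<^bsub>Q\<^esub> ?Y
      \<otimes>\<^bsub>Q\<^esub> inv\<^bsub>Q\<^esub> ?X = \<one>\<^bsub>Q\<^esub>"
    by (simp add: h_mult h_finv TF_comp TF_finv xgen_TF)
  then have XY: "?X \<otimes>\<^bsub>Q\<^esub> ?Y = ?Y \<otimes>\<^bsub>Q\<^esub> ?X"
    using X by (intro Q.commute_if_commutator_one)
  define Z where "Z U = {f \<in> TF. \<forall>u\<in>U. h f \<otimes>\<^bsub>Q\<^esub> u = u \<otimes>\<^bsub>Q\<^esub> h f}" for U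
  have sub: "subgrp (Z U)" if U: "U \<subseteq> carrier Q" for U
    unfolding subgrp_def
  proof (intro conjI ballI)
    show "id \<in> Z U"
      using U h_id by (auto simp: TF_id subset_iff Z_def)
  next
    fix f g assume "f \<in> Z U" "g \<in> Z U"
    then show "f \<circ> g \<in> Z U"
      using U h_closed by (simp add: TF_comp h_mult subset_iff Q.commute_mult Z_def)
  next
    fix f assume "f \<in> Z U"
    then show "finv f \<in> Z U"
      using U h_closed by (simp add: TF_finv h_finv subset_iff Q.commute_inv Z_def)
  qed
  have central: "h f \<otimes>\<^bsub>Q\<^esub> u = u \<otimes>\<^bsub>Q\<^esub> h f"
    if "f \<in> TF" "u \<in> {?X, ?Y}" for f u
  proof -
    have "TF \<subseteq> Z {?X, ?Y}"
    proof (rule TF_generated[OF sub])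
      show "{?X, ?Y} \<subseteq> carrier Q" using X by blast
      show "xgen 0 \<in> Z {?X, ?Y}" "xgen 1 \<in> Z {?X, ?Y}"
        unfolding Z_def using xgen_TF XY XY[symmetric] by blast+
    qed
    then show ?thesis using that unfolding Z_def by blast
  qed
  have comm: "h f \<otimes>\<^bsub>Q\<^esub> h g = h g \<otimes>\<^bsub>Q\<^esub> h f" if "f \<in> TF" "g \<in> TF" for f g
  proof -
    have "TF \<subseteq> Z {h g}"
    proof (rule TF_generated[OF sub])
      show "{h g} \<subseteq> carrier Q" using h_closed that by blast
      show "xgen 0 \<in> Z {h g}" "xgen 1 \<in> Z {h g}"
        unfolding Z_def using xgen_TF central[OF that(2), of ?X] central[OF that(2), of ?Y] by auto
    qed
    then show ?thesis using that unfolding Z_def by blast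
  qed
  have "carrier Q = h ` TF"
    by (auto simp: FactGroup_def RCOSETS_def h_def Q_def)
  then interpret Q: comm_group Q
    using comm by (intro Q.group_comm_groupI) auto
  \<comment> \<open>As \<open>x\<^sub>0\<close> has slope exponents \<open>(1, -1)\<close> and \<open>x\<^sub>1\<close> has \<open>(0, -1)\<close>, these are the only possible exponents.\<close>
  define w where "w f = ?X [^]\<^bsub>Q\<^esub> slope0 f
      \<otimes>\<^bsub>Q\<^esub> ?Y [^]\<^bsub>Q\<^esub> (- slope1 f - slope0 f)" for f
  have w_closed: "w f \<in> carrier Q" for f
    using X by (simp add: w_def)
  have w_comp: "w (f \<circ> g) = w f \<otimes>\<^bsub>Q\<^esub> w g" if "f \<in> TF" "g \<in> TF" for f g
  proof -
    have "- slope1 (f \<circ> g) - slope0 (f \<circ> g) = (- slope1 f - slope0 f) + (- slope1 g - slope0 g)"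
      using that by (simp add: slope0_comp slope1_comp)
    then have "w (f \<circ> g) = (?X [^]\<^bsub>Q\<^esub> slope0 f \<otimes>\<^bsub>Q\<^esub> ?X [^]\<^bsub>Q\<^esub> slope0 g) \<otimes>\<^bsub>Q\<^esub>
      (?Y [^]\<^bsub>Q\<^esub> (- slope1 f - slope0 f) \<otimes>\<^bsub>Q\<^esub> ?Y [^]\<^bsub>Q\<^esub> (- slope1 g - slope0 g))"
      unfolding w_def slope0_comp[OF that] by (simp only: Q.int_pow_mult[OF X])
    also have "\<dots> = w f \<otimes>\<^bsub>Q\<^esub> w g"
      unfolding w_def by (simp only: Q.m_ac Q.m_closed Q.int_pow_closed[OF X])
    finally show ?thesis .
  qed
  have "TF \<subseteq> {f \<in> TF. h f = w f}"
  proof (rule TF_generated)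
    show "subgrp {f \<in> TF. h f = w f}"
      unfolding subgrp_def
    proof (intro conjI ballI)
      show "id \<in> {f \<in> TF. h f = w f}" using h_id by (simp add: TF_id w_def)
      fix f g assume "f \<in> {f \<in> TF. h f = w f}" "g \<in> {f \<in> TF. h f = w f}"
      then show "f \<circ> g \<in> {f \<in> TF. h f = w f}" by (simp add: TF_comp h_mult w_comp)
    next
      fix f assume f: "f \<in> {f \<in> TF. h f = w f}"
      then have "w (finv f) \<otimes>\<^bsub>Q\<^esub> w f = w id"
        using w_comp[of "finv f" f] by (simp add: TF_finv finv_comp_self TF_PL_line)
      also have "w id = \<one>\<^bsub>Q\<^esub>" by (simp add: w_def)
      finally have "inv\<^bsub>Q\<^esub> w f = w (finv f)"
        by (intro Q.inv_equality w_closed)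
      with f show "finv f \<in> {f \<in> TF. h f = w f}" by (simp add: TF_finv h_finv)
    qed
    show "xgen 0 \<in> {f \<in> TF. h f = w f}" "xgen 1 \<in> {f \<in> TF. h f = w f}"
      using X by (simp_all add: xgen_TF w_def slope_xgen)
  qed
  then have "y \<in> N" if "y \<in> TF_cpt" for y
    using that h_one[of y] by (auto simp: TF_cpt_def w_def)
  then show ?thesis by (auto simp: N_def)
qed

section \<open>Copies of the group in small dyadic intervals\<close>

text \<open>The copy of \<open>u\<close> in the interval from \<open>2\<^sup>-\<^sup>j\<^sup>-\<^sup>1\<close> to \<open>2\<^sup>-\<^sup>j\<close>.\<close>

definition transplant :: "nat \<Rightarrow> (real \<Rightarrow> real) \<Rightarrow> real \<Rightarrow> real" where
  "transplant j u = (\<lambda>y. (u (2 ^ (j + 1) * y - 1) + 1) / 2 ^ (j + 1))"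

lemma transplant_PL_line:
  assumes "u \<in> PL_line" shows "transplant j u \<in> PL_line"
proof -
  have "transplant j u = (\<lambda>x. 2 powi (- int (j + 1)) * u (2 powi (int (j + 1)) * x + (-1)) + 2 powi (- int (j + 1)))"
    by (rule ext) (simp only: transplant_def power_int_minus power_int_of_nat, simp add: field_simps)
  then show ?thesis
    using PL_line_affine_comp[OF assms dyadic_minus_1 dyadic_powi] by metis
qed

lemma transplant_comp: "transplant j (u \<circ> w) = transplant j u \<circ> transplant j w"
  by (rule ext) (simp add: transplant_def)

lemma transplant_id: "transplant j id = id"
  by (rule ext) (simp add: transplant_def)

lemma transplant_finv:
  assumes "u \<in> PL_line" shows "transplant j (finv u) = finv (transplant j u)"
proof -
  have "transplant j u (transplant j (finv u) y) = y" for y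
    using assms by (simp add: transplant_def f_finv)
  then show ?thesis
    by (intro ext) (metis finv_eq_iff[OF transplant_PL_line[OF assms]])
qed

lemma transplant_outside:
  assumes "u \<in> TF" "y \<le> (1/2) ^ (j + 1) \<or> y \<ge> (1/2) ^ j"
  shows "transplant j u y = y"
proof -
  have "2 ^ (j + 1) * y - 1 \<le> 0 \<or> 2 ^ (j + 1) * y - 1 \<ge> 1"
    using assms(2) by (auto simp: field_simps power_one_over)
  then have "u (2 ^ (j + 1) * y - 1) = 2 ^ (j + 1) * y - 1"
    by (rule TF_outside[OF assms(1)])
  then show ?thesis by (simp add: transplant_def)
qed

lemma transplant_TF:
  assumes "u \<in> TF" shows "transplant j u \<in> TF"
proof -
  have "y \<le> (1/2) ^ (j + 1) \<or> y \<ge> (1/2) ^ j" if "y \<le> 0 \<or> y \<ge> 1" for y :: real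
    using that power_le_one[of "1/2::real" j] zero_le_power[of "1/2::real" "j + 1"] by linarith
  then show ?thesis
    using transplant_outside[OF assms, of _ j] transplant_PL_line[OF TF_PL_line[OF assms]]
    by (auto simp: TF_def not_less)
qed

lemma transplant_TF_cpt:
  assumes "u \<in> TF" "j \<ge> 1" shows "transplant j u \<in> TF_cpt"
proof (rule TF_cptI[OF transplant_TF[OF assms(1)]])
  show "(1/2::real) ^ j < 1" using assms(2) by (simp add: power_less_one_iff)
  show "0 < (1/2::real) ^ (j + 1)" by simp
  show "transplant j u x = x" if "x \<le> (1/2) ^ (j + 1) \<or> x \<ge> (1/2) ^ j" for x
    by (rule transplant_outside[OF assms(1) that])
qed

lemma transplant_scale: "transplant (j + k) u ((1/2) ^ k * y) = (1/2) ^ k * transplant j u y"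
proof -
  have "2 ^ (j + k + 1) * ((1/2) ^ k * y) = 2 ^ (j + 1) * y"
    by (simp add: power_add power_one_over)
  then have "transplant (j + k) u ((1/2) ^ k * y) = (u (2 ^ (j + 1) * y - 1) + 1) / 2 ^ (j + k + 1)"
    by (simp only: transplant_def)
  then show ?thesis
    by (simp add: transplant_def power_add power_one_over field_simps)
qed

lemma transplant_surj:
  assumes z: "z \<in> PL_line" and \<alpha>: "(1/2) ^ (j + 1) < \<alpha>" and \<beta>: "\<beta> < (1/2) ^ j"
    and supp: "\<And>x. x \<le> \<alpha> \<or> x \<ge> \<beta> \<Longrightarrow> z x = x"
  obtains u where "u \<in> TF_cpt" "z = transplant j u"
proof -
  define c :: real where "c = 2 ^ (j + 1)"
  have c: "c > 0" "(1/2) ^ (j + 1) = 1 / c" "(1/2) ^ j = 2 / c" by (simp_all add: c_def power_one_over)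
  define u where "u = (\<lambda>x. c * z ((x + 1) / c) - 1)"
  have "u = (\<lambda>x. 2 powi (int (j + 1)) * z (2 powi (- int (j + 1)) * x + 2 powi (- int (j + 1))) + (-1))"
    by (rule ext) (simp only: u_def c_def power_int_minus power_int_of_nat, simp add: field_simps)
  then have PL: "u \<in> PL_line"
    using PL_line_affine_comp[OF z dyadic_powi dyadic_minus_1] by metis
  have fix_u: "u x = x" if "x \<le> c * \<alpha> - 1 \<or> x \<ge> c * \<beta> - 1" for x
  proof -
    have "(x + 1) / c \<le> \<alpha> \<or> (x + 1) / c \<ge> \<beta>"
      using that c(1) by (auto simp: field_simps)
    then show ?thesis using c(1) supp[of "(x + 1) / c"] by (simp add: u_def)
  qed
  have bounds: "0 < c * \<alpha> - 1" "c * \<beta> - 1 < 1"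
    using \<alpha> \<beta> c(1) unfolding c(2,3) by (simp_all add: field_simps)
  have "u \<in> TF"
    using PL fix_u bounds by (auto simp: TF_def)
  then have "u \<in> TF_cpt"
    by (rule TF_cptI[OF _ bounds]) (use fix_u in auto)
  moreover have "z = transplant j u"
    using c(1) unfolding transplant_def u_def c_def[symmetric] by (intro ext) simp
  ultimately show ?thesis by (rule that)
qed

section \<open>Elements contracting towards a given point\<close>

text \<open>The slopes \<open>1/2, 1, 2\<close> to the right of \<open>a\<close> put the two breaks at \<open>a + 1/4\<close> and \<open>7/8\<close>. With the
  slopes \<open>1/2\<close> and \<open>2\<close> alone the break need not be dyadic.\<close>

lemma exists_contraction_step:
  assumes a: "a \<in> dyadic" "0 < a" "a \<le> 1/2"
  shows "\<exists>v \<in> TF. slope1 v = 1 \<and> (\<forall>x\<le>a. v x = x) \<and> (\<forall>x. a < x \<and> x < 1 \<longrightarrow> v x < x)"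
proof
  define v where "v = (\<lambda>x. min x (max (max ((x + a) / 2) (x - 1/8)) (2 * x - 1)))"
  have "strict_mono v"
    by (auto simp: strict_mono_def v_def max_def min_def)
  moreover have "surj v"
    by (rule surjI[of _ "\<lambda>y. max y (min (min (2 * y - a) (y + 1/8)) ((y + 1) / 2))"])
      (use a in \<open>auto simp: v_def max_def min_def field_simps\<close>)
  moreover have "PL_at v x" for x
  proof -
    have 8: "1 / 8 \<in> dyadic"
      using dyadic_power[OF dyadic_half, of 3] by (simp add: power3_eq_cube)
    have 1: "PL_at (\<lambda>x. (x + a) / 2) x"
      using PL_at_affine[of "1/2 * a" "-1" x] dyadic_mult[OF dyadic_half a(1)]
      by (simp add: add_divide_distrib power_int_minus)
    have 2: "PL_at (\<lambda>x. x - 1/8) x"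
      using PL_at_affine[of "- (1/8)" 0 x] dyadic_uminus[OF 8] by simp
    have 3: "PL_at (\<lambda>x. 2 * x - 1) x"
      using PL_at_affine[of "-1" 1 x] dyadic_uminus[OF dyadic_1] by simp
    have 12: "PL_at (\<lambda>x. max ((x + a) / 2) (x - 1/8)) x"
    proof (rule PL_at_max[OF 1 2])
      assume "(x + a) / 2 = x - 1/8"
      then have "x = a + 1/2 * (1/2)" by simp
      then show "x \<in> dyadic" using a(1) dyadic_mult[OF dyadic_half dyadic_half] dyadic_add by metis
    qed
    have 123: "PL_at (\<lambda>x. max (max ((x + a) / 2) (x - 1/8)) (2 * x - 1)) x"
    proof (rule PL_at_max[OF 12 3])
      assume "max ((x + a) / 2) (x - 1/8) = 2 * x - 1"
      then have "x = 1 - 1/8" using a(3) by (auto simp: max_def split: if_splits)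
      then show "x \<in> dyadic" using 8 dyadic_diff[OF dyadic_1] by metis
    qed
    show ?thesis
      unfolding v_def
    proof (rule PL_at_min[OF PL_at_id(2) 123])
      assume "x = max (max ((x + a) / 2) (x - 1/8)) (2 * x - 1)"
      then have "x = a \<or> x = 1" using a(3) by (auto simp: max_def split: if_splits)
      then show "x \<in> dyadic" using a(1) by auto
    qed
  qed
  ultimately have PL: "v \<in> PL_line" by (auto simp: PL_line_def)
  have low: "v x = x" if "x \<le> a" for x
    using that a by (auto simp: v_def max_def min_def)
  moreover have "v x = x" if "x \<ge> 1" for x
    using that a by (auto simp: v_def max_def min_def)
  ultimately show "v \<in> TF"
    using PL a by (auto simp: TF_def)
  have "germ (-1) v 1 1"
    by (rule germ_leftI[of "1/8"]) (use a in \<open>auto simp: v_def max_def min_def\<close>)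
  then have "slope1 v = 1" by (rule slope1_eq)
  moreover have "v x < x" if "a < x" "x < 1" for x
    using that a by (auto simp: v_def max_def min_def)
  ultimately show "slope1 v = 1 \<and> (\<forall>x\<le>a. v x = x) \<and> (\<forall>x. a < x \<and> x < 1 \<longrightarrow> v x < x)"
    using low by blast
qed

lemma exists_contraction:
  assumes a: "a \<in> dyadic" "0 < a" "a \<le> 1/2" and "d \<ge> 1"
  shows "\<exists>v \<in> TF. slope1 v = int d \<and> (\<forall>x\<le>a. v x = x) \<and> (\<forall>x. a < x \<and> x < 1 \<longrightarrow> v x < x)"
proof -
  obtain u where u: "u \<in> TF" "slope1 u = 1" "\<And>x. x \<le> a \<Longrightarrow> u x = x"
    "\<And>x. a < x \<Longrightarrow> x < 1 \<Longrightarrow> u x < x"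
    using exists_contraction_step[OF a] by blast
  have low: "(u ^^ n) x = x" if "x \<le> a" for n x
    by (induction n) (use u(3) that in auto)
  have iter: "a < (u ^^ Suc n) x \<and> (u ^^ Suc n) x < x" if x: "a < x" "x < 1" for n x
  proof (induction n)
    case 0
    show ?case using u(4)[OF x] PL_line_less_iff[OF TF_PL_line[OF u(1)], of a x] u(3)[of a] x by simp
  next
    case (Suc n)
    define y where "y = (u ^^ Suc n) x"
    have y: "a < y" "y < x" using Suc by (simp_all add: y_def)
    then show ?case
      using u(4)[of y] PL_line_less_iff[OF TF_PL_line[OF u(1)], of a y] u(3)[of a] x
      by (simp flip: y_def) (simp add: y_def)
  qed
  obtain n where d: "d = Suc n" using assms(4) by (cases d) auto
  show ?thesis
    by (rule bexI[of _ "u ^^ d"])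
      (use low iter[of _ n] u(1,2) in \<open>auto simp: d slope_funpow TF_funpow simp del: funpow.simps\<close>)
qed

text \<open>Otherwise the iterates would decrease to a fixed point above \<open>T\<close>.\<close>

lemma funpow_below:
  assumes f: "f \<in> PL_line" and dec: "\<And>x. T \<le> x \<Longrightarrow> x \<le> \<beta> \<Longrightarrow> f x < x"
  shows "\<exists>n. (f ^^ n) \<beta> < T"
proof (rule ccontr)
  assume "\<not> ?thesis"
  then have ge: "T \<le> (f ^^ n) \<beta>" for n by (auto simp: not_less)
  have le: "(f ^^ n) \<beta> \<le> \<beta>" for n
  proof (induction n)
    case (Suc n)
    then show ?case using dec[OF ge[of n]] by simp
  qed simp
  have "decseq (\<lambda>n. (f ^^ n) \<beta>)"
    by (rule decseq_SucI) (use dec[OF ge le] in \<open>simp add: less_imp_le\<close>)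
  then obtain L where L: "(\<lambda>n. (f ^^ n) \<beta>) \<longlonglongrightarrow> L"
    using decseq_convergent[of "\<lambda>n. (f ^^ n) \<beta>" T] ge by blast
  have "T \<le> L" "L \<le> \<beta>"
    using LIMSEQ_le_const[OF L] LIMSEQ_le_const2[OF L] ge le by blast+
  then have "f L < L" by (rule dec)
  have "isCont f L" using f by (auto simp: PL_line_def intro: PL_at_isCont)
  then have "(\<lambda>n. f ((f ^^ n) \<beta>)) \<longlonglongrightarrow> f L" using L by (rule isCont_tendsto_compose)
  moreover have "(\<lambda>n. (f ^^ Suc n) \<beta>) \<longlonglongrightarrow> L" using L by (rule LIMSEQ_Suc)
  ultimately have "f L = L" by (simp add: LIMSEQ_unique)
  with \<open>f L < L\<close> show False by simp
qed

section \<open>Commutators and conjugates of maps with controlled support\<close>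

definition supported_on :: "(real \<Rightarrow> real) \<Rightarrow> real set \<Rightarrow> bool" where
  "supported_on f J \<longleftrightarrow> (\<forall>x. x \<notin> J \<longrightarrow> f x = x)"

lemma supported_onD: "supported_on f J \<Longrightarrow> x \<notin> J \<Longrightarrow> f x = x"
  by (simp add: supported_on_def)

lemma support_invariant:
  assumes "f \<in> PL_line" "supported_on f J"
  shows "f x \<in> J \<longleftrightarrow> x \<in> J"
proof (cases "x \<in> J")
  case True
  have "f x \<in> J"
  proof (rule ccontr)
    assume "f x \<notin> J"
    then have "f (f x) = f x" by (rule supported_onD[OF assms(2)])
    then have "f x = x" using PL_line_inj[OF assms(1)] by (simp add: inj_eq)
    with \<open>f x \<notin> J\<close> True show False by simp
  qed
  then show ?thesis using True by simp
qed (use supported_onD[OF assms(2)] in simp)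

lemma finv_supported_on:
  assumes "f \<in> PL_line" "supported_on f J"
  shows "supported_on (finv f) J"
  using assms by (simp add: supported_on_def finv_eq_iff)

lemma finv_agree:
  assumes u: "u \<in> PL_line" and w: "w \<in> PL_line" "supported_on w J"
    and eq: "\<forall>x\<in>J. u x = w x"
  shows "\<forall>x\<in>J. finv u x = finv w x"
proof
  fix x assume "x \<in> J"
  then have "finv w x \<in> J"
    using support_invariant[OF PL_line_finv[OF w(1)] finv_supported_on[OF w]] by simp
  then have "u (finv w x) = x" using bspec[OF eq] w(1) by (simp add: f_finv)
  then show "finv u x = finv w x" using u by (simp add: finv_eq_iff)
qed

lemma agree_outside:
  assumes u: "u \<in> PL_line" and w: "w \<in> PL_line" "supported_on w J"
    and eq: "\<forall>x\<in>J. u x = w x" and "x \<notin> J"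
  shows "u x \<notin> J"
proof
  assume J: "u x \<in> J"
  then have "finv w (u x) \<in> J"
    using support_invariant[OF PL_line_finv[OF w(1)] finv_supported_on[OF w]] by simp
  moreover have "finv w (u x) = finv u (u x)"
    using finv_agree[OF u w eq] J by simp
  ultimately show False using u \<open>x \<notin> J\<close> by (simp add: finv_f)
qed

lemma conj_supported:
  assumes u: "u \<in> PL_line" and w: "w \<in> PL_line" "supported_on w J"
    and eq: "\<forall>x\<in>J. u x = w x"
    and y: "y \<in> PL_line" "supported_on y J"
  shows "u \<circ> y \<circ> finv u = w \<circ> y \<circ> finv w" "finv u \<circ> y \<circ> u = finv w \<circ> y \<circ> w"
proof -
  have *: "u \<circ> y \<circ> finv u = w \<circ> y \<circ> finv w"
    if u: "u \<in> PL_line" and w: "w \<in> PL_line" "supported_on w J" and eq: "\<forall>x\<in>J. u x = w x" for u w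
  proof
    fix x
    show "(u \<circ> y \<circ> finv u) x = (w \<circ> y \<circ> finv w) x"
    proof (cases "x \<in> J")
      case True
      then have 1: "finv u x = finv w x" using finv_agree[OF u w eq] by simp
      have "y (finv w x) \<in> J"
        using True support_invariant[OF y] support_invariant[OF PL_line_finv[OF w(1)] finv_supported_on[OF w]]
        by simp
      then show ?thesis using 1 eq by simp
    next
      case False
      have "finv u x \<notin> J"
        using agree_outside[OF PL_line_finv[OF u] PL_line_finv[OF w(1)] finv_supported_on[OF w]
            finv_agree[OF u w eq] False] .
      then show ?thesis
        using False u supported_onD[OF y(2)] supported_onD[OF w(2)]
          supported_onD[OF finv_supported_on[OF w]] by (simp add: f_finv)
    qed
  qed
  show "u \<circ> y \<circ> finv u = w \<circ> y \<circ> finv w" by (rule *[OF u w eq])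
  show "finv u \<circ> y \<circ> u = finv w \<circ> y \<circ> w"
    using *[OF PL_line_finv[OF u] PL_line_finv[OF w(1)] finv_supported_on[OF w] finv_agree[OF u w eq]]
    by (simp only: finv_finv u w)
qed

text \<open>Outside \<open>J\<close> the maps \<open>a\<close> and \<open>b\<close> move disjoint invariant sets of points and hence commute there.
  So their commutator is determined by what they do on \<open>J\<close>.\<close>

lemma commutator_supported:
  assumes a: "a \<in> PL_line" and b: "b \<in> PL_line"
    and a': "a' \<in> PL_line" "supported_on a' J" and b': "b' \<in> PL_line" "supported_on b' J"
    and aeq: "\<forall>x\<in>J. a x = a' x" and beq: "\<forall>x\<in>J. b x = b' x"
    and disj: "\<And>x. x \<notin> J \<Longrightarrow> a x = x \<or> b x = x"
  shows "a \<circ> b \<circ> finv a \<circ> finv b = a' \<circ> b' \<circ> finv a' \<circ> finv b'"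
proof
  note outa = agree_outside[OF a a' aeq] and outb = agree_outside[OF b b' beq]
  fix y
  define x where "x = finv a (finv b y)"
  have y: "y = b (a x)" using a b by (simp add: x_def f_finv)
  have l: "(a \<circ> b \<circ> finv a \<circ> finv b) y = a (b x)"
    using a b by (simp add: y finv_f)
  show "(a \<circ> b \<circ> finv a \<circ> finv b) y = (a' \<circ> b' \<circ> finv a' \<circ> finv b') y"
  proof (cases "x \<in> J")
    case True
    then have "a' x \<in> J" "b' x \<in> J" using support_invariant[OF a'] support_invariant[OF b'] by auto
    then have "y = b' (a' x)" "a (b x) = a' (b' x)" using True y aeq beq by auto
    then show ?thesis unfolding l using a'(1) b'(1) by (simp add: finv_f)
  next
    case False
    have comm: "a (b x) = b (a x)"
    proof (cases "a x = x")
      case True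
      show ?thesis
      proof (cases "b x = x")
        case bx: False
        then have "b (b x) \<noteq> b x" using PL_line_inj[OF b] by (simp add: inj_eq)
        then show ?thesis using disj[OF outb[OF False]] True by simp
      qed (use True in simp)
    next
      case ax: False
      then have "b x = x" using disj[OF False] by simp
      moreover have "a (a x) \<noteq> a x" using ax PL_line_inj[OF a] by (simp add: inj_eq)
      ultimately show ?thesis using disj[OF outa[OF False]] by simp
    qed
    have "y \<notin> J" unfolding y by (intro outb outa False)
    then have "b' y = y" "a' y = y" "finv b' y = y" "finv a' y = y"
      using supported_onD[OF a'(2)] supported_onD[OF b'(2)] a' b' by (simp_all add: finv_eq_iff)
    moreover have "a (b x) = y" using comm y by simp
    ultimately show ?thesis unfolding l by simp
  qed
qed

section \<open>A partner for an element that contracts at the left end point\<close>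

lemma TF_low:
  assumes "f \<in> TF" "slope0 f = - int k"
  obtains t :: nat where "t \<ge> 1" "\<And>x. 0 \<le> x \<Longrightarrow> x \<le> (1/2) ^ t \<Longrightarrow> f x = (1/2) ^ k * x"
proof -
  have "germ 1 f 0 (- int k)"
    using germ_slope0[OF TF_PL_line[OF assms(1)]] assms(2) by simp
  then obtain d where d: "d > 0" "\<forall>y\<in>{0..0 + d}. f y = f 0 + 2 powi (- int k) * (y - 0)"
    unfolding germ_right_interval by blast
  obtain n where n: "(1/2::real) ^ n < d"
    using real_arch_pow_inv[OF d(1), of "1/2"] by auto
  show ?thesis
  proof (rule that[of "Suc n"])
    fix x :: real assume x: "0 \<le> x" "x \<le> (1/2) ^ Suc n"
    have "(1/2::real) ^ Suc n \<le> (1/2) ^ n" by simp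
    then have "x \<in> {0..0 + d}" using x n by auto
    from bspec[OF d(2) this] show "f x = (1/2) ^ k * x"
      using assms(1) by (simp add: power_int_minus power_one_over inverse_eq_divide)
  qed simp
qed

text \<open>The positions \<open>4\<close> and \<open>7\<close> of the two copies in \<open>g\<close> matter. They contribute to the
  commutator \<open>a\<close> of \<open>f\<close> and \<open>g\<close> on the positions \<open>4, 5, 7, 8\<close>, and to its conjugate \<open>b\<close>, shifted by two,
  on \<open>6, 7, 9, 10\<close>; the only common position is \<open>7\<close>. Starting as low as \<open>4\<close> keeps the copies below the large parts of the supports of \<open>a\<close> and \<open>b\<close>.\<close>

theorem exists_partner:
  assumes f: "f \<in> TF" and k: "k \<ge> 1" "slope0 f = - int k" and d: "d \<ge> 1"
  shows "\<exists>g\<in>TF. slope0 g = 0 \<and> slope1 g = int d \<and>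
     (\<forall>H. subgrp H \<longrightarrow> f \<in> H \<longrightarrow> g \<in> H \<longrightarrow> TF_cpt \<subseteq> H)"
proof -
  note fPL = TF_PL_line[OF f]
  define q :: real where "q = (1/2) ^ k"
  have q: "0 < q" "q \<le> 1/2"
    using k(1) power_decreasing[of 1 k "1/2::real"] by (simp_all add: q_def)
  obtain t where t: "t \<ge> 1" and f_low0: "\<And>x. 0 \<le> x \<Longrightarrow> x \<le> (1/2) ^ t \<Longrightarrow> f x = q * x"
    using TF_low[OF f k(2)] unfolding q_def by metis
  define T :: real where "T = (1/2) ^ t"
  have T: "0 < T" "T \<le> 1/2"
    using t power_decreasing[of 1 t "1/2::real"] by (simp_all add: T_def)
  have f_low: "f x = q * x" if "0 \<le> x" "x \<le> T" for x
    using f_low0 that by (simp add: T_def)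
  have q_pow: "q ^ i > 0" "q ^ Suc i \<le> q ^ i / 2" for i
    using q by (simp_all add: field_simps)
  have q_mono: "q ^ j \<le> q ^ i" if "i \<le> j" for i j
    using that q by (intro power_decreasing) auto
  have Tq_mono: "T * q ^ j \<le> T * q ^ i" if "i \<le> j" for i j
    using q_mono[OF that] T by simp
  have Tq_half: "T * q ^ j \<le> T * q ^ i / 2" if "i < j" for i j
  proof -
    have "q ^ j \<le> q ^ i / 2" using q_mono[of "Suc i" j] q_pow(2)[of i] that by linarith
    then show ?thesis using T(1) by (simp add: mult_left_mono flip: times_divide_eq_right)
  qed
  define E where "E i = {T * q ^ i / 2 <..< T * q ^ i}" for i :: nat
  have E_scale: "q * y \<in> E (Suc i) \<longleftrightarrow> y \<in> E i" for y i
    using q(1) by (auto simp: E_def field_simps)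
  have E_unscale: "y / q \<in> E i \<longleftrightarrow> y \<in> E (Suc i)" for y i
    using E_scale[of "y / q" i] q(1) by simp
  have E_disj: "i = j" if "y \<in> E i" "y \<in> E j" for y i j
    using that Tq_half[of i j] Tq_half[of j i] by (cases i j rule: linorder_cases) (auto simp: E_def)
  have E_bounds: "0 < y" "y < T * q ^ m" if "y \<in> E i" "m \<le> i" for y i m
  proof -
    have y: "T * q ^ i / 2 < y" "y < T * q ^ i" using that(1) by (simp_all add: E_def)
    show "0 < y" using y(1) mult_pos_pos[OF T(1) q_pow(1)[of i]] by linarith
    show "y < T * q ^ m" using y(2) Tq_mono[OF that(2)] by linarith
  qed
  \<comment> \<open>An interior point of \<open>E 0\<close>: the contraction only needs to reach points below \<open>T\<close>.\<close>
  define a0 where "a0 = 3/4 * T"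
  have a0: "a0 \<in> dyadic" "0 < a0" "a0 \<le> 1/2" "T * q < a0" "T / 2 < a0" "a0 < T"
  proof -
    have "3 / 4 = 1 - 1 / 2 * (1 / 2 :: real)" by simp
    then show "a0 \<in> dyadic"
      unfolding a0_def T_def using dyadic_mult dyadic_diff dyadic_1 dyadic_half dyadic_power by metis
    show "T * q < a0" using mult_left_mono[OF q(2), of T] T by (simp add: a0_def)
  qed (use T in \<open>simp_all add: a0_def\<close>)
  obtain v where v: "v \<in> TF" "slope1 v = int d" "\<And>x. x \<le> a0 \<Longrightarrow> v x = x"
    "\<And>x. a0 < x \<Longrightarrow> x < 1 \<Longrightarrow> v x < x"
    using exists_contraction[OF a0(1-3) d] by blast
  note vPL = TF_PL_line[OF v(1)]
  define j where "j i = t + k * i" for i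
  have pow_j: "(1/2) ^ j i = T * q ^ i" "(1/2) ^ (j i + 1) = T * q ^ i / 2" for i
    by (simp_all add: j_def T_def q_def power_add power_mult)
  define A where "A i = transplant (j i) (xgen 0)" for i
  define B where "B i = transplant (j i) (xgen 1)" for i
  have transplant_supp: "supported_on (transplant (j i) u) (E i)" if "u \<in> TF" for u i
    unfolding supported_on_def
  proof (intro allI impI)
    fix x assume "x \<notin> E i"
    then show "transplant (j i) u x = x"
      using transplant_outside[OF that, of x "j i"] unfolding pow_j by (auto simp: E_def not_less)
  qed
  have A: "A i \<in> TF" "supported_on (A i) (E i)" and B: "B i \<in> TF" "supported_on (B i) (E i)" for i
    unfolding A_def B_def by (intro transplant_TF transplant_supp xgen_TF)+
  have A_scale: "A (Suc i) (q * x) = q * A i x" for i x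
    using transplant_scale[of "j i" k "xgen 0" x] by (simp add: A_def j_def q_def add_ac)
  note A_E = support_invariant[OF TF_PL_line[OF A(1)] A(2)] and B_E = support_invariant[OF TF_PL_line[OF B(1)] B(2)]
  define g where "g = A 4 \<circ> B 7 \<circ> v"
  have g_TF: "g \<in> TF" unfolding g_def by (intro TF_comp A B v)
  note gPL = TF_PL_line[OF g_TF]
  have Tq4: "T * q ^ 4 \<le> T * q" using Tq_mono[of 1 4] by simp
  have E_a0: "x \<le> a0" if "x \<in> E i" "i \<ge> 1" for x i
    using E_bounds(2)[OF that] a0(4) by simp
  have g_E4: "g x = A 4 x" if "x \<in> E 4" for x
  proof -
    have "x \<notin> E 7" using E_disj[OF that, of 7] by auto
    then show ?thesis using v(3)[OF E_a0[OF that]] supported_onD[OF B(2)] by (simp add: g_def)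
  qed
  have g_E7: "g x = B 7 x" if "x \<in> E 7" for x
  proof -
    have "B 7 x \<in> E 7" using B_E that by simp
    then have "B 7 x \<notin> E 4" using E_disj[of _ 4 7] by auto
    then show ?thesis using v(3)[OF E_a0[OF that]] supported_onD[OF A(2)] by (simp add: g_def)
  qed
  have g_low: "g x = x" if "x \<le> a0" "x \<notin> E 4" "x \<notin> E 7" for x
    using v(3)[OF that(1)] supported_onD[OF A(2) that(2)] supported_onD[OF B(2) that(3)]
    by (simp add: g_def)
  have g_high: "g x = v x" if "a0 \<le> x" for x
  proof -
    have "a0 \<le> v x" using PL_line_le_iff[OF vPL, of a0 x] v(3)[of a0] that by simp
    then have "v x \<notin> E 4" "v x \<notin> E 7"
      using E_bounds(2)[of "v x" 4 1] E_bounds(2)[of "v x" 7 1] a0(4) by auto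
    then show ?thesis using supported_onD[OF A(2)] supported_onD[OF B(2)] by (simp add: g_def)
  qed
  have A_cpt: "A 4 \<in> TF_cpt" "B 7 \<in> TF_cpt"
    unfolding A_def B_def by (intro transplant_TF_cpt xgen_TF, use t in \<open>simp add: j_def\<close>)+
  have "germ 1 v 0 0"
    by (rule germ_rightI[OF a0(2)]) (use v(1,3) in simp)
  then have slope_g: "slope0 g = 0" "slope1 g = int d"
    using A_cpt v(1,2) slope0_eq unfolding g_def
    by (simp_all add: TF_cpt_def slope0_comp slope1_comp TF_comp)
  have g_contr: "g x < x" if "a0 < x" "x < 1" for x
    using g_high[of x] v(4)[OF that] that by simp
  \<comment> \<open>Equations such as \<open>a_eq\<close> and \<open>b_eq\<close> below compute these maps without mentioning inverses.\<close>
  define a where "a = f \<circ> g \<circ> finv f \<circ> finv g"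
  have a_TF: "a \<in> TF" unfolding a_def by (intro TF_comp TF_finv f g_TF)
  note aPL = TF_PL_line[OF a_TF]
  have a_eq: "a (g (f w)) = f (g w)" for w
    using finv_f[OF fPL] finv_f[OF gPL] by (simp add: a_def)
  \<comment> \<open>Near \<open>1\<close> the map \<open>g\<close> is \<open>v\<close>, and the slopes of \<open>f\<close> and \<open>v\<close> at \<open>1\<close> cancel in the commutator.\<close>
  obtain \<beta> where \<beta>: "T \<le> \<beta>" "\<beta> < 1" and a_high: "\<And>x. \<beta> \<le> x \<Longrightarrow> a x = x"
  proof -
    define av where "av = f \<circ> v \<circ> finv f \<circ> finv v"
    have av_TF: "av \<in> TF" unfolding av_def by (intro TF_comp TF_finv f v)
    have "slope1 av = 0"
      unfolding av_def using f v(1) by (simp add: slope1_comp TF_comp TF_finv slope1_finv)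
    then have "germ (-1) av 1 0" using germ_slope1[OF TF_PL_line[OF av_TF]] by simp
    then obtain b where b: "b > 0" "\<forall>y\<in>{1 - b..1}. av y = av 1 - 2 powi 0 * (1 - y)"
      unfolding germ_left_interval by blast
    define c where "c = max a0 (finv f a0)"
    have "a0 < 1" using a0 T by simp
    then have "c < 1" using TF_bounds(2)[OF TF_finv[OF f]] by (simp add: c_def)
    then have c: "v (f c) < 1" using TF_bounds(2)[OF f] TF_bounds(2)[OF v(1)] by simp
    show ?thesis
    proof (rule that[of "max T (max (1 - b) (v (f c)))"])
      fix x assume x: "max T (max (1 - b) (v (f c))) \<le> x"
      define w where "w = finv f (finv v x)"
      have xw: "x = v (f w)" using f_finv[OF fPL] f_finv[OF vPL] by (simp add: w_def)
      have "v (f c) \<le> v (f w)" using x xw by simp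
      then have "c \<le> w" using PL_line_le_iff[OF vPL] PL_line_le_iff[OF fPL] by simp
      then have w: "a0 \<le> w" "finv f a0 \<le> w" by (simp_all add: c_def)
      then have "a0 \<le> f w" using PL_line_le_iff[OF fPL, of "finv f a0" w] f_finv[OF fPL] by simp
      then have "a x = f (v w)" using a_eq[of w] g_high[OF w(1)] g_high[of "f w"] xw by simp
      also have "f (v w) = av x" unfolding av_def xw using finv_f[OF fPL] finv_f[OF vPL] by simp
      finally have "a x = av x" .
      show "a x = x"
      proof (cases "x \<le> 1")
        case True
        then have "x \<in> {1 - b..1}" using x by simp
        from bspec[OF b(2) this] have "av x = x" using av_TF by simp
        with \<open>a x = av x\<close> show ?thesis by simp
      next
        case False
        then show ?thesis using TF_outside[OF a_TF] by simp
      qed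
    qed (use T b c in auto)
  qed
  obtain n where n: "(g ^^ n) \<beta> < T"
    using funpow_below[OF gPL, of T \<beta>] g_contr \<beta> a0(6) by force
  have gn_fix: "(g ^^ n) x = x" if "g x = x" for x n
    by (induction n) (use that in simp_all)
  \<comment> \<open>The power of \<open>g\<close> brings the large part of the support of \<open>a\<close> below \<open>T\<close>, and \<open>f \<circ> f\<close> brings it below \<open>T * q\<^sup>2\<close>,
      while \<open>a\<close> itself moves nothing between \<open>E 4\<close> and \<open>T * q\<^sup>2\<close>.\<close>
  define h where "h = f \<circ> f \<circ> (g ^^ n)"
  have h_TF: "h \<in> TF" unfolding h_def by (intro TF_comp TF_funpow f g_TF)
  note hPL = TF_PL_line[OF h_TF]
  define b where "b = h \<circ> a \<circ> finv h"
  have b_TF: "b \<in> TF" unfolding b_def by (intro TF_comp TF_finv a_TF h_TF)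
  note bPL = TF_PL_line[OF b_TF]
  have b_eq: "b (h z) = h (a z)" for z
    using finv_f[OF hPL] by (simp add: b_def)
  have ff_low: "f (f x) = q * (q * x)" if "0 \<le> x" "x \<le> T" for x
  proof -
    have "q * x \<le> 1 * T" using that q by (intro mult_mono) auto
    then show ?thesis using that f_low[of x] f_low[of "q * x"] q by simp
  qed
  have Tq2: "T * q ^ 2 \<le> T" "T * q ^ 2 \<le> T * q" using Tq_mono[of 0 2] Tq_mono[of 1 2] by simp_all
  have a_low: "a x = x" if x: "0 < x" "x < T * q ^ 2" "x \<notin> E 4" "x \<notin> E 5" "x \<notin> E 7" "x \<notin> E 8" for x
  proof -
    define w where "w = x / q"
    have w: "q * w = x" "0 \<le> w" using q x by (simp_all add: w_def)
    have "w < T * q" using x(2) q(1) by (simp add: w_def field_simps power2_eq_square)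
    then have "w \<le> a0" "w \<le> T" using a0(4,6) by simp_all
    have "w \<notin> E 4" "w \<notin> E 7" using x E_unscale[of x 4] E_unscale[of x 7] by (simp_all add: w_def)
    then have "g w = w" using g_low \<open>w \<le> a0\<close> by simp
    moreover have "f w = x" using f_low[OF w(2) \<open>w \<le> T\<close>] w by simp
    moreover have "g x = x" using g_low[of x] x Tq2 a0(4) by simp
    ultimately show ?thesis using a_eq[of w] by simp
  qed
  have disj: "a x = x \<or> b x = x" if "x \<notin> E 7" for x
  proof -
    consider "x \<le> 0" | "0 < x" "x < T * q ^ 2" "x \<notin> E 4" "x \<notin> E 5" "x \<notin> E 8"
      | "x \<in> E 4 \<or> x \<in> E 5 \<or> x \<in> E 8" | "T * q ^ 2 \<le> x" "x < \<beta>" | "\<beta> \<le> x"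
      by linarith
    then show ?thesis
    proof cases
      case 1
      then show ?thesis using TF_outside[OF a_TF] by simp
    next
      case 2
      then show ?thesis using a_low[of x] that by simp
    next
      case 3
      define z where "z = x / q / q"
      have E: "z \<in> E 2 \<or> z \<in> E 3 \<or> z \<in> E 6"
        using 3 E_unscale[of x 3] E_unscale[of x 4] E_unscale[of x 7]
          E_unscale[of "x / q" 2] E_unscale[of "x / q" 3] E_unscale[of "x / q" 6]
        by (auto simp: z_def)
      then have z: "0 < z" "z < T * q ^ 2" using E_bounds[of z _ 2] by auto
      have nE: "z \<notin> E 4" "z \<notin> E 5" "z \<notin> E 7" "z \<notin> E 8"
        using E E_disj[of z] by fastforce+
      have "g z = z" using g_low[of z] z nE Tq2 a0(4) by simp
      then have "h z = f (f z)" using gn_fix by (simp add: h_def)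
      also have "\<dots> = x" using ff_low[of z] z Tq2 q by (simp add: z_def)
      finally have "h z = x" .
      moreover have "a z = z" by (rule a_low[OF z nE])
      ultimately show ?thesis using b_eq[of z] by simp
    next
      case 4
      define z where "z = finv h x"
      have hz: "h z = x" using f_finv[OF hPL] by (simp add: z_def)
      have "\<beta> \<le> z"
      proof (rule ccontr)
        assume "\<not> \<beta> \<le> z"
        then have "(g ^^ n) z < (g ^^ n) \<beta>"
          using PL_line_less_iff[OF PL_line_funpow[OF gPL]] by simp
        then have "(g ^^ n) z < T" using n by simp
        then have "h z < f (f T)" using PL_line_less_iff[OF fPL] by (simp add: h_def)
        also have "\<dots> = T * q ^ 2" using ff_low[of T] T by (simp add: power2_eq_square)
        finally show False using 4 hz by simp
      qed
      then show ?thesis using a_high b_eq[of z] hz by simp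
    next
      case 5
      then show ?thesis using a_high by simp
    qed
  qed
  have a_E7: "\<forall>x\<in>E 7. a x = finv (B 7) x"
  proof
    fix x assume x: "x \<in> E 7"
    define y where "y = finv (B 7) x"
    have y: "B 7 y = x" using f_finv[OF TF_PL_line[OF B(1)]] by (simp add: y_def)
    then have yE: "y \<in> E 7" using B_E[of 7 y] x by simp
    define w where "w = y / q"
    have wE: "w \<in> E 6" using yE E_unscale[of y 6] by (simp add: w_def)
    have "g w = w" using g_low[of w] E_a0[OF wE] E_disj[OF wE, of 4] E_disj[OF wE, of 7] by auto
    moreover have "f w = y" using f_low[of w] E_bounds[OF wE, of 0] q by (simp add: w_def)
    ultimately have "a x = y" using a_eq[of w] g_E7[OF yE] y by simp
    then show "a x = finv (B 7) x" by (simp add: y_def)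
  qed
  have b_E7: "\<forall>x\<in>E 7. b x = A 7 x"
  proof
    fix x assume x: "x \<in> E 7"
    define z where "z = x / q / q"
    have zE: "z \<in> E 5" using x E_unscale[of x 6] E_unscale[of "x / q" 5] by (simp add: z_def)
    have g5: "g y = y" if "y \<in> E 5" for y
      using g_low[of y] E_a0[OF that] E_disj[OF that, of 4] E_disj[OF that, of 7] by auto
    have h5: "h y = q * (q * y)" if "y \<in> E 5" for y
      using gn_fix[OF g5[OF that]] ff_low[of y] E_bounds[OF that, of 0] by (simp add: h_def)
    define w where "w = z / q"
    have wE: "w \<in> E 4" using zE E_unscale[of z 4] by (simp add: w_def)
    have wz: "q * w = z" using q by (simp add: w_def)
    have "f w = z" using f_low[of w] E_bounds[OF wE, of 0] wz by simp
    then have "a z = f (A 4 w)" using a_eq[of w] g5[OF zE] g_E4[OF wE] by simp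
    also have "\<dots> = q * A 4 w"
      using f_low[of "A 4 w"] E_bounds[of "A 4 w" 4 0] A_E[of 4 w] wE by simp
    also have "\<dots> = A 5 z" using A_scale[of 4 w] wz by simp
    finally have az: "a z = A 5 z" .
    have "A 5 z \<in> E 5" using A_E[of 5 z] zE by simp
    then have "b (h z) = q * (q * A 5 z)" using b_eq[of z] az h5 by simp
    also have "\<dots> = A 7 (q * (q * z))" using A_scale[of 5 z] A_scale[of 6 "q * z"] by simp
    finally show "b x = A 7 x" using h5[OF zE] q by (simp add: z_def)
  qed
  have comm: "a \<circ> b \<circ> finv a \<circ> finv b = transplant (j 7) (finv (xgen 1) \<circ> xgen 0 \<circ> xgen 1 \<circ> finv (xgen 0))"
  proof -
    have "a \<circ> b \<circ> finv a \<circ> finv b = finv (B 7) \<circ> A 7 \<circ> finv (finv (B 7)) \<circ> finv (A 7)"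
      by (rule commutator_supported[OF aPL bPL PL_line_finv[OF TF_PL_line[OF B(1)]]
            finv_supported_on[OF TF_PL_line[OF B(1)] B(2)] TF_PL_line[OF A(1)] A(2) a_E7 b_E7 disj])
    then show ?thesis
      by (simp only: finv_finv[OF TF_PL_line[OF B(1)]] transplant_comp transplant_finv[OF xgen_PL_line]
          flip: A_def B_def)
  qed
  have "TF_cpt \<subseteq> H" if H: "subgrp H" "f \<in> H" "g \<in> H" for H
  proof -
    define S where "S = {u \<in> TF. transplant (j 7) u \<in> H}"
    have aH: "a \<in> H" and hH: "h \<in> H"
      unfolding a_def h_def using H by (auto intro!: subgrpD subgrp_funpow)
    then have bH: "b \<in> H" unfolding b_def using H by (auto intro!: subgrpD)
    have S: "subgrp S"
      using H unfolding subgrp_def S_def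
      by (simp add: transplant_id transplant_comp transplant_finv TF_PL_line TF_id TF_comp TF_finv)
    have commS: "finv (xgen 1) \<circ> xgen 0 \<circ> xgen 1 \<circ> finv (xgen 0) \<in> S"
    proof -
      have "a \<circ> b \<circ> finv a \<circ> finv b \<in> H"
        using aH bH H by (auto intro!: subgrpD)
      then show ?thesis
        unfolding comm S_def using xgen_TF by (simp add: TF_comp TF_finv)
    qed
    \<comment> \<open>On \<open>E 7\<close> this conjugate of \<open>g\<close> acts as the copy of \<open>x\<^sub>0\<close> that \<open>g\<close> has on \<open>E 4\<close>.\<close>
    define g' where "g' = (f ^^ 3) \<circ> g \<circ> finv (f ^^ 3)"
    have f3: "f ^^ 3 \<in> TF" by (rule TF_funpow[OF f])
    have g'_TF: "g' \<in> TF" and g'_H: "g' \<in> H"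
      unfolding g'_def using f3 g_TF H by (auto intro!: subgrpD subgrp_funpow TF_comp TF_finv)
    have f3_low: "(f ^^ 3) x = q * (q * (q * x))" if "x \<in> E 4" for x
    proof -
      have x: "0 < x" "x < T" using E_bounds[OF that, of 0] by simp_all
      have "q * (q * x) \<le> 1 * (1 * T)" using x q by (intro mult_mono) auto
      then show ?thesis
        using f_low[of "q * (q * x)"] ff_low[of x] x q by (simp add: numeral_3_eq_3)
    qed
    have g'_E7: "\<forall>x\<in>E 7. g' x = A 7 x"
    proof
      fix x assume x: "x \<in> E 7"
      define z where "z = x / q / q / q"
      have zE: "z \<in> E 4"
        using x E_unscale[of x 6] E_unscale[of "x / q" 5] E_unscale[of "x / q / q" 4] by (simp add: z_def)
      have "(f ^^ 3) z = x" using f3_low[OF zE] q by (simp add: z_def)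
      then have "g' x = (f ^^ 3) (g z)"
        using finv_f[OF TF_PL_line[OF f3]] by (auto simp: g'_def)
      also have "\<dots> = q * (q * (q * A 4 z))"
        using g_E4[OF zE] f3_low[of "A 4 z"] A_E[of 4 z] zE by simp
      also have "\<dots> = A 7 (q * (q * (q * z)))"
        using A_scale[of 4 z] A_scale[of 5 "q * z"] A_scale[of 6 "q * (q * z)"] by simp
      finally show "g' x = A 7 x" using q by (simp add: z_def)
    qed
    have gB: "\<forall>x\<in>E 7. g x = B 7 x" using g_E7 by blast
    have conj_transplant: "w \<circ> u \<circ> finv w \<in> S \<and> finv w \<circ> u \<circ> w \<in> S"
      if w: "w \<in> TF" and g1: "g1 \<in> TF" "g1 \<in> H" "\<forall>x\<in>E 7. g1 x = transplant (j 7) w x" and u: "u \<in> S" for w g1 u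
    proof -
      have uTF: "u \<in> TF" and uH: "transplant (j 7) u \<in> H" using u by (simp_all add: S_def)
      note c = conj_supported[OF TF_PL_line[OF g1(1)] TF_PL_line[OF transplant_TF[OF w]] transplant_supp[OF w] g1(3)
          TF_PL_line[OF transplant_TF[OF uTF]] transplant_supp[OF uTF]]
      have "transplant (j 7) (w \<circ> u \<circ> finv w) = g1 \<circ> transplant (j 7) u \<circ> finv g1"
        "transplant (j 7) (finv w \<circ> u \<circ> w) = finv g1 \<circ> transplant (j 7) u \<circ> g1"
        unfolding c by (simp_all only: transplant_comp transplant_finv[OF TF_PL_line[OF w]])
      moreover have "g1 \<circ> transplant (j 7) u \<circ> finv g1 \<in> H" "finv g1 \<circ> transplant (j 7) u \<circ> g1 \<in> H"
        using g1(2) uH H(1) by (auto intro!: subgrpD)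
      ultimately show ?thesis
        unfolding S_def using w uTF by (simp add: TF_comp TF_finv)
    qed
    have "TF_cpt \<subseteq> S"
    proof (rule TF_cpt_subset_normal_closure[OF S commS])
      fix i :: nat and y assume "i \<in> {0, 1}" "y \<in> S"
      then have "xgen i \<circ> y \<circ> finv (xgen i) \<in> S \<and> finv (xgen i) \<circ> y \<circ> xgen i \<in> S"
        using conj_transplant[OF xgen_TF g'_TF g'_H, of 0 y] g'_E7 conj_transplant[OF xgen_TF g_TF H(3), of 1 y] gB
        by (auto simp: A_def B_def simp del: One_nat_def)
      then show "xgen i \<circ> y \<circ> finv (xgen i) \<in> S" "finv (xgen i) \<circ> y \<circ> xgen i \<in> S" by simp_all
    qed
    then have trH: "transplant (j 7) u \<in> H" if "u \<in> TF_cpt" for u using that by (auto simp: S_def)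
    show "TF_cpt \<subseteq> H"
    proof
      fix y assume y: "y \<in> TF_cpt"
      then have yTF: "y \<in> TF" by (simp add: TF_cpt_def)
      obtain \<alpha> \<gamma> where \<alpha>\<gamma>: "0 < \<alpha>" "\<alpha> < \<gamma>" "\<gamma> < 1" "\<And>x. x \<le> \<alpha> \<or> x \<ge> \<gamma> \<Longrightarrow> y x = x"
        using TF_cpt_support[OF y] by blast
      have fpow_low: "(f ^^ m) x = q ^ m * x" if "0 \<le> x" "x \<le> T" for m x
      proof (induction m)
        case (Suc m)
        have "q ^ m * x \<le> 1 * T" using that q by (intro mult_mono) (auto simp: power_le_one)
        then show ?case using Suc f_low[of "q ^ m * x"] that q by simp
      qed simp
      obtain m where m: "q ^ m < \<alpha>" using real_arch_pow_inv[OF \<alpha>\<gamma>(1), of q] q by auto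
      define p where "p = finv (f ^^ m)"
      have pTF: "p \<in> TF" unfolding p_def by (intro TF_finv TF_funpow f)
      have "(f ^^ m) (T / 2) < \<alpha>"
      proof -
        have "q ^ m * (T / 2) \<le> q ^ m * 1" using T q by (intro mult_left_mono) auto
        then show ?thesis using fpow_low[of "T / 2" m] T m by simp
      qed
      then have p\<alpha>: "T / 2 < p \<alpha>"
        using PL_line_less_iff[OF TF_PL_line[OF pTF], of "(f ^^ m) (T / 2)" \<alpha>]
          finv_f[OF PL_line_funpow[OF fPL], of m "T / 2"] by (simp add: p_def)
      have p\<gamma>: "p \<gamma> < 1" using TF_bounds(2)[OF pTF] \<alpha>\<gamma>(3) by simp
      obtain m' where m': "(g ^^ m') (p \<gamma>) < T"
        using funpow_below[OF gPL, of T "p \<gamma>"] g_contr p\<gamma> a0(6) by force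
      have "g (T / 2) = T / 2"
      proof (rule g_low)
        have "\<not> T / 2 < T * q ^ 4" using Tq_half[of 0 4] by simp
        then show "T / 2 \<notin> E 4" "T / 2 \<notin> E 7"
          using E_bounds(2)[of "T / 2" 4 4] E_bounds(2)[of "T / 2" 7 4] by auto
      qed (use a0 in simp)
      then have m'\<alpha>: "T / 2 < (g ^^ m') (p \<alpha>)"
        using gn_fix PL_line_less_iff[OF PL_line_funpow[OF gPL], of m' "T / 2" "p \<alpha>"] p\<alpha> by simp
      \<comment> \<open>Inverse powers of \<open>f\<close> lift the support of \<open>y\<close> above \<open>T / 2\<close>, powers of \<open>g\<close> bring it below \<open>T\<close>, that
          is, into \<open>E 0\<close>, and \<open>f\<close> moves \<open>E 0\<close> to \<open>E 7\<close>.\<close>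
      define W where "W = (f ^^ 7) \<circ> (g ^^ m') \<circ> p"
      have WTF: "W \<in> TF" and WH: "W \<in> H"
        unfolding W_def p_def using H f g_TF by (auto intro!: subgrpD subgrp_funpow TF_comp TF_finv TF_funpow)
      note WPL = TF_PL_line[OF WTF]
      have W\<alpha>: "(1/2) ^ (j 7 + 1) < W \<alpha>"
        using PL_line_less_iff[OF PL_line_funpow[OF fPL], of 7 "T / 2"] m'\<alpha> fpow_low[of "T / 2" 7] T
        unfolding pow_j by (simp add: W_def mult.commute)
      have W\<gamma>: "W \<gamma> < (1/2) ^ j 7"
        using PL_line_less_iff[OF PL_line_funpow[OF fPL], of 7 _ T] m' fpow_low[of T 7] T
        unfolding pow_j by (simp add: W_def mult.commute)
      have "W \<circ> y \<circ> finv W \<in> PL_line"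
        using WTF yTF by (intro TF_PL_line TF_comp TF_finv)
      moreover have "(W \<circ> y \<circ> finv W) x = x" if "x \<le> W \<alpha> \<or> x \<ge> W \<gamma>" for x
      proof -
        have "finv W x \<le> \<alpha> \<or> finv W x \<ge> \<gamma>"
          using that PL_line_le_iff[OF WPL, of "finv W x" \<alpha>] PL_line_le_iff[OF WPL, of \<gamma> "finv W x"]
          by (simp add: f_finv[OF WPL])
        then show ?thesis using \<alpha>\<gamma>(4) f_finv[OF WPL] by simp
      qed
      ultimately obtain u where "u \<in> TF_cpt" "W \<circ> y \<circ> finv W = transplant (j 7) u"
        using transplant_surj[OF _ W\<alpha> W\<gamma>] by blast
      then have "W \<circ> y \<circ> finv W \<in> H" using trH by simp
      then have "finv W \<circ> (W \<circ> y \<circ> finv W) \<circ> W \<in> H"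
        by (rule subgrpD(2)[OF H(1) subgrpD(2)[OF H(1) subgrpD(3)[OF H(1) WH]] WH])
      moreover have "finv W \<circ> (W \<circ> y \<circ> finv W) \<circ> W = y"
        using finv_f[OF WPL] by (intro ext) simp
      ultimately show "y \<in> H" by simp
    qed
  qed
  then show ?thesis using g_TF slope_g by blast
qed

section \<open>The finite index subgroups given by divisibility of the slopes\<close>

definition TF_div :: "nat \<Rightarrow> nat \<Rightarrow> (real \<Rightarrow> real) set" where
  "TF_div p q = {f \<in> TF. int p dvd slope0 f \<and> int q dvd slope1 f}"

lemma subgrp_TF_div: "subgrp (TF_div p q)"
  by (auto simp: subgrp_def TF_div_def TF_id TF_comp TF_finv slope0_comp slope1_comp slope0_finv slope1_finv)

lemma flip_TF_div: "f \<in> TF_div p q \<Longrightarrow> flip f \<in> TF_div q p"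
  by (auto simp: TF_div_def flip_TF slope_flip)

text \<open>Given \<open>x\<close> with divisible slope exponents, a power of \<open>f\<close> corrects its slope at \<open>0\<close>. A power of \<open>g\<close>,
  which has slope \<open>1\<close> at \<open>0\<close>, then corrects the slope at \<open>1\<close>.\<close>

lemma TF_div_generated_neg:
  assumes f: "f \<in> TF" and s: "slope0 f < 0"
  shows "\<exists>g\<in>TF. \<exists>p q. p > 0 \<and> q > 0 \<and> f \<in> TF_div p q \<and> g \<in> TF_div p q \<and>
     (\<forall>H. subgrp H \<longrightarrow> f \<in> H \<longrightarrow> g \<in> H \<longrightarrow> TF_div p q \<subseteq> H)"
proof -
  define k where "k = nat (- slope0 f)"
  define d where "d = (if slope1 f = 0 then 1 else nat \<bar>slope1 f\<bar>)"
  have k: "k \<ge> 1" "slope0 f = - int k" using s by (simp_all add: k_def)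
  have d: "d \<ge> 1" "int d dvd slope1 f" by (auto simp: d_def)
  obtain g where g: "g \<in> TF" "slope0 g = 0" "slope1 g = int d"
    "\<And>H. subgrp H \<Longrightarrow> f \<in> H \<Longrightarrow> g \<in> H \<Longrightarrow> TF_cpt \<subseteq> H"
    using exists_partner[OF f k d(1)] by blast
  have "TF_div k d \<subseteq> H" if H: "subgrp H" "f \<in> H" "g \<in> H" for H
  proof
    fix x assume "x \<in> TF_div k d"
    then have x: "x \<in> TF" "int k dvd slope0 x" "int d dvd slope1 x" by (auto simp: TF_div_def)
    obtain i where i: "slope0 x = int k * i" using x(2) by (auto simp: dvd_def)
    obtain z where z: "z \<in> H" "z \<in> TF" "slope0 z = i * slope0 f" "slope1 z = i * slope1 f"
      by (rule subgrp_slope_multiple[OF H(1,2) f])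
    have "int d dvd slope1 z + slope1 x" using z(4) d(2) x(3) by simp
    then obtain j where j: "slope1 z + slope1 x = int d * j" by (auto simp: dvd_def)
    obtain w where w: "w \<in> H" "w \<in> TF" "slope0 w = (- j) * slope0 g" "slope1 w = (- j) * slope1 g"
      by (rule subgrp_slope_multiple[OF H(1,3) g(1)])
    have "w \<circ> (z \<circ> x) \<in> TF_cpt"
      using w z x(1) i j k g by (simp add: TF_cpt_def TF_comp slope0_comp slope1_comp mult.commute)
    then have "w \<circ> (z \<circ> x) \<in> H" using g(4)[OF H] by blast
    then have "finv z \<circ> (finv w \<circ> (w \<circ> (z \<circ> x))) \<in> H"
      using w z subgrpD(2,3)[OF H(1)] by blast
    moreover have "finv z \<circ> (finv w \<circ> (w \<circ> (z \<circ> x))) = x"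
      using finv_f[OF TF_PL_line[OF w(2)]] finv_f[OF TF_PL_line[OF z(2)]] by (intro ext) simp
    ultimately show "x \<in> H" by simp
  qed
  moreover have "f \<in> TF_div k d" "g \<in> TF_div k d" using f k d g by (auto simp: TF_div_def)
  ultimately show ?thesis using g(1) k(1) d(1) by (intro bexI[of _ g] exI[of _ k] exI[of _ d]) auto
qed

lemma TF_div_generated_slope0:
  assumes f: "f \<in> TF" and s: "slope0 f \<noteq> 0"
  shows "\<exists>g\<in>TF. \<exists>p q. p > 0 \<and> q > 0 \<and> f \<in> TF_div p q \<and> g \<in> TF_div p q \<and>
     (\<forall>H. subgrp H \<longrightarrow> f \<in> H \<longrightarrow> g \<in> H \<longrightarrow> TF_div p q \<subseteq> H)"
proof (cases "slope0 f < 0")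
  case False
  then have "slope0 (finv f) < 0" using s f by (simp add: slope0_finv)
  from TF_div_generated_neg[OF TF_finv[OF f] this] obtain g p q where *: "g \<in> TF" "p > 0" "q > 0"
    "finv f \<in> TF_div p q" "g \<in> TF_div p q"
    "\<And>H. subgrp H \<Longrightarrow> finv f \<in> H \<Longrightarrow> g \<in> H \<Longrightarrow> TF_div p q \<subseteq> H" by blast
  have "f \<in> TF_div p q"
    using subgrpD(3)[OF subgrp_TF_div *(4)] by (simp add: finv_finv TF_PL_line f)
  moreover have "TF_div p q \<subseteq> H" if "subgrp H" "f \<in> H" "g \<in> H" for H
    using *(6)[OF that(1) subgrpD(3)[OF that(1,2)] that(3)] .
  ultimately show ?thesis using * by blast
qed (rule TF_div_generated_neg[OF f])

theorem TF_div_generated: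
  assumes f: "f \<in> TF" and s: "slope0 f \<noteq> 0 \<or> slope1 f \<noteq> 0"
  shows "\<exists>g\<in>TF. \<exists>p q. p > 0 \<and> q > 0 \<and> f \<in> TF_div p q \<and> g \<in> TF_div p q \<and>
     (\<forall>H. subgrp H \<longrightarrow> f \<in> H \<longrightarrow> g \<in> H \<longrightarrow> TF_div p q \<subseteq> H)"
proof (cases "slope0 f = 0")
  case True
  then have "slope0 (flip f) \<noteq> 0" using s f by (simp add: slope_flip)
  from TF_div_generated_slope0[OF flip_TF[OF f] this] obtain g p q where *: "g \<in> TF" "p > 0" "q > 0"
    "flip f \<in> TF_div p q" "g \<in> TF_div p q"
    "\<And>H. subgrp H \<Longrightarrow> flip f \<in> H \<Longrightarrow> g \<in> H \<Longrightarrow> TF_div p q \<subseteq> H" by blast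
  have "TF_div q p \<subseteq> H" if H: "subgrp H" "f \<in> H" "flip g \<in> H" for H
  proof -
    define S where "S = {u \<in> TF. flip u \<in> H}"
    have "subgrp S"
      using H(1) unfolding subgrp_def S_def by (simp add: TF_id TF_comp TF_finv flip_comp flip_finv)
    moreover have "flip f \<in> S" "g \<in> S" using H f * by (simp_all add: S_def flip_TF)
    ultimately have "TF_div p q \<subseteq> S" by (rule *(6))
    then have "flip (flip x) \<in> H" if "x \<in> TF_div q p" for x
      using flip_TF_div[OF that] by (auto simp: S_def)
    then show ?thesis by auto
  qed
  moreover have "f \<in> TF_div q p" "flip g \<in> TF_div q p"
    using flip_TF_div[OF *(4)] flip_TF_div[OF *(5)] by simp_all
  ultimately show ?thesis using *(2,3) flip_TF[OF *(1)]
    by (intro bexI[of _ "flip g"] exI[of _ q] exI[of _ p]) auto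
qed (rule TF_div_generated_slope0[OF f])

section \<open>A map that turns halving into division by \<open>2\<^sup>p\<close>\<close>

text \<open>Any dyadic piecewise linear map of the unit interval onto \<open>[0, 2\<^sup>p - 1]\<close> would do. It is used to map
  \<open>[1, 2]\<close> onto \<open>[1, 2\<^sup>p]\<close>, and the scaling law below extends this to all positive numbers.\<close>

definition stretch :: "nat \<Rightarrow> real \<Rightarrow> real" where
  "stretch p = split_leaf 0 ^^ (2 ^ p - 2)"

lemma stretch_PL_line: "stretch p \<in> PL_line"
  unfolding stretch_def by (intro PL_line_funpow split_leaf_PL_line)

lemma stretch_0: "stretch p 0 = 0"
proof -
  have "(split_leaf 0 ^^ m) 0 = 0" for m by (induction m) (simp_all add: split_leaf_simps)
  then show ?thesis by (simp add: stretch_def)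
qed

lemma stretch_1:
  assumes "p \<ge> 1" shows "stretch p 1 = 2 ^ p - 1"
proof -
  have "(split_leaf 0 ^^ m) 1 = real m + 1" for m by (induction m) (simp_all add: split_leaf_simps)
  moreover have "(2::nat) \<le> 2 ^ p" using power_increasing[of 1 p "2::nat"] assms by simp
  ultimately show ?thesis by (simp add: stretch_def of_nat_diff)
qed

definition piece :: "nat \<Rightarrow> int \<Rightarrow> real \<Rightarrow> real" where
  "piece p n x = 2 powi (int p * n) * (1 + stretch p (x / 2 powi n - 1))"

lemma piece_PL_line: "piece p n \<in> PL_line"
proof -
  have "piece p n = (\<lambda>x. 2 powi (int p * n) * stretch p (2 powi (- n) * x + (-1)) + 2 powi (int p * n))"
    by (rule ext) (simp add: piece_def power_int_minus algebra_simps inverse_eq_divide)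
  then show ?thesis
    using PL_line_affine_comp[OF stretch_PL_line dyadic_minus_1 dyadic_powi] by metis
qed

lemma powi_add_one: "(2::real) powi (n + 1) = 2 * 2 powi n"
  by (simp add: power_int_add)

lemma piece_ends:
  assumes "p \<ge> 1"
  shows "piece p n (2 powi n) = 2 powi (int p * n)" "piece p n (2 powi (n + 1)) = 2 powi (int p * (n + 1))"
proof -
  show "piece p n (2 powi n) = 2 powi (int p * n)" by (simp add: piece_def stretch_0)
  have "(2::real) powi (int p * (n + 1)) = 2 powi (int p * n) * 2 ^ p"
    by (simp add: distrib_left power_int_add)
  then show "piece p n (2 powi (n + 1)) = 2 powi (int p * (n + 1))"
    using stretch_1[OF assms] by (simp add: piece_def powi_add_one)
qed

lemma floor_log2_iff:
  fixes x :: real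
  assumes "x > 0"
  shows "\<lfloor>log 2 x\<rfloor> = n \<longleftrightarrow> 2 powi n \<le> x \<and> x < 2 powi (n + 1)"
proof -
  have "2 powr real_of_int m = (2::real) powi m" for m
    by (simp add: powr_real_of_int')
  from this[of n] this[of "n + 1"] show ?thesis
    using floor_log_eq_powr_iff[of x 2 n] assms by simp
qed

definition halving :: "nat \<Rightarrow> real \<Rightarrow> real" where
  "halving p x = piece p \<lfloor>log 2 x\<rfloor> x"

lemma halving_eq_piece:
  assumes p: "p \<ge> 1" and x: "2 powi n \<le> x" "x \<le> 2 powi (n + 1)"
  shows "halving p x = piece p n x"
proof -
  have pos: "x > 0" using x(1) by (rule less_le_trans[rotated]) simp
  show ?thesis
  proof (cases "x = 2 powi (n + 1)")
    case True
    have "\<lfloor>log 2 x\<rfloor> = n + 1"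
      by (rule iffD2[OF floor_log2_iff[OF pos]]) (simp add: True power_int_strict_increasing)
    then show ?thesis using piece_ends[OF p] by (simp add: halving_def True)
  next
    case False
    then have "\<lfloor>log 2 x\<rfloor> = n" unfolding floor_log2_iff[OF pos] using x by simp
    then show ?thesis by (simp add: halving_def)
  qed
qed

lemma halving_bounds:
  assumes p: "p \<ge> 1" and n: "2 powi n \<le> x" "x < 2 powi (n + 1)"
  shows "2 powi (int p * n) \<le> halving p x" "halving p x < 2 powi (int p * (n + 1))"
proof -
  have eq: "halving p x = piece p n x" using halving_eq_piece[OF p n(1)] n(2) by simp
  show "2 powi (int p * n) \<le> halving p x"
    using PL_line_le_iff[OF piece_PL_line[of p n], of "2 powi n" x] piece_ends[OF p] n by (simp add: eq)
  show "halving p x < 2 powi (int p * (n + 1))"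
    using PL_line_less_iff[OF piece_PL_line[of p n], of x "2 powi (n + 1)"] piece_ends[OF p] n by (simp add: eq)
qed

lemma halving_pos:
  assumes "p \<ge> 1" "x > 0" shows "halving p x > 0"
proof -
  have "2 powi \<lfloor>log 2 x\<rfloor> \<le> x \<and> x < 2 powi (\<lfloor>log 2 x\<rfloor> + 1)"
    using floor_log2_iff[OF assms(2)] by blast
  then have "2 powi (int p * \<lfloor>log 2 x\<rfloor>) \<le> halving p x"
    using halving_bounds(1)[OF assms(1)] by blast
  then show ?thesis by (rule less_le_trans[rotated]) simp
qed

lemma halving_1: "p \<ge> 1 \<Longrightarrow> halving p 1 = 1"
  using halving_eq_piece[of p 0 1] piece_ends(1)[of p 0] by simp

lemma halving_scale:
  assumes "x > 0"
  shows "halving p (2 powi m * x) = 2 powi (int p * m) * halving p x"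
proof -
  define n where "n = \<lfloor>log 2 x\<rfloor>"
  have n: "2 powi n \<le> x" "x < 2 powi (n + 1)" using floor_log2_iff[OF assms, of n] by (auto simp: n_def)
  have "\<lfloor>log 2 (2 powi m * x)\<rfloor> = m + n"
    using n assms by (subst floor_log2_iff) (simp_all add: power_int_add)
  then show ?thesis
    unfolding halving_def piece_def n_def[symmetric]
    by (simp add: power_int_add distrib_left)
qed

lemma halving_strict_mono:
  assumes p: "p \<ge> 1" and x: "0 < x" "x < y"
  shows "halving p x < halving p y"
proof -
  define n m where "n = \<lfloor>log 2 x\<rfloor>" and "m = \<lfloor>log 2 y\<rfloor>"
  have n: "2 powi n \<le> x" "x < 2 powi (n + 1)" using floor_log2_iff[OF x(1), of n] by (auto simp: n_def)
  have y: "y > 0" using x by simp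
  have m: "2 powi m \<le> y" "y < 2 powi (m + 1)" using floor_log2_iff[OF y, of m] by (auto simp: m_def)
  show ?thesis
  proof (cases "n = m")
    case True
    then show ?thesis
      unfolding halving_def n_def[symmetric] m_def[symmetric]
      using PL_line_less_iff[OF piece_PL_line] x by simp
  next
    case False
    have "n \<le> m"
    proof (rule ccontr)
      assume "\<not> n \<le> m"
      then have "(2::real) powi (m + 1) \<le> 2 powi n" by (intro power_int_increasing) auto
      then show False using n m x by linarith
    qed
    with False have "int p * (n + 1) \<le> int p * m" by (intro mult_left_mono) auto
    then have "(2::real) powi (int p * (n + 1)) \<le> 2 powi (int p * m)" by (intro power_int_increasing) auto
    then show ?thesis using halving_bounds[OF p n] halving_bounds[OF p m] by linarith
  qed
qed

lemma halving_surj: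
  assumes p: "p \<ge> 1" and y: "0 < y"
  shows "\<exists>x>0. halving p x = y"
proof -
  define l where "l = \<lfloor>log 2 y\<rfloor>"
  have l: "2 powi l \<le> y" "y < 2 powi (l + 1)" using floor_log2_iff[OF y, of l] by (auto simp: l_def)
  define n where "n = l div int p"
  have "int p * n + l mod int p = l" by (simp add: n_def)
  moreover have "0 \<le> l mod int p" "l mod int p < int p" using p by simp_all
  ultimately have "int p * n \<le> l" "l + 1 \<le> int p * (n + 1)" unfolding distrib_left by linarith+
  then have "(2::real) powi (int p * n) \<le> 2 powi l" "(2::real) powi (l + 1) \<le> 2 powi (int p * (n + 1))"
    by (intro power_int_increasing, simp_all)+
  then have y': "2 powi (int p * n) \<le> y" "y < 2 powi (int p * (n + 1))" using l by linarith+
  define x where "x = finv (piece p n) y"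
  have x: "piece p n x = y" using f_finv[OF piece_PL_line] by (simp add: x_def)
  have "2 powi n \<le> x" "x < 2 powi (n + 1)"
    using y' PL_line_le_iff[OF piece_PL_line[of p n], of "2 powi n" x]
      PL_line_less_iff[OF piece_PL_line[of p n], of x "2 powi (n + 1)"] piece_ends[OF p] x by simp_all
  moreover from this(1) have "x > 0" by (rule less_le_trans[rotated]) simp
  ultimately show ?thesis using halving_eq_piece[OF p] x by auto
qed

lemma PL_at_halving:
  assumes p: "p \<ge> 1" and x: "x > 0"
  shows "PL_at (halving p) x"
proof -
  define n where "n = \<lfloor>log 2 x\<rfloor>"
  have n: "2 powi n \<le> x" "x < 2 powi (n + 1)" using floor_log2_iff[OF x, of n] by (auto simp: n_def)
  have PL: "PL_at (piece p m) x" for m using piece_PL_line by (simp add: PL_line_def)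
  show ?thesis
  proof (cases "x = 2 powi n")
    case True
    define e where "e = (2::real) powi (n - 1)"
    have e: "e > 0" "2 powi n = 2 * e" "2 powi (n + 1) = 4 * e"
      by (simp_all add: e_def power_int_diff power_int_add)
    show ?thesis
    proof (rule PL_at_glue[OF PL[of n] PL[of "n - 1"] _ e(1)])
      show "x \<in> dyadic" unfolding True by simp
      show "halving p y = piece p n y" if "x \<le> y" "y < x + e" for y
        by (rule halving_eq_piece[OF p]) (use that e in \<open>simp_all add: True\<close>)
      show "halving p y = piece p (n - 1) y" if "x - e < y" "y \<le> x" for y
        by (rule halving_eq_piece[OF p]) (use that e in \<open>simp_all add: True flip: e_def\<close>)
    qed
  next
    case False
    then have "x \<in> {2 powi n <..< 2 powi (n + 1)}" using n by simp
    then show ?thesis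
      by (rule PL_at_cong[OF PL open_greaterThanLessThan]) (auto intro!: halving_eq_piece[OF p, of n])
  qed
qed

text \<open>Its breakpoints accumulate at \<open>0\<close>, the only point at which it may fail to be piecewise linear.\<close>

definition halving_unit :: "nat \<Rightarrow> real \<Rightarrow> real" where
  "halving_unit p x = (if 0 < x \<and> x < 1 then halving p x else x)"

lemma halving_unit_inside: "p \<ge> 1 \<Longrightarrow> 0 < x \<Longrightarrow> x \<le> 1 \<Longrightarrow> halving_unit p x = halving p x"
  by (auto simp: halving_unit_def halving_1 not_less)

lemma halving_unit_outside: "x \<le> 0 \<or> x \<ge> 1 \<Longrightarrow> halving_unit p x = x"
  by (auto simp: halving_unit_def)

lemma halving_unit_bij:
  assumes p: "p \<ge> 1"
  shows "strict_mono (halving_unit p)" "bij (halving_unit p)"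
proof -
  have less_1: "halving p x < 1" if "0 < x" "x < 1" for x
    using halving_strict_mono[OF p that] halving_1[OF p] by simp
  have "halving_unit p x < halving_unit p y" if "x < y" for x y
    using that halving_pos[OF p, of x] halving_pos[OF p, of y] less_1[of x] less_1[of y]
      halving_strict_mono[OF p, of x y]
    unfolding halving_unit_def by fastforce
  then show mono: "strict_mono (halving_unit p)" by (simp add: strict_mono_def)
  have "\<exists>x. halving_unit p x = y" for y
  proof (cases "0 < y \<and> y < 1")
    case True
    then obtain x where x: "x > 0" "halving p x = y" using halving_surj[OF p] by blast
    have "x < 1"
    proof (rule ccontr)
      assume "\<not> x < 1"
      then have "halving p 1 \<le> halving p x"
        using halving_strict_mono[OF p, of 1 x] by (cases "x = 1") auto
      then show False using x True halving_1[OF p] by simp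
    qed
    then show ?thesis using x by (intro exI[of _ x]) (simp add: halving_unit_def)
  next
    case False
    then show ?thesis by (intro exI[of _ y]) (auto simp: halving_unit_def)
  qed
  then have "surj (halving_unit p)" by (metis surj_def)
  then show "bij (halving_unit p)" using strict_mono_imp_inj_on[OF mono] by (simp add: bij_def)
qed

lemma halving_unit_inv:
  assumes "p \<ge> 1"
  shows "finv (halving_unit p) (halving_unit p x) = x" "halving_unit p (finv (halving_unit p) x) = x"
  using halving_unit_bij(2)[OF assms] by (simp_all add: bij_is_inj bij_is_surj surj_f_inv_f)

lemma PL_at_halving_unit:
  assumes p: "p \<ge> 1" and x: "x \<noteq> 0"
  shows "PL_at (halving_unit p) x"
proof -
  consider "x < 0" | "0 < x" "x < 1" | "x = 1" | "x > 1" using x by linarith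
  then show ?thesis
  proof cases
    case 1
    show ?thesis
      by (rule PL_at_cong[OF PL_at_id(2) open_lessThan[of 0]]) (use 1 in \<open>simp_all add: halving_unit_def\<close>)
  next
    case 2
    show ?thesis
      by (rule PL_at_cong[OF PL_at_halving[OF p 2(1)] open_greaterThanLessThan[of 0 1]])
        (use 2 in \<open>simp_all add: halving_unit_def\<close>)
  next
    case 3
    show ?thesis unfolding 3
    proof (rule PL_at_glue[of "\<lambda>x. x" 1 "halving p" "1/2"])
      show "PL_at (halving p) 1" by (rule PL_at_halving[OF p]) simp
      show "halving_unit p y = halving p y" if "1 - 1/2 < y" "y \<le> 1" for y
        by (rule halving_unit_inside[OF p]) (use that in simp_all)
    qed (simp_all add: PL_at_id halving_unit_outside)
  next
    case 4
    show ?thesis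
      by (rule PL_at_cong[OF PL_at_id(2) open_greaterThan[of 1]]) (use 4 in \<open>simp_all add: halving_unit_def\<close>)
  qed
qed

text \<open>Only at \<open>0\<close> the conjugate has to be examined, since everywhere else all three maps are piecewise
  linear. At \<open>1\<close> the slope of \<open>c\<close> cancels.\<close>

lemma conj_TF:
  assumes c: "strict_mono c" "bij c" "\<And>x. x \<noteq> 0 \<Longrightarrow> PL_at c x" "\<And>x. x \<le> 0 \<or> x \<ge> 1 \<Longrightarrow> c x = x"
    and f: "f \<in> TF" and K: "germ 1 (c \<circ> f \<circ> finv c) 0 K"
  shows "c \<circ> f \<circ> finv c \<in> TF" "slope0 (c \<circ> f \<circ> finv c) = K" "slope1 (c \<circ> f \<circ> finv c) = slope1 f"
proof -
  have inv: "finv c (c x) = x" "c (finv c x) = x" for x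
    using c(2) by (simp_all add: bij_is_inj bij_is_surj surj_f_inv_f)
  have fixc: "finv c x = x" if "x \<le> 0 \<or> x \<ge> 1" for x using inv(1)[of x] c(4)[OF that] by simp
  have mono_inv: "finv c x < finv c y" if "x < y" for x y
    using that strict_mono_less[OF c(1), of "finv c x" "finv c y"] by (simp add: inv)
  have outside: "(c \<circ> f \<circ> finv c) x = x" if "x \<le> 0 \<or> x \<ge> 1" for x
    using fixc[OF that] TF_outside[OF f that] c(4)[OF that] by simp
  have "PL_at (c \<circ> f \<circ> finv c) x" for x
  proof (cases "x = 0")
    case True
    have "germ (-1) (c \<circ> f \<circ> finv c) 0 0"
      by (rule germ_leftI[of 1]) (use outside in \<open>simp_all del: o_apply\<close>)
    then show ?thesis unfolding True PL_at_def
      using K outside[of 0] by (intro exI[of _ K] exI[of _ 0]) simp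
  next
    case False
    define z where "z = finv c x"
    have z: "c z = x" by (simp add: z_def inv)
    have "z \<noteq> 0" using z False c(4)[of 0] by auto
    have fz: "f z \<noteq> 0" using PL_line_inj[OF TF_PL_line[OF f]] TF_0[OF f] \<open>z \<noteq> 0\<close> by (metis inj_eq)
    have "PL_at (finv c) x"
      using PL_at_finv[OF c(3)[OF \<open>z \<noteq> 0\<close>] bij_is_inj[OF c(2)]] unfolding z .
    moreover have "PL_at f z" using f by (simp add: TF_def PL_line_def)
    ultimately have "PL_at (f \<circ> finv c) x" by (intro PL_at_comp) (simp_all add: z_def)
    moreover have "PL_at c (f z)" by (rule c(3)[OF fz])
    ultimately have "PL_at (c \<circ> (f \<circ> finv c)) x"
      by (intro PL_at_comp[of "f \<circ> finv c"]) (simp_all add: z_def)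
    then show ?thesis by (simp only: o_assoc)
  qed
  moreover have "strict_mono (c \<circ> f \<circ> finv c)"
    using mono_inv PL_line_less_iff[OF TF_PL_line[OF f]] strict_mono_less[OF c(1)]
    by (simp add: strict_mono_def)
  moreover have "surj (c \<circ> f \<circ> finv c)"
    using c(2) PL_line_bij[OF TF_PL_line[OF f]] bij_imp_bij_inv[OF c(2)]
    by (intro comp_surj bij_is_surj) auto
  ultimately show TF: "c \<circ> f \<circ> finv c \<in> TF"
    using outside unfolding TF_def PL_line_def by (auto simp del: o_apply)
  show "slope0 (c \<circ> f \<circ> finv c) = K" by (rule slope0_eq[OF K])
  obtain l where l: "germ (-1) c 1 l" using c(3)[of 1] by (auto simp: PL_at_def)
  have c1: "c 1 = 1" "finv c 1 = 1" using c(4)[of 1] fixc[of 1] by simp_all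
  have "germ (-1) (f \<circ> finv c) 1 (slope1 f + - l)"
    using germ_finv[OF l bij_is_inj[OF c(2)]] germ_slope1[OF TF_PL_line[OF f]]
    by (intro germ_comp) (simp_all only: c1)
  then have "germ (-1) (c \<circ> (f \<circ> finv c)) 1 (l + (slope1 f + - l))"
    using l f by (intro germ_comp[of _ "f \<circ> finv c"]) (simp_all add: c1)
  then show "slope1 (c \<circ> f \<circ> finv c) = slope1 f"
    by (intro slope1_eq) (simp add: o_assoc)
qed

lemma powi_mult_lt_1:
  assumes "p \<ge> 1" and x: "0 < x" "x < min 1 (2 powi (- m))"
  shows "0 < 2 powi m * x" "2 powi m * x < 1" "0 < x" "x < 1"
    "halving_unit p (2 powi m * x) = 2 powi (int p * m) * halving_unit p x"
proof -
  have "2 powi m * x < 2 powi m * 2 powi (- m)" using x by (intro mult_strict_left_mono) auto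
  then show *: "0 < 2 powi m * x" "2 powi m * x < 1" "0 < x" "x < 1"
    using x by (simp_all add: power_int_minus)
  show "halving_unit p (2 powi m * x) = 2 powi (int p * m) * halving_unit p x"
    using * halving_scale[OF x(1), of p m] by (simp add: halving_unit_def)
qed

text \<open>Near \<open>0\<close> the map \<open>f\<close> is multiplication by a power \<open>2\<^sup>m\<close>, which the scaling law of the halving map
  turns into multiplication by \<open>2\<^sup>p\<^sup>m\<close>.\<close>

lemma germ_conj_halving:
  assumes p: "p \<ge> 1" and f: "f \<in> TF"
  shows "germ 1 (halving_unit p \<circ> f \<circ> finv (halving_unit p)) 0 (int p * slope0 f)"
proof -
  let ?c = "halving_unit p" and ?m = "slope0 f"
  note inv = halving_unit_inv[OF p]
  obtain d where d: "d > 0" "\<forall>y\<in>{0..0 + d}. f y = f 0 + 2 powi ?m * (y - 0)"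
    using germ_slope0[OF TF_PL_line[OF f]] unfolding germ_right_interval by blast
  define e where "e = min d (min 1 (2 powi (- ?m)) / 2)"
  have "min 1 (2 powi (- ?m)) > (0::real)" by simp
  then have e: "0 < e" "e \<le> d" "e < min 1 (2 powi (- ?m))"
    using d(1) unfolding e_def by linarith+
  have ce: "?c e > 0"
    using strict_mono_less[OF halving_unit_bij(1)[OF p], of 0 e] e(1) by (simp add: halving_unit_outside)
  have c0: "?c 0 = 0" "finv ?c 0 = 0" using inv(1)[of 0] by (simp_all add: halving_unit_outside)
  show ?thesis
  proof (rule germ_rightI[OF ce])
    fix y assume y: "0 \<le> y" "y \<le> 0 + ?c e"
    define x where "x = finv ?c y"
    have xy: "?c x = y" by (simp add: x_def inv)
    have x: "0 \<le> x" "x \<le> e"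
      using strict_mono_less_eq[OF halving_unit_bij(1)[OF p], of 0 x]
        strict_mono_less_eq[OF halving_unit_bij(1)[OF p], of x e] y xy c0 by simp_all
    have fx: "f x = 2 powi ?m * x"
      using bspec[OF d(2), of x] x e f by simp
    show "(?c \<circ> f \<circ> finv ?c) y = (?c \<circ> f \<circ> finv ?c) 0 + 2 powi (int p * ?m) * (y - 0)"
    proof (cases "x = 0")
      case True
      then have "y = 0" using xy c0 by simp
      then show ?thesis by simp
    next
      case False
      then have "0 < x" "x < min 1 (2 powi (- ?m))" using x e by linarith+
      from powi_mult_lt_1(5)[OF p this] have "?c (f x) = 2 powi (int p * ?m) * ?c x"
        unfolding fx .
      then show ?thesis using xy c0 f by (simp flip: x_def)
    qed
  qed
qed

lemma germ_conj_halving_inv: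
  assumes p: "p \<ge> 1" and z: "z \<in> TF" and m: "slope0 z = int p * m"
  shows "germ 1 (finv (halving_unit p) \<circ> z \<circ> finv (finv (halving_unit p))) 0 m"
proof -
  let ?c = "halving_unit p"
  have cc: "finv (finv ?c) = ?c" by (rule inv_inv_eq[OF halving_unit_bij(2)[OF p]])
  note inv = halving_unit_inv[OF p]
  have c0: "?c 0 = 0" "finv ?c 0 = 0" using inv(1)[of 0] by (simp_all add: halving_unit_outside)
  obtain d where d: "d > 0" "\<forall>y\<in>{0..0 + d}. z y = z 0 + 2 powi slope0 z * (y - 0)"
    using germ_slope0[OF TF_PL_line[OF z]] unfolding germ_right_interval by blast
  have d': "finv ?c d > 0"
    using strict_mono_less[OF halving_unit_bij(1)[OF p], of 0 "finv ?c d"] d(1) c0 inv by simp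
  define e where "e = min (finv ?c d) (min 1 (2 powi (- m)) / 2)"
  have "min 1 (2 powi (- m)) > (0::real)" by simp
  then have e: "0 < e" "e \<le> finv ?c d" "e < min 1 (2 powi (- m))"
    using d' unfolding e_def by linarith+
  show ?thesis
    unfolding cc
  proof (rule germ_rightI[OF e(1)])
    fix x assume x: "0 \<le> x" "x \<le> 0 + e"
    show "(finv ?c \<circ> z \<circ> ?c) x = (finv ?c \<circ> z \<circ> ?c) 0 + 2 powi m * (x - 0)"
    proof (cases "x = 0")
      case True
      then show ?thesis by simp
    next
      case False
      then have x': "0 < x" "x < min 1 (2 powi (- m))" using x e by linarith+
      have "0 \<le> ?c x" "?c x \<le> d"
        using strict_mono_less_eq[OF halving_unit_bij(1)[OF p], of 0 x]
          strict_mono_less_eq[OF halving_unit_bij(1)[OF p], of x "finv ?c d"] x e c0 inv by simp_all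
      then have "z (?c x) = 2 powi (int p * m) * ?c x"
        using bspec[OF d(2), of "?c x"] z m by simp
      also have "\<dots> = ?c (2 powi m * x)" using powi_mult_lt_1(5)[OF p x'] by simp
      finally show ?thesis using c0 z by (simp add: inv)
    qed
  qed
qed

definition conj_halving :: "nat \<Rightarrow> (real \<Rightarrow> real) \<Rightarrow> real \<Rightarrow> real" where
  "conj_halving p f = halving_unit p \<circ> f \<circ> finv (halving_unit p)"

lemma conj_halving_comp:
  assumes "p \<ge> 1" shows "conj_halving p (f \<circ> g) = conj_halving p f \<circ> conj_halving p g"
  using halving_unit_bij(2)[OF assms] by (intro ext) (simp add: conj_halving_def bij_is_inj)

lemma conj_halving_inj:
  assumes "p \<ge> 1" shows "inj (conj_halving p)"
proof (rule injI)
  fix f g assume eq: "conj_halving p f = conj_halving p g"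
  note inv = halving_unit_inv[OF assms]
  have "f x = g x" for x
    using fun_cong[OF eq, of "halving_unit p x"] inv bij_is_inj[OF halving_unit_bij(2)[OF assms]]
    by (simp add: conj_halving_def inj_eq)
  then show "f = g" by blast
qed

lemma conj_halving_TF:
  assumes p: "p \<ge> 1" and f: "f \<in> TF"
  shows "conj_halving p f \<in> TF" "slope0 (conj_halving p f) = int p * slope0 f"
    "slope1 (conj_halving p f) = slope1 f"
  unfolding conj_halving_def
  using conj_TF[OF halving_unit_bij[OF p] PL_at_halving_unit[OF p] halving_unit_outside f germ_conj_halving[OF p f]]
  by simp_all

lemma conj_halving_surj:
  assumes p: "p \<ge> 1" and z: "z \<in> TF" "int p dvd slope0 z"
  obtains f where "f \<in> TF" "z = conj_halving p f"
proof -
  let ?c = "halving_unit p"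
  obtain m where m: "slope0 z = int p * m" using z(2) by (auto simp: dvd_def)
  note inv = halving_unit_inv[OF p]
  have "strict_mono (finv ?c)"
    unfolding strict_mono_def
  proof (intro allI impI)
    fix x y :: real assume "x < y"
    then show "finv ?c x < finv ?c y"
      using strict_mono_less[OF halving_unit_bij(1)[OF p], of "finv ?c x" "finv ?c y"] by (simp add: inv)
  qed
  moreover have "bij (finv ?c)" by (rule bij_imp_bij_inv[OF halving_unit_bij(2)[OF p]])
  moreover have out: "finv ?c x = x" if "x \<le> 0 \<or> x \<ge> 1" for x
    using inv(1)[of x] halving_unit_outside[OF that, of p] by simp
  moreover have "PL_at (finv ?c) x" if "x \<noteq> 0" for x
  proof -
    have "finv ?c x \<noteq> 0" using that inv(2)[of x] halving_unit_outside[of 0 p] by auto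
    from PL_at_finv[OF PL_at_halving_unit[OF p this] bij_is_inj[OF halving_unit_bij(2)[OF p]]]
    show ?thesis by (simp add: inv)
  qed
  ultimately have "finv ?c \<circ> z \<circ> finv (finv ?c) \<in> TF"
    using conj_TF(1)[OF _ _ _ _ z(1) germ_conj_halving_inv[OF p z(1) m]] by blast
  moreover have "finv (finv ?c) = ?c" by (rule inv_inv_eq[OF halving_unit_bij(2)[OF p]])
  moreover have "z = conj_halving p (finv ?c \<circ> z \<circ> ?c)"
    by (rule ext) (simp add: conj_halving_def inv)
  ultimately show ?thesis using that by simp
qed

text \<open>Conjugation by a halving map multiplies the slope exponent at \<open>0\<close> and leaves that at \<open>1\<close> alone. So two
  such conjugations, one of them reversed, act on the two exponents independently.\<close>

theorem TF_div_iso: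
  assumes "p > 0" "q > 0"
  shows "\<exists>\<Phi>. bij_betw \<Phi> TF (TF_div p q) \<and> (\<forall>f\<in>TF. \<forall>g\<in>TF. \<Phi> (f \<circ> g) = \<Phi> f \<circ> \<Phi> g)"
proof -
  have p: "p \<ge> 1" and q: "q \<ge> 1" using assms by simp_all
  define \<Phi> where "\<Phi> f = flip (conj_halving q (flip (conj_halving p f)))" for f
  have closed: "\<Phi> f \<in> TF_div p q" if "f \<in> TF" for f
    using conj_halving_TF[OF p that] conj_halving_TF[OF q flip_TF[OF conj_halving_TF(1)[OF p that]]]
    by (simp add: \<Phi>_def TF_div_def flip_TF slope_flip)
  have "inj_on \<Phi> TF"
  proof (rule inj_onI)
    fix f g assume "\<Phi> f = \<Phi> g"
    then have "flip (\<Phi> f) = flip (\<Phi> g)" by simp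
    then have "flip (flip (conj_halving p f)) = flip (flip (conj_halving p g))"
      using conj_halving_inj[OF q] by (simp add: \<Phi>_def inj_eq)
    then show "f = g" using conj_halving_inj[OF p] by (simp add: inj_eq)
  qed
  moreover have "\<Phi> ` TF = TF_div p q"
  proof (intro equalityI subsetI)
    fix z assume "z \<in> TF_div p q"
    then have z: "z \<in> TF" "int p dvd slope0 z" "int q dvd slope1 z" by (auto simp: TF_div_def)
    have "int q dvd slope0 (flip z)" using z by (simp add: slope_flip)
    then obtain u where u: "u \<in> TF" "flip z = conj_halving q u"
      using conj_halving_surj[OF q flip_TF[OF z(1)]] by blast
    have "slope1 u = slope0 z"
      using conj_halving_TF(3)[OF q u(1)] z(1) by (simp add: slope_flip flip: u(2))
    then have "int p dvd slope0 (flip u)" using z(2) by (simp add: slope_flip[OF u(1)])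
    then obtain w where w: "w \<in> TF" "flip u = conj_halving p w"
      using conj_halving_surj[OF p flip_TF[OF u(1)]] by blast
    have "\<Phi> w = z"
      unfolding \<Phi>_def by (simp flip: w(2) u(2))
    then show "z \<in> \<Phi> ` TF" using w(1) by blast
  qed (use closed in auto)
  moreover have "\<Phi> (f \<circ> g) = \<Phi> f \<circ> \<Phi> g" for f g
    by (simp only: \<Phi>_def conj_halving_comp[OF p] conj_halving_comp[OF q] flip_comp)
  ultimately show ?thesis by (auto simp: bij_betw_def)
qed

section \<open>The two models of Thompson's group agree\<close>

definition restr :: "(real \<Rightarrow> real) \<Rightarrow> real \<Rightarrow> real" where
  "restr f = restrict f {0..1}"

lemma TF_image_unit: "f \<in> TF \<Longrightarrow> f ` {0..1} = {0..1}"
proof (intro equalityI subsetI)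
  fix y assume f: "f \<in> TF" and "y \<in> {0..1::real}"
  then have "finv f y \<in> {0..1}" using TF_bounds[OF TF_finv[OF f], of y] by simp
  moreover have "f (finv f y) = y" using f by (simp add: f_finv TF_PL_line)
  ultimately show "y \<in> f ` {0..1}" by (metis imageI)
qed (auto simp: TF_bounds)

lemma TF_homeomorphism:
  assumes f: "f \<in> TF" shows "homeomorphism {0..1} {0..1} f (finv f)"
proof -
  have cont: "continuous_on {0..1} g" if "g \<in> TF" for g
    using that PL_at_isCont by (intro continuous_at_imp_continuous_on) (auto simp: TF_def PL_line_def)
  show ?thesis
    unfolding homeomorphism_def
    using TF_image_unit[OF f] TF_image_unit[OF TF_finv[OF f]] cont[OF f] cont[OF TF_finv[OF f]]
    by (simp add: finv_f f_finv TF_PL_line f)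
qed

lemma dyadic_PL_cong: "(\<And>x. x \<in> {0..1} \<Longrightarrow> f x = g x) \<Longrightarrow> dyadic_PL f \<Longrightarrow> dyadic_PL g"
  unfolding dyadic_PL_def by (elim exE, rule exI) fastforce

text \<open>The breakpoints are among those of a fine enough uniform subdivision.\<close>

lemma TF_dyadic_PL:
  assumes f: "f \<in> TF" shows "dyadic_PL f"
proof -
  obtain N where N: "\<forall>i<2 ^ N.
     \<exists>j m::nat. \<forall>t\<in>{0..1::real}. f ((real i + t) / 2 ^ N) = (real m + t) / 2 ^ j"
    using TF_standard_intervals[OF f] ..
  define B where "B = (\<lambda>i. real i / 2 ^ N) ` {0<..<2 ^ N}"
  have "finite B" by (simp add: B_def)
  moreover have "B \<subseteq> dyadics \<inter> {0<..<1}"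
  proof
    fix x assume "x \<in> B"
    then obtain i where i: "0 < i" "i < 2 ^ N" "x = real i / 2 ^ N" by (auto simp: B_def)
    have "real i < 2 ^ N" using i(2) by (metis of_nat_less_iff of_nat_numeral of_nat_power)
    then have "0 < x" "x < 1" using i by simp_all
    moreover have "x \<in> dyadics" unfolding dyadics_def using i(3) by blast
    ultimately show "x \<in> dyadics \<inter> {0<..<1}" by simp
  qed
  moreover have "\<exists>(k::int) c. \<forall>x\<in>{a..b}. f x = 2 powi k * x + c"
    if ab: "0 \<le> a" "a < b" "b \<le> 1" "{a<..<b} \<inter> B = {}" for a b
  proof -
    define i where "i = nat \<lfloor>a * 2 ^ N\<rfloor>"
    have i: "real i \<le> a * 2 ^ N" "a * 2 ^ N < real i + 1"
      using ab(1) by (simp_all add: i_def)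
    have "a * 2 ^ N < 1 * 2 ^ N" using ab by (intro mult_strict_right_mono) auto
    then have "real i < 2 ^ N" using i by linarith
    then have iN: "i < 2 ^ N" by simp
    have b: "b * 2 ^ N \<le> real i + 1"
    proof (rule ccontr)
      assume "\<not> ?thesis"
      then have lt: "real (Suc i) < b * 2 ^ N" by simp
      have "b * 2 ^ N \<le> 1 * 2 ^ N" using ab by (intro mult_right_mono) auto
      then have "real (Suc i) < 2 ^ N" using lt by linarith
      then have "Suc i < 2 ^ N" by (simp del: of_nat_Suc)
      then have "real (Suc i) / 2 ^ N \<in> B" unfolding B_def by (intro imageI) simp
      moreover have "a < real (Suc i) / 2 ^ N" "real (Suc i) / 2 ^ N < b"
        using i lt by (simp_all add: field_simps)
      ultimately have "real (Suc i) / 2 ^ N \<in> {a<..<b} \<inter> B" by simp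
      then show False unfolding ab(4) by simp
    qed
    obtain j m :: nat where jm: "\<forall>t\<in>{0..1::real}. f ((real i + t) / 2 ^ N) = (real m + t) / 2 ^ j"
      using N iN by blast
    have "f x = 2 powi (int N - int j) * x + (real m - real i) / 2 ^ j" if "x \<in> {a..b}" for x
    proof -
      have "a * 2 ^ N \<le> x * 2 ^ N" "x * 2 ^ N \<le> b * 2 ^ N" using that by (simp_all add: mult_right_mono)
      then have "0 \<le> x * 2 ^ N - real i" "x * 2 ^ N - real i \<le> 1" using i b by linarith+
      then have "x * 2 ^ N - real i \<in> {0..1}" by simp
      from bspec[OF jm this] have "f x = (real m + (x * 2 ^ N - real i)) / 2 ^ j" by simp
      then show ?thesis by (simp add: power_int_diff add_divide_distrib diff_divide_distrib)
    qed
    then show ?thesis by (intro exI[of _ "int N - int j"] exI ballI)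
  qed
  ultimately show ?thesis
    unfolding dyadic_PL_def by (intro exI[of _ B] conjI allI impI; (elim conjE)?) simp_all
qed

lemma restr_thompson_F: "f \<in> TF \<Longrightarrow> restr f \<in> carrier thompson_F"
proof -
  assume f: "f \<in> TF"
  have "homeomorphism {0..1} {0..1} (restr f) (finv f)"
    using homeomorphism_cong[OF TF_homeomorphism[OF f] refl refl, of "restr f" "finv f"]
    by (simp add: restr_def)
  moreover have "dyadic_PL (restr f)"
    by (rule dyadic_PL_cong[OF _ TF_dyadic_PL[OF f]]) (simp add: restr_def)
  moreover have "restr f \<in> extensional {0..1}" by (simp add: restr_def)
  ultimately show ?thesis unfolding thompson_F_def by auto
qed

text \<open>The point is that the constants of the affine pieces, which may be arbitrary real numbers in
  the definition, are dyadic. This holds at \<open>0\<close> and is passed on from piece to piece, because breakpoints are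
  dyadic.\<close>

lemma thompson_F_restr:
  assumes "u \<in> carrier thompson_F"
  obtains f where "f \<in> TF" "u = restr f"
proof -
  obtain u' where u: "u \<in> extensional {0..1}" "homeomorphism {0..1} {0..1} u u'" "dyadic_PL u"
    using assms unfolding thompson_F_def by simp blast
  define f where "f x = (if 0 \<le> x \<and> x \<le> 1 then u x else x)" for x
  have fu: "f x = u x" if "0 \<le> x" "x \<le> 1" for x using that by (simp add: f_def)
  have f_out: "f x = x" if "x < 0 \<or> x > 1" for x using that by (auto simp: f_def)
  obtain B where B': "finite B \<and> B \<subseteq> dyadics \<inter> {0<..<1} \<and>
      (\<forall>a b. 0 \<le> a \<and> a < b \<and> b \<le> 1 \<and> {a<..<b} \<inter> B = {} \<longrightarrow>
           (\<exists>(k::int) c. \<forall>x\<in>{a..b}. u x = 2 powi k * x + c))"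
    using u(3) unfolding dyadic_PL_def ..
  note B = conjunct1[OF B'] conjunct1[OF conjunct2[OF B']]
  have aff: "\<exists>(k::int) c. \<forall>x\<in>{a..b}. u x = 2 powi k * x + c"
    if "0 \<le> a" "a < b" "b \<le> 1" "{a<..<b} \<inter> B = {}" for a b
    using conjunct2[OF conjunct2[OF B']] that by simp
  have B_dyadic: "x \<in> dyadic" if "x \<in> B" for x using that B(2) unfolding dyadics_eq by blast
  \<comment> \<open>Each point has a one-sided affine neighbourhood on either side within the interval, and a two-sided one
      unless it lies in \<open>B\<close>.\<close>
  have near: "\<exists>d>0. (x < 1 \<longrightarrow> x + d \<le> 1 \<and> (\<exists>k c. \<forall>y. x \<le> y \<longrightarrow> y \<le> x + d \<longrightarrow> f y = 2 powi k * y + c)) \<and>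
      (0 < x \<longrightarrow> 0 \<le> x - d \<and> (\<exists>k c. \<forall>y. x - d \<le> y \<longrightarrow> y \<le> x \<longrightarrow> f y = 2 powi k * y + c)) \<and>
      (0 < x \<and> x < 1 \<and> x \<notin> B \<longrightarrow> (\<exists>k c. \<forall>y. x - d \<le> y \<longrightarrow> y \<le> x + d \<longrightarrow> f y = 2 powi k * y + c))"
    if x: "0 \<le> x" "x \<le> 1" for x
  proof -
    obtain e where e: "e > 0" "\<And>y. y \<in> B \<Longrightarrow> y \<noteq> x \<Longrightarrow> e \<le> dist x y"
      using finite_set_avoid[OF B(1), of x] by blast
    define d where "d = min e (min (if x < 1 then 1 - x else 1) (if 0 < x then x else 1))"
    have d: "d > 0" "d \<le> e" "x < 1 \<Longrightarrow> d \<le> 1 - x" "0 < x \<Longrightarrow> d \<le> x"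
      using e(1) by (auto simp: d_def)
    have avoid: "y \<notin> B" if "x - d < y" "y < x + d" "y \<noteq> x" for y
    proof
      assume "y \<in> B"
      then have "e \<le> \<bar>x - y\<bar>" using e(2) that(3) by (simp add: dist_real_def)
      then show False using that d(2) by linarith
    qed
    have ex: "\<exists>k c. \<forall>y. a \<le> y \<longrightarrow> y \<le> b \<longrightarrow> f y = 2 powi k * y + c"
      if "0 \<le> a" "a < b" "b \<le> 1" "{a<..<b} \<inter> B = {}" for a b
    proof -
      from aff[OF that] obtain k c where kc: "\<forall>y\<in>{a..b}. u y = 2 powi k * y + c" by blast
      have "f y = 2 powi k * y + c" if "a \<le> y" "y \<le> b" for y
      proof -
        have "f y = u y" using fu[of y] that \<open>0 \<le> a\<close> \<open>b \<le> 1\<close> by simp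
        then show ?thesis using bspec[OF kc, of y] that by simp
      qed
      then show ?thesis by (intro exI[of _ k] exI[of _ c]) simp
    qed
    have "x + d \<le> 1 \<and> (\<exists>k c. \<forall>y. x \<le> y \<longrightarrow> y \<le> x + d \<longrightarrow> f y = 2 powi k * y + c)" if "x < 1"
    proof
      show "x + d \<le> 1" using d(3)[OF that] by simp
      moreover have "{x<..<x + d} \<inter> B = {}" using avoid d(1) by auto
      ultimately show "\<exists>k c. \<forall>y. x \<le> y \<longrightarrow> y \<le> x + d \<longrightarrow> f y = 2 powi k * y + c"
        using d(1) x by (intro ex) auto
    qed
    moreover have "0 \<le> x - d \<and> (\<exists>k c. \<forall>y. x - d \<le> y \<longrightarrow> y \<le> x \<longrightarrow> f y = 2 powi k * y + c)" if "0 < x"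
    proof
      show "0 \<le> x - d" using d(4)[OF that] by simp
      moreover have "{x - d<..<x} \<inter> B = {}" using avoid d(1) by auto
      ultimately show "\<exists>k c. \<forall>y. x - d \<le> y \<longrightarrow> y \<le> x \<longrightarrow> f y = 2 powi k * y + c"
        using d(1) x by (intro ex) auto
    qed
    moreover have "\<exists>k c. \<forall>y. x - d \<le> y \<longrightarrow> y \<le> x + d \<longrightarrow> f y = 2 powi k * y + c"
      if "0 < x \<and> x < 1 \<and> x \<notin> B"
    proof -
      have "{x - d<..<x + d} \<inter> B = {}" using avoid that by (metis disjoint_iff greaterThanLessThan_iff)
      then show ?thesis using d(1,3,4) that by (intro ex) auto
    qed
    ultimately show ?thesis by (intro exI[of _ d] conjI d(1) impI) simp_all
  qed
  have germR: "germ 1 f x k" if "d > 0" "\<forall>y. x \<le> y \<longrightarrow> y \<le> x + d \<longrightarrow> f y = 2 powi k * y + c" for x d k c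
  proof (rule germ_rightI[OF that(1)])
    fix y assume y: "x \<le> y" "y \<le> x + d"
    have "f y = 2 powi k * y + c" "f x = 2 powi k * x + c" using that y by simp_all
    then show "f y = f x + 2 powi k * (y - x)" by (simp add: algebra_simps)
  qed
  have germL: "germ (-1) f x k" if "d > 0" "\<forall>y. x - d \<le> y \<longrightarrow> y \<le> x \<longrightarrow> f y = 2 powi k * y + c" for x d k c
  proof (rule germ_leftI[OF that(1)])
    fix y assume y: "x - d \<le> y" "y \<le> x"
    have "f y = 2 powi k * y + c" "f x = 2 powi k * x + c" using that y by simp_all
    then show "f y = f x - 2 powi k * (x - y)" by (simp add: algebra_simps)
  qed
  have less: "f a < f b" if "0 \<le> a" "a < b" "b \<le> 1" for a b
  proof -
    have "0 \<le> a \<longrightarrow> a < b \<longrightarrow> b \<le> 1 \<longrightarrow> f a < f b"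
      using less_imp_le[OF that(2)]
    proof (induction rule: Bolzano)
      case (trans a b c)
      then show ?case by (cases "a = b"; cases "b = c") auto
    next
      case (local x)
      show ?case
      proof (cases "0 \<le> x \<and> x \<le> 1")
        case True
        obtain d where d: "d > 0"
          "x < 1 \<longrightarrow> x + d \<le> 1 \<and> (\<exists>k c. \<forall>y. x \<le> y \<longrightarrow> y \<le> x + d \<longrightarrow> f y = 2 powi k * y + c)"
          "0 < x \<longrightarrow> 0 \<le> x - d \<and> (\<exists>k c. \<forall>y. x - d \<le> y \<longrightarrow> y \<le> x \<longrightarrow> f y = 2 powi k * y + c)"
          using near[of x] True by blast
        have R: "f x < f b'" if b': "x < b'" "b' < x + d" "b' \<le> 1" for b'
        proof -
          obtain k c where kc: "\<forall>y. x \<le> y \<longrightarrow> y \<le> x + d \<longrightarrow> f y = 2 powi k * y + c" using d(2) b' by auto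
          have "f x = 2 powi k * x + c" "f b' = 2 powi k * b' + c" using kc b' by simp_all
          then show ?thesis using b' by simp
        qed
        have L: "f a' < f x" if a': "a' < x" "x - d < a'" "0 \<le> a'" for a'
        proof -
          obtain k c where kc: "\<forall>y. x - d \<le> y \<longrightarrow> y \<le> x \<longrightarrow> f y = 2 powi k * y + c" using d(3) a' by auto
          have "f x = 2 powi k * x + c" "f a' = 2 powi k * a' + c" using kc a' d(1) by simp_all
          then show ?thesis using a' by simp
        qed
        have "0 \<le> a' \<longrightarrow> a' < b' \<longrightarrow> b' \<le> 1 \<longrightarrow> f a' < f b'" if "a' \<le> x \<and> x \<le> b' \<and> b' - a' < d" for a' b'
          using L[of a'] R[of b'] that by (cases "a' = x"; cases "b' = x") force+
        then show ?thesis using d(1) by blast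
      next
        case False
        then show ?thesis by (intro exI[of _ 1]) auto
      qed
    qed
    then show ?thesis using that by blast
  qed
  have im: "u ` {0..1} = {0..1}" using u(2) by (simp add: homeomorphism_def)
  have f_im: "0 \<le> f x" "f x \<le> 1" if "0 \<le> x" "x \<le> 1" for x
  proof -
    have "u x \<in> u ` {0..1}" using that by (intro imageI) simp
    then show "0 \<le> f x" "f x \<le> 1" unfolding im fu[OF that] by simp_all
  qed
  have preim: "\<exists>x. 0 \<le> x \<and> x \<le> 1 \<and> f x = y" if "0 \<le> y" "y \<le> 1" for y
  proof -
    have "y \<in> u ` {0..1}" unfolding im using that by simp
    then obtain x where x: "y = u x" "x \<in> {0..1}" by (rule imageE)
    have "f x = y" using fu[of x] x by simp
    then show ?thesis using x(2) by (intro exI[of _ x]) simp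
  qed
  have f0: "f 0 = 0"
  proof -
    obtain x where x: "0 \<le> x \<and> x \<le> 1 \<and> f x = 0" using preim[of 0] by fastforce
    show ?thesis
    proof (cases "x = 0")
      case False
      then have "f 0 < f x" using x by (intro less) simp_all
      then show ?thesis using x f_im(1)[of 0] by linarith
    qed (use x in simp)
  qed
  have f1: "f 1 = 1"
  proof -
    obtain x where x: "0 \<le> x \<and> x \<le> 1 \<and> f x = 1" using preim[of 1] by fastforce
    show ?thesis
    proof (cases "x = 1")
      case False
      then have "f x < f 1" using x by (intro less) simp_all
      then show ?thesis using x f_im(2)[of 1] by linarith
    qed (use x in simp)
  qed
  have mono: "strict_mono f"
    unfolding strict_mono_def
  proof (intro allI impI)
    fix x y :: real assume xy: "x < y"
    consider "0 \<le> x" "y \<le> 1" | "x < 0" "0 \<le> y" "y \<le> 1" | "0 \<le> x" "x \<le> 1" "y > 1"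
      | "x < 0 \<or> x > 1" "y < 0 \<or> y > 1" using xy by linarith
    then show "f x < f y"
    proof cases
      case 1
      then show ?thesis using less xy by blast
    next
      case 2
      then show ?thesis using f_im[of y] f_out[of x] by simp
    next
      case 3
      then show ?thesis using f_im[of x] f_out[of y] by simp
    next
      case 4
      then show ?thesis using f_out xy by simp
    qed
  qed
  have surj: "surj f"
  proof -
    have "\<exists>x. f x = y" for y
    proof (cases "0 \<le> y \<and> y \<le> 1")
      case True
      then show ?thesis using preim[of y] by blast
    next
      case False
      then have "f y = y" using f_out[of y] by linarith
      then show ?thesis by blast
    qed
    then show ?thesis by (metis surj_def)
  qed
  \<comment> \<open>The affine piece to the right of \<open>y\<close> has a dyadic constant.\<close>
  define Q where "Q y \<longleftrightarrow> (\<exists>k. germ 1 f y k \<and> f y - 2 powi k * y \<in> dyadic)" for y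
  have Q_iff: "Q y \<longleftrightarrow> f y - 2 powi k * y \<in> dyadic" if "germ 1 f y k" for y k
  proof
    assume "Q y"
    then obtain l where "germ 1 f y l" "f y - 2 powi l * y \<in> dyadic" by (auto simp: Q_def)
    then show "f y - 2 powi k * y \<in> dyadic" using germ_unique[OF that, of l] by simp
  qed (use that in \<open>auto simp: Q_def\<close>)
  have dyadic_diff_iff: "f x - 2 powi k * x \<in> dyadic \<longleftrightarrow> f x \<in> dyadic" if "x \<in> dyadic" for x k
  proof
    have *: "2 powi k * x \<in> dyadic" using that by (simp add: dyadic_powi_mult_iff)
    show "f x \<in> dyadic" if "f x - 2 powi k * x \<in> dyadic" using dyadic_add[OF that *] by simp
    show "f x - 2 powi k * x \<in> dyadic" if "f x \<in> dyadic" using dyadic_diff[OF that *] .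
  qed
  have Q: "Q x" if x: "0 \<le> x" "x < 1" for x
  proof -
    have "(0::real) \<le> 0 \<longrightarrow> x < 1 \<longrightarrow> (Q 0 \<longleftrightarrow> Q x)"
      using x(1)
    proof (induction rule: Bolzano[where P = "\<lambda>a b. 0 \<le> a \<longrightarrow> b < 1 \<longrightarrow> (Q a \<longleftrightarrow> Q b)"])
      case (trans a b c)
      then show ?case by auto
    next
      case (local z)
      then have z: "0 \<le> z" "z < 1" using x by simp_all
      obtain d where d: "d > 0"
        "z + d \<le> 1 \<and> (\<exists>k c. \<forall>y. z \<le> y \<longrightarrow> y \<le> z + d \<longrightarrow> f y = 2 powi k * y + c)"
        "0 < z \<longrightarrow> 0 \<le> z - d \<and> (\<exists>k c. \<forall>y. z - d \<le> y \<longrightarrow> y \<le> z \<longrightarrow> f y = 2 powi k * y + c)"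
        "0 < z \<and> z < 1 \<and> z \<notin> B \<longrightarrow> (\<exists>k c. \<forall>y. z - d \<le> y \<longrightarrow> y \<le> z + d \<longrightarrow> f y = 2 powi k * y + c)"
        using near[of z] z by auto
      have R: "Q z \<longleftrightarrow> Q b" if b: "z \<le> b" "b < z + d" for b
      proof -
        obtain k c where kc: "\<forall>y. z \<le> y \<longrightarrow> y \<le> z + d \<longrightarrow> f y = 2 powi k * y + c" using d(2) by blast
        have "germ 1 f z k" by (rule germR[OF d(1) kc])
        moreover have "germ 1 f b k" by (rule germR[of "z + d - b" _ _ c]) (use b kc in auto)
        moreover have "f z - 2 powi k * z = c" "f b - 2 powi k * b = c" using kc b d(1) by simp_all
        ultimately show ?thesis using Q_iff by simp
      qed
      have L: "Q a \<longleftrightarrow> Q z" if a: "0 \<le> a" "a < z" "z - d < a" for a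
      proof (cases "z \<in> B")
        case False
        then obtain k c where kc: "\<forall>y. z - d \<le> y \<longrightarrow> y \<le> z + d \<longrightarrow> f y = 2 powi k * y + c"
          using d(4) a z by auto
        have "germ 1 f z k" by (rule germR[OF d(1), of _ _ c]) (use kc d(1) in auto)
        moreover have "germ 1 f a k" by (rule germR[of "z + d - a" _ _ c]) (use a kc d(1) in auto)
        moreover have "f z - 2 powi k * z = c" "f a - 2 powi k * a = c" using kc a d(1) by simp_all
        ultimately show ?thesis using Q_iff by simp
      next
        case True
        obtain l c where lc: "\<forall>y. z - d \<le> y \<longrightarrow> y \<le> z \<longrightarrow> f y = 2 powi l * y + c"
          using d(3) a by auto
        obtain k c' where kc: "\<forall>y. z \<le> y \<longrightarrow> y \<le> z + d \<longrightarrow> f y = 2 powi k * y + c'" using d(2) by blast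
        have "germ 1 f a l" by (rule germR[of "z - a" _ _ c]) (use a lc in auto)
        moreover have "f z - 2 powi l * z = c" "f a - 2 powi l * a = c" using lc a d(1) by simp_all
        ultimately have "Q a \<longleftrightarrow> f z - 2 powi l * z \<in> dyadic" using Q_iff by simp
        also have "\<dots> \<longleftrightarrow> f z - 2 powi k * z \<in> dyadic"
          using dyadic_diff_iff[OF B_dyadic[OF True]] by simp
        also have "\<dots> \<longleftrightarrow> Q z" using Q_iff[OF germR[OF d(1) kc]] by simp
        finally show ?thesis .
      qed
      have "0 \<le> a \<longrightarrow> b < 1 \<longrightarrow> (Q a \<longleftrightarrow> Q b)" if "a \<le> z \<and> z \<le> b \<and> b - a < d" for a b
        using L[of a] R[of b] that by (cases "a = z") auto
      then show ?case using d(1) by blast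
    qed
    moreover have "Q 0"
    proof -
      obtain d k c where "d > 0" "\<forall>y. 0 \<le> y \<longrightarrow> y \<le> 0 + d \<longrightarrow> f y = 2 powi k * y + c"
        using near[of 0] by auto
      then have "germ 1 f 0 k" by (rule germR)
      then show ?thesis using Q_iff f0 by simp
    qed
    ultimately show ?thesis using x by simp
  qed
  have PL: "PL_at f x" for x
  proof -
    have germ_out: "germ (-1) f 0 0" "germ 1 f 1 0"
    proof -
      show "germ (-1) f 0 0"
      proof (rule germ_leftI[of 1])
        fix y :: real assume "0 - 1 \<le> y" "y \<le> 0"
        then show "f y = f 0 - 2 powi 0 * (0 - y)"
          by (cases "y = 0") (simp_all add: f0 f_out)
      qed simp
      show "germ 1 f 1 0"
      proof (rule germ_rightI[of 1])
        fix y :: real assume "1 \<le> y" "y \<le> 1 + 1"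
        then show "f y = f 1 + 2 powi 0 * (y - 1)"
          by (cases "y = 1") (simp_all add: f1 f_out)
      qed simp
    qed
    have right: "\<exists>k. germ 1 f x k \<and> f x - 2 powi k * x \<in> dyadic" if "0 \<le> x" "x < 1"
      using Q[OF that] by (simp add: Q_def)
    consider "x < 0" | "x > 1" | "x = 0" | "x = 1" | "0 < x" "x < 1" by linarith
    then show ?thesis
    proof cases
      case 1
      show ?thesis
        by (rule PL_at_cong[OF PL_at_id(2) open_lessThan[of 0]]) (use 1 in \<open>simp_all add: f_out\<close>)
    next
      case 2
      show ?thesis
        by (rule PL_at_cong[OF PL_at_id(2) open_greaterThan[of 1]]) (use 2 in \<open>simp_all add: f_out\<close>)
    next
      case 3
      then obtain k where "germ 1 f x k" using right by auto
      then show ?thesis unfolding PL_at_def using 3 f0 germ_out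
        by (intro exI[of _ k] exI[of _ 0]) simp
    next
      case 4
      obtain d k c where "d > 0" "\<forall>y. x - d \<le> y \<longrightarrow> y \<le> x \<longrightarrow> f y = 2 powi k * y + c"
        using near[of x] 4 by auto
      then have "germ (-1) f x k" by (rule germL)
      moreover have "f x - 2 powi k * x \<in> dyadic" "f x - 2 powi 0 * x \<in> dyadic"
        using dyadic_diff_iff[of x] 4 f1 by (simp_all add: dyadic_diff)
      ultimately show ?thesis unfolding PL_at_def using 4 germ_out
        by (intro exI[of _ 0] exI[of _ k]) simp
    next
      case 5
      obtain k where k: "germ 1 f x k" "f x - 2 powi k * x \<in> dyadic" using right 5 by auto
      obtain d where d: "d > 0"
        "(\<exists>k c. \<forall>y. x - d \<le> y \<longrightarrow> y \<le> x \<longrightarrow> f y = 2 powi k * y + c)"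
        "x \<notin> B \<longrightarrow> (\<exists>k c. \<forall>y. x - d \<le> y \<longrightarrow> y \<le> x + d \<longrightarrow> f y = 2 powi k * y + c)"
        using near[of x] 5 by auto
      show ?thesis
      proof (cases "x \<in> B")
        case True
        obtain l c where "\<forall>y. x - d \<le> y \<longrightarrow> y \<le> x \<longrightarrow> f y = 2 powi l * y + c" using d(2) by blast
        then have "germ (-1) f x l" by (rule germL[OF d(1)])
        moreover have "f x - 2 powi l * x \<in> dyadic"
          using dyadic_diff_iff[OF B_dyadic[OF True]] k(2) by simp
        ultimately show ?thesis unfolding PL_at_def using k B_dyadic[OF True] by blast
      next
        case False
        then obtain l c where lc: "\<forall>y. x - d \<le> y \<longrightarrow> y \<le> x + d \<longrightarrow> f y = 2 powi l * y + c"
          using d(3) by blast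
        have "germ (-1) f x l" by (rule germL[OF d(1), of _ _ c]) (use lc d(1) in auto)
        moreover have "germ 1 f x l" by (rule germR[OF d(1), of _ _ c]) (use lc d(1) in auto)
        moreover have "l = k" using germ_unique[OF \<open>germ 1 f x l\<close> k(1)] by simp
        ultimately show ?thesis unfolding PL_at_def using k by blast
      qed
    qed
  qed
  have f_fix: "f x = x" if "x \<notin> {0<..<1}" for x
  proof -
    consider "x = 0" | "x = 1" | "x < 0 \<or> x > 1" using \<open>x \<notin> {0<..<1}\<close> by fastforce
    then show ?thesis using f0 f1 f_out by cases blast+
  qed
  have "f \<in> PL_line" unfolding PL_line_def using mono surj PL by blast
  then have "f \<in> TF" unfolding TF_def using f_fix by blast
  moreover have "u = restr f"
  proof (rule ext)
    fix x
    show "u x = restr f x"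
    proof (cases "x \<in> {0..1}")
      case True
      then show ?thesis using fu[of x] by (simp add: restr_def)
    next
      case False
      then show ?thesis using extensional_arb[OF u(1) False] by (simp only: restr_def restrict_apply if_False)
    qed
  qed
  ultimately show ?thesis by (rule that)
qed

lemma carrier_thompson_F: "carrier thompson_F = restr ` TF"
proof (intro equalityI subsetI)
  fix u assume "u \<in> carrier thompson_F"
  then show "u \<in> restr ` TF" by (rule thompson_F_restr) blast
qed (use restr_thompson_F in blast)

lemma restr_inj: "inj_on restr TF"
proof (rule inj_onI)
  fix f g assume fg: "f \<in> TF" "g \<in> TF" "restr f = restr g"
  show "f = g"
  proof
    fix x
    show "f x = g x"
    proof (cases "x \<in> {0..1}")
      case True
      then show ?thesis using fun_cong[OF fg(3), of x] by (simp add: restr_def)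
    next
      case False
      then show ?thesis using TF_outside[OF fg(1), of x] TF_outside[OF fg(2), of x] by auto
    qed
  qed
qed

lemma restr_Bij:
  assumes "f \<in> TF" shows "restr f \<in> Bij {0..1}"
proof -
  have "bij_betw f {0..1} {0..1}"
    using inj_on_subset[OF PL_line_inj[OF TF_PL_line[OF assms]]] TF_image_unit[OF assms]
    by (intro bij_betw_imageI) simp_all
  then have "bij_betw (restr f) {0..1} {0..1}"
    by (subst bij_betw_cong[of "{0..1}" "restr f" f]) (simp_all add: restr_def)
  then show ?thesis by (simp add: Bij_def restr_def)
qed

lemma restr_mult:
  assumes "f \<in> TF" "g \<in> TF"
  shows "restr f \<otimes>\<^bsub>thompson_F\<^esub> restr g = restr (f \<circ> g)"
proof -
  have "restr f \<otimes>\<^bsub>thompson_F\<^esub> restr g = compose {0..1} (restr f) (restr g)"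
    using restr_Bij[OF assms(1)] restr_Bij[OF assms(2)] by (simp add: thompson_F_def BijGroup_def)
  also have "\<dots> = restr (f \<circ> g)"
  proof (rule ext)
    fix x :: real
    show "compose {0..1} (restr f) (restr g) x = restr (f \<circ> g) x"
      using TF_bounds[OF assms(2), of x] by (simp add: compose_def restr_def)
  qed
  finally show ?thesis .
qed

lemma restr_one: "\<one>\<^bsub>thompson_F\<^esub> = restr id"
  by (simp add: thompson_F_def BijGroup_def restr_def id_def)

lemma group_thompson_F: "group thompson_F"
proof (rule groupI)
  show "\<one>\<^bsub>thompson_F\<^esub> \<in> carrier thompson_F"
    unfolding restr_one by (rule restr_thompson_F[OF TF_id])
next
  fix x y assume "x \<in> carrier thompson_F" "y \<in> carrier thompson_F"
  then show "x \<otimes>\<^bsub>thompson_F\<^esub> y \<in> carrier thompson_F"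
    unfolding carrier_thompson_F by (auto simp: restr_mult TF_comp)
next
  fix x y z assume "x \<in> carrier thompson_F" "y \<in> carrier thompson_F" "z \<in> carrier thompson_F"
  then show "x \<otimes>\<^bsub>thompson_F\<^esub> y \<otimes>\<^bsub>thompson_F\<^esub> z = x \<otimes>\<^bsub>thompson_F\<^esub> (y \<otimes>\<^bsub>thompson_F\<^esub> z)"
    unfolding carrier_thompson_F by (auto simp: restr_mult TF_comp o_assoc)
next
  fix x assume "x \<in> carrier thompson_F"
  then show "\<one>\<^bsub>thompson_F\<^esub> \<otimes>\<^bsub>thompson_F\<^esub> x = x"
    unfolding carrier_thompson_F restr_one by (auto simp: restr_mult TF_id)
next
  fix x assume "x \<in> carrier thompson_F"
  then obtain f where f: "f \<in> TF" "x = restr f" unfolding carrier_thompson_F by blast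
  have "restr (finv f) \<otimes>\<^bsub>thompson_F\<^esub> x = \<one>\<^bsub>thompson_F\<^esub>"
    unfolding f(2) restr_one using f(1) by (simp add: restr_mult TF_finv finv_comp_self TF_PL_line)
  then show "\<exists>y\<in>carrier thompson_F. y \<otimes>\<^bsub>thompson_F\<^esub> x = \<one>\<^bsub>thompson_F\<^esub>"
    using restr_thompson_F[OF TF_finv[OF f(1)]] by blast
qed

lemma restr_inv: "f \<in> TF \<Longrightarrow> inv\<^bsub>thompson_F\<^esub> (restr f) = restr (finv f)"
  by (rule group.inv_equality[OF group_thompson_F])
    (simp_all add: restr_mult TF_finv restr_one restr_thompson_F finv_comp_self TF_PL_line)

lemma subgrp_restr:
  assumes "subgroup H thompson_F"
  shows "subgrp {f \<in> TF. restr f \<in> H}"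
  unfolding subgrp_def
proof (intro conjI ballI)
  interpret subgroup H thompson_F by (rule assms)
  show "id \<in> {f \<in> TF. restr f \<in> H}" using one_closed by (simp add: TF_id restr_one)
  fix f g assume "f \<in> {f \<in> TF. restr f \<in> H}" "g \<in> {f \<in> TF. restr f \<in> H}"
  then show "f \<circ> g \<in> {f \<in> TF. restr f \<in> H}"
    using m_closed[of "restr f" "restr g"] by (simp add: restr_mult TF_comp)
next
  interpret subgroup H thompson_F by (rule assms)
  fix f assume "f \<in> {f \<in> TF. restr f \<in> H}"
  then show "finv f \<in> {f \<in> TF. restr f \<in> H}"
    using m_inv_closed[of "restr f"] by (simp add: restr_inv TF_finv)
qed

lemma subgroup_restr:
  assumes "subgrp K" "K \<subseteq> TF"
  shows "subgroup (restr ` K) thompson_F"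
proof (rule group.subgroupI[OF group_thompson_F])
  show "restr ` K \<subseteq> carrier thompson_F" using assms(2) by (auto simp: carrier_thompson_F)
  show "restr ` K \<noteq> {}" using subgrpD(1)[OF assms(1)] by blast
  show "inv\<^bsub>thompson_F\<^esub> a \<in> restr ` K" if "a \<in> restr ` K" for a
    using that assms subgrpD(3)[OF assms(1)] by (auto simp: restr_inv subset_iff)
  show "a \<otimes>\<^bsub>thompson_F\<^esub> b \<in> restr ` K" if "a \<in> restr ` K" "b \<in> restr ` K" for a b
    using that assms subgrpD(2)[OF assms(1)] by (auto simp: restr_mult subset_iff)
qed

section \<open>A finite index copy of the group generated by two elements\<close>

text \<open>The derived subgroup is normal and contains the commutator of the generators, hence its normal
  closure.\<close>

lemma trivial_slopes_imp_derived:
  assumes "f \<in> TF_cpt"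
  shows "restr f \<in> derived thompson_F (carrier thompson_F)"
proof -
  interpret G: group thompson_F by (rule group_thompson_F)
  let ?D = "derived thompson_F (carrier thompson_F)"
  interpret D: normal ?D thompson_F by (rule G.derived_self_is_normal)
  let ?S = "{f \<in> TF. restr f \<in> ?D}"
  have S: "subgrp ?S" by (rule subgrp_restr[OF D.subgroup_axioms])
  have conj: "w \<circ> y \<circ> finv w \<in> ?S" if "w \<in> TF" "y \<in> ?S" for w y
    using D.inv_op_closed2[of "restr w" "restr y"] that
    by (simp add: restr_mult restr_inv TF_comp TF_finv restr_thompson_F)
  have "TF_cpt \<subseteq> ?S"
  proof (rule TF_cpt_subset_normal_closure[OF S])
    have "restr (finv (xgen 1)) \<otimes>\<^bsub>thompson_F\<^esub> restr (xgen 0) \<otimes>\<^bsub>thompson_F\<^esub>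
       inv\<^bsub>thompson_F\<^esub> restr (finv (xgen 1)) \<otimes>\<^bsub>thompson_F\<^esub> inv\<^bsub>thompson_F\<^esub> restr (xgen 0) \<in> ?D"
      unfolding derived_def using restr_thompson_F[OF TF_finv[OF xgen_TF]] restr_thompson_F[OF xgen_TF]
      by (intro generate.incl) blast
    then show "finv (xgen 1) \<circ> xgen 0 \<circ> xgen 1 \<circ> finv (xgen 0) \<in> ?S"
      by (simp add: restr_mult restr_inv TF_comp TF_finv xgen_TF finv_finv xgen_PL_line)
    fix i :: nat and y assume y: "y \<in> ?S"
    show "xgen i \<circ> y \<circ> finv (xgen i) \<in> ?S" by (rule conj[OF xgen_TF y])
    show "finv (xgen i) \<circ> y \<circ> xgen i \<in> ?S"
      using conj[OF TF_finv[OF xgen_TF] y] by (simp only: finv_finv[OF xgen_PL_line])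
  qed
  then show ?thesis using assms by blast
qed

theorem corollary4:
  fixes f :: "real \<Rightarrow> real"
  assumes "f \<in> carrier thompson_F"
    and "to_abelianization thompson_F f \<noteq> \<one>\<^bsub>abelianization thompson_F\<^esub>"
  shows "\<exists>g \<in> carrier thompson_F.
           thompson_F\<lparr>carrier := generate thompson_F {f, g}\<rparr> \<cong> thompson_F \<and>
           finite (rcosets\<^bsub>thompson_F\<^esub> (generate thompson_F {f, g}))"
proof -
  interpret G: group thompson_F by (rule group_thompson_F)
  obtain u where u: "u \<in> TF" "f = restr u" using assms(1) by (rule thompson_F_restr)
  let ?D = "derived thompson_F (carrier thompson_F)"
  interpret D: normal ?D thompson_F by (rule G.derived_self_is_normal)
  have "f \<notin> ?D"
  proof
    assume "f \<in> ?D"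
    then have "?D #>\<^bsub>thompson_F\<^esub> f = ?D"
      using G.coset_join2[OF assms(1) D.subgroup_axioms] by simp
    with assms(2) show False
      by (simp add: to_abelianization_def abelianization_def FactGroup_def)
  qed
  then have "slope0 u \<noteq> 0 \<or> slope1 u \<noteq> 0"
    using trivial_slopes_imp_derived[of u] u by (auto simp: TF_cpt_def)
  from TF_div_generated[OF u(1) this] obtain w p q where w: "w \<in> TF" "p > 0" "q > 0"
    "u \<in> TF_div p q" "w \<in> TF_div p q"
    and min: "\<And>H. subgrp H \<Longrightarrow> u \<in> H \<Longrightarrow> w \<in> H \<Longrightarrow> TF_div p q \<subseteq> H" by blast
  let ?K = "restr ` TF_div p q"
  have KTF: "TF_div p q \<subseteq> TF" by (auto simp: TF_div_def)
  have K: "subgroup ?K thompson_F" by (rule subgroup_restr[OF subgrp_TF_div KTF])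
  have fw: "{f, restr w} \<subseteq> carrier thompson_F" using u w by (simp add: restr_thompson_F)
  have gen: "generate thompson_F {f, restr w} = ?K"
  proof
    show "generate thompson_F {f, restr w} \<subseteq> ?K"
      by (rule G.generate_subgroup_incl[OF _ K]) (use u w in auto)
    let ?H = "generate thompson_F {f, restr w}"
    have "TF_div p q \<subseteq> {v \<in> TF. restr v \<in> ?H}"
    proof (rule min)
      show "subgrp {v \<in> TF. restr v \<in> ?H}"
        by (rule subgrp_restr[OF G.generate_is_subgroup[OF fw]])
    qed (use u w in \<open>auto intro: generate.incl\<close>)
    then show "?K \<subseteq> ?H" by blast
  qed
  obtain \<Phi> where \<Phi>: "bij_betw \<Phi> TF (TF_div p q)" "\<And>v z. v \<in> TF \<Longrightarrow> z \<in> TF \<Longrightarrow> \<Phi> (v \<circ> z) = \<Phi> v \<circ> \<Phi> z"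
    using TF_div_iso[OF w(2,3)] by blast
  have iso: "thompson_F \<cong> thompson_F\<lparr>carrier := ?K\<rparr>"
  proof -
    define e where "e = the_inv_into TF restr"
    have e: "e (restr v) = v" if "v \<in> TF" for v
      unfolding e_def by (rule the_inv_into_f_f[OF restr_inj that])
    have \<Phi>_TF: "\<Phi> v \<in> TF" "\<Phi> v \<in> TF_div p q" if "v \<in> TF" for v
      using \<Phi>(1) that KTF by (auto simp: bij_betw_def)
    define \<Theta> where "\<Theta> x = restr (\<Phi> (e x))" for x
    have "\<Theta> \<in> hom thompson_F (thompson_F\<lparr>carrier := ?K\<rparr>)"
      by (rule homI) (auto simp: carrier_thompson_F \<Theta>_def e \<Phi>_TF restr_mult TF_comp \<Phi>(2))
    moreover have "bij_betw \<Theta> (carrier thompson_F) ?K"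
    proof -
      have "bij_betw e (restr ` TF) TF"
        unfolding e_def by (rule bij_betw_the_inv_into) (simp add: bij_betw_def restr_inj)
      moreover have "bij_betw restr (TF_div p q) ?K"
        using inj_on_subset[OF restr_inj KTF] by (simp add: bij_betw_def)
      ultimately have "bij_betw (restr \<circ> (\<Phi> \<circ> e)) (restr ` TF) ?K"
        using \<Phi>(1) by (blast intro: bij_betw_trans)
      then show ?thesis unfolding carrier_thompson_F by (simp add: \<Theta>_def[abs_def] comp_def)
    qed
    ultimately show ?thesis by (intro is_isoI) (auto simp: iso_def)
  qed
  have "finite (rcosets\<^bsub>thompson_F\<^esub> ?K)"
  proof -
    \<comment> \<open>A coset is determined by the residues of the two slope exponents.\<close>
    define key where "key v = (slope0 v mod int p, slope1 v mod int q)" for v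
    have same: "?K #>\<^bsub>thompson_F\<^esub> restr v = ?K #>\<^bsub>thompson_F\<^esub> restr z"
      if v: "v \<in> TF" and z: "z \<in> TF" and eq: "key v = key z" for v z
    proof -
      have "slope0 v mod int p = slope0 z mod int p" "slope1 v mod int q = slope1 z mod int q"
        using eq by (simp_all add: key_def)
      then have "int p dvd slope0 v - slope0 z" "int q dvd slope1 v - slope1 z"
        by (simp_all only: mod_eq_dvd_iff)
      then have "v \<circ> finv z \<in> TF_div p q"
        using v z by (simp add: TF_div_def TF_comp TF_finv slope0_comp slope1_comp slope0_finv slope1_finv)
      moreover have "restr v = restr (v \<circ> finv z) \<otimes>\<^bsub>thompson_F\<^esub> restr z"
        unfolding restr_mult[OF TF_comp[OF v TF_finv[OF z]] z] o_assoc[symmetric]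
          finv_comp_self[OF TF_PL_line[OF z]] comp_id ..
      ultimately have "restr v \<in> ?K #>\<^bsub>thompson_F\<^esub> restr z"
        unfolding r_coset_def by blast
      then show ?thesis
        using G.repr_independence[OF _ restr_thompson_F[OF z] K] by simp
    qed
    define rep where "rep k = (SOME v. v \<in> TF \<and> key v = k)" for k
    have rep: "rep (key v) \<in> TF" "key (rep (key v)) = key v" if "v \<in> TF" for v
    proof -
      have "rep (key v) \<in> TF \<and> key (rep (key v)) = key v"
        unfolding rep_def by (rule someI[of _ v]) (use that in blast)
      then show "rep (key v) \<in> TF" "key (rep (key v)) = key v" by blast+
    qed
    have "rcosets\<^bsub>thompson_F\<^esub> ?K \<subseteq> (\<lambda>k. ?K #>\<^bsub>thompson_F\<^esub> restr (rep k)) ` ({0..<int p} \<times> {0..<int q})"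
    proof
      fix C assume "C \<in> rcosets\<^bsub>thompson_F\<^esub> ?K"
      then obtain v where v: "v \<in> TF" "C = ?K #>\<^bsub>thompson_F\<^esub> restr v"
        unfolding RCOSETS_def carrier_thompson_F by blast
      have "C = ?K #>\<^bsub>thompson_F\<^esub> restr (rep (key v))"
        unfolding v(2) by (rule same[OF v(1) rep(1)[OF v(1)] rep(2)[OF v(1), symmetric]])
      moreover have "key v \<in> {0..<int p} \<times> {0..<int q}"
        using w(2,3) by (simp add: key_def)
      ultimately show "C \<in> (\<lambda>k. ?K #>\<^bsub>thompson_F\<^esub> restr (rep k)) ` ({0..<int p} \<times> {0..<int q})"
        by (rule image_eqI)
    qed
    then show ?thesis by (rule finite_subset) simp
  qed
  then show ?thesis
    using G.iso_sym[OF iso] restr_thompson_F[OF w(1)] unfolding gen[symmetric] by blast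
qed

end
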